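(* Let $F$ be a natural bundle on $\mathcal{M}f_n$, $M$ an $n$-dimensional manifold, $G$ a Lie group with Lie algebra $\mathfrak g$, $P$ a principal $G$-bundle over $M$, and let ${}_cG$ denote $G$ with the conjugation action of $G$ on itself. For every section $a\in\Gamma(M,P\times_G\mathfrak g)$ and every fiber bundle map $h\colon F(M)\to P\times_G{}_cG$ over $M$, we have $$\pounds_{X^a}h=a\circ p_M-\mathrm{Ad}_{h^{-1}}(a),$$ where $p_M\colon F(M)\to M$ is the bundle projection.
   Context: All manifolds and maps are smooth. $\Phi^t_X$ denotes the (local) flow of a vector field $X$, defined at time $t$ on the open set $U^X_t$. Natural bundles. $\mathcal{M}f_n$ is the category of $n$-dimensional manifolds with local diffeomorphisms as morphisms. A natural bundle on $\mathcal{M}f_n$ is a functor $F$ from $\mathcal{M}f_n$ to smooth manifolds together with a natural transformation $p_M\colon F(M)\to M$ such that each $p_M$ is a fiber bundle and, for each morphism $f\colon M\to M'$, $F(f)$ covers $f$ and is a fiberwise diffeomorphism. For a vector field $X$ on $M$, its canonical lift $\mathcal F(X)$ is the unique vector field on $F(M)$ whose flow satisfies $U^{\mathcal F(X)}_t=\mathrm{Im}\,F(\iota_t)$ and $\Phi^t_{\mathcal F(X)}\circ F(\iota_t)=F(\iota_{-t})\circ F(\Phi^t_X)$, where $\iota_t\colon U^X_t\hookrightarrow M$ is the inclusion and $\Phi^t_X\colon U^X_t\to U^X_{-t}$. Associated bundles. For a manifold $N$ with left $G$-action, $P\times_G N=(P\times N)/G$ for the action $(p,y)g=(pg,g^{-1}y)$;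 classes are written $[p,y]$. For $p\in P_x$ and $z\in (P\times_G N)_x$, $p\backslash z\in N$ is the unique element with $z=[p,p\backslash z]$. $G$ acts on $\mathfrak g$ by the adjoint action. Darboux-Lie derivative. Let $\widetilde X$ be a $G$-invariant vector field on $P$ over the vector field $X$ on $M$, and let $\widetilde X_G$ be the vector field on $P\times_G{}_cG$ with flow $[p,g]\mapsto[\Phi^t_{\widetilde X}p,g]$. For a bundle map $h\colon F(M)\to P\times_G{}_cG$ over $\mathrm{id}_M$, the vector $T_yh(\mathcal F(X)_y)-(\widetilde X_G)_{h(y)}$ is vertical, hence of the form $\left.\frac{d}{dt}\right|_0[p,\gamma(t)]$ with $p\in P$ fixed and $\gamma$ a curve in $G$; then $\pounds_{\widetilde X}h(y)=[p,\omega_{MC}(\dot\gamma(0))]\in P\times_G\mathfrak g$, where $\omega_{MC}\colon TG\to\mathfrak g=T_eG$, $T_gG\ni Z\mapsto(T_eL_g)^{-1}(Z)$, is the left-invariant Maurer-Cartan form. Notation of the statement. For $a\in\Gamma(M,P\times_G\mathfrak g)$, $X^a$ is the $G$-invariant vertical vector field on $P$ with flow $\Phi^t_{X^a}p=p\exp((p\backslash a(x))t)$ for $x\in M$, $p\in P_x$. The map $h^{-1}\colon F(M)\to P\times_G{}_cG$ is the fiberwise group inverse (not the inverse map): $h^{-1}(y)=[p,(p\backslash h(y))^{-1}]$. For $h\colon F(M)\to P\times_G{}_cG$, $\mathrm{Ad}_h(a)\colon F(M)\to P\times_G\mathfrak g$ is $\mathrm{Ad}_h(a)(y)=[p,\mathrm{Ad}_{p\backslash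 h(y)}(p\backslash a(x))]$ for $y\in F(M)_x$ and any $p\in P_x$. *)

theory Defs
  imports "HOL-Analysis.Analysis" "HOL-Algebra.Group"
begin

section \<open>Model spaces\<close>

text \<open>
  The model space \<open>\<real>\<^sup>n\<close> is a finite-dimensional real inner product space. The class
  \<^class>\<open>euclidean_space\<close> forces positive dimension, so a slightly wider class is used, which
  also has a zero-dimensional instance (\<^typ>\<open>unit\<close>). Completeness follows from finite
  dimension and is only included for convenience.
\<close>

class model_space = real_inner + banach +
  assumes finite_dimensional: "\<exists>B. finite B \<and> (\<forall>x. \<exists>c. x = (\<Sum>b\<in>B. c b *\<^sub>R b))"

instance euclidean_space \<subseteq> model_space
  by standard (metis finite_Basis euclidean_representation)

instance prod :: (model_space, model_space) model_space
proof
  obtain A :: "'a set" where A: "finite A" "\<forall>x. \<exists>c. x = (\<Sum>b\<in>A. c b *\<^sub>R b)"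
    using finite_dimensional by blast
  obtain B :: "'b set" where B: "finite B" "\<forall>x. \<exists>c. x = (\<Sum>b\<in>B. c b *\<^sub>R b)"
    using finite_dimensional by blast
  let ?A = "(\<lambda>a. (a, 0::'b)) ` (A - {0})" and ?B = "(\<lambda>b. (0::'a, b)) ` B"
  have "\<exists>c. z = (\<Sum>b\<in>?A \<union> ?B. c b *\<^sub>R b)" for z :: "'a \<times> 'b"
  proof -
    obtain c where c: "fst z = (\<Sum>a\<in>A. c a *\<^sub>R a)" using A by blast
    obtain d where d: "snd z = (\<Sum>b\<in>B. d b *\<^sub>R b)" using B by blast
    let ?c = "\<lambda>x. if x \<in> ?A then c (fst x) else d (snd x)"
    have "(\<Sum>x\<in>?A \<union> ?B. ?c x *\<^sub>R x) = (\<Sum>x\<in>?A. ?c x *\<^sub>R x) + (\<Sum>x\<in>?B. ?c x *\<^sub>R x)"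
      using A(1) B(1) by (intro sum.union_disjoint) auto
    also have "(\<Sum>x\<in>?A. ?c x *\<^sub>R x) = (\<Sum>a\<in>A - {0}. (c a *\<^sub>R a, 0))"
      by (subst sum.reindex) (auto simp: inj_on_def intro!: sum.cong)
    also have "\<dots> = (\<Sum>a\<in>A. (c a *\<^sub>R a, 0))"
      using A(1) by (intro sum.mono_neutral_left) (auto simp: zero_prod_def)
    also have "(\<Sum>x\<in>?B. ?c x *\<^sub>R x) = (\<Sum>b\<in>B. (0, d b *\<^sub>R b))"
      by (subst sum.reindex) (auto simp: inj_on_def intro!: sum.cong)
    finally have "(\<Sum>x\<in>?A \<union> ?B. ?c x *\<^sub>R x) = z"
      using c d by (simp add: prod_eq_iff fst_sum snd_sum)
    then show ?thesis by (intro exI[of _ ?c]) (rule sym)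
  qed
  then show "\<exists>C::('a \<times> 'b) set. finite C \<and> (\<forall>x. \<exists>c. x = (\<Sum>b\<in>C. c b *\<^sub>R b))"
    using A(1) B(1) by (intro exI[of _ "?A \<union> ?B"]) auto
qed

instantiation unit :: real_inner
begin

definition zero_unit :: unit where "zero_unit = ()"
definition plus_unit :: "unit \<Rightarrow> unit \<Rightarrow> unit" where "plus_unit x y = ()"
definition minus_unit :: "unit \<Rightarrow> unit \<Rightarrow> unit" where "minus_unit x y = ()"
definition uminus_unit :: "unit \<Rightarrow> unit" where "uminus_unit x = ()"
definition scaleR_unit :: "real \<Rightarrow> unit \<Rightarrow> unit" where "scaleR_unit r x = ()"
definition inner_unit :: "unit \<Rightarrow> unit \<Rightarrow> real" where "inner_unit x y = 0"
definition norm_unit :: "unit \<Rightarrow> real" where "norm_unit x = 0"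
definition dist_unit :: "unit \<Rightarrow> unit \<Rightarrow> real" where "dist_unit x y = 0"
definition sgn_unit :: "unit \<Rightarrow> unit" where "sgn_unit x = ()"
definition uniformity_unit :: "(unit \<times> unit) filter" where
  "uniformity_unit = (INF e\<in>{0 <..}. principal {(x, y). dist x y < e})"
definition open_unit :: "unit set \<Rightarrow> bool" where
  "open_unit U = (\<forall>x\<in>U. eventually (\<lambda>(x', y). x' = x \<longrightarrow> y \<in> U) uniformity)"

instance
  by standard (auto simp: dist_unit_def norm_unit_def inner_unit_def sgn_unit_def
      uniformity_unit_def open_unit_def)

end

instance unit :: banach
proof
  fix X :: "nat \<Rightarrow> unit"
  have "X = (\<lambda>_. ())" by auto
  then show "convergent X"
    by (simp add: convergent_const)
qed

instance unit :: model_space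
  by standard (intro exI[of _ "{}"]; auto)

section \<open>Smooth maps between open subsets of model spaces\<close>

text \<open>For open \<open>S\<close>, \<open>Ck_on k S f\<close> says that \<open>f\<close> is \<open>k\<close> times continuously differentiable on \<open>S\<close>.\<close>

primrec Ck_on :: "nat \<Rightarrow> 'a::real_normed_vector set \<Rightarrow> ('a \<Rightarrow> 'b::real_normed_vector) \<Rightarrow> bool" where
  "Ck_on 0 S f \<longleftrightarrow> continuous_on S f"
| "Ck_on (Suc k) S f \<longleftrightarrow>
     (\<forall>x\<in>S. f differentiable (at x)) \<and> (\<forall>v. Ck_on k S (\<lambda>x. frechet_derivative f (at x) v))"

definition smooth_on :: "'a::real_normed_vector set \<Rightarrow> ('a \<Rightarrow> 'b::real_normed_vector) \<Rightarrow> bool" where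
  "smooth_on S f \<longleftrightarrow> (\<forall>k. Ck_on k S f)"

section \<open>Manifolds\<close>

text \<open>
  A chart is a pair of a domain and a coordinate map, whose values off the domain are
  irrelevant. A manifold is given by its maximal atlas: the points and the topology are
  recovered from the chart domains. Being maximal, the atlas determines the manifold
  structure uniquely, so equal manifolds are equal as objects of a category. The dimension is that
  of the model space \<^typ>\<open>'e\<close>.
\<close>

type_synonym ('a, 'e) chart = "'a set \<times> ('a \<Rightarrow> 'e)"
type_synonym ('a, 'e) manifold = "('a, 'e) chart set"

definition pts :: "('a, 'e) manifold \<Rightarrow> 'a set" where
  "pts M = \<Union>(fst ` M)"

definition man_top :: "('a, 'e) manifold \<Rightarrow> 'a topology" where
  "man_top M = topology_generated_by (fst ` M)"

definition transition ::
  "('a, 'e) chart \<Rightarrow> ('a, 'f) chart \<Rightarrow> 'e \<Rightarrow> 'f" where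
  "transition c d = snd d \<circ> inv_into (fst c) (snd c)"

definition compatible :: "('a, 'e::model_space) chart \<Rightarrow> ('a, 'e) chart \<Rightarrow> bool" where
  "compatible c d \<longleftrightarrow>
     open (snd c ` (fst c \<inter> fst d)) \<and> open (snd d ` (fst c \<inter> fst d)) \<and>
     smooth_on (snd c ` (fst c \<inter> fst d)) (transition c d) \<and>
     smooth_on (snd d ` (fst c \<inter> fst d)) (transition d c)"

definition max_atlas :: "('a, 'e::model_space) chart set \<Rightarrow> ('a, 'e) manifold" where
  "max_atlas A = {(U, \<phi>). U \<subseteq> \<Union>(fst ` A) \<and> inj_on \<phi> U \<and> open (\<phi> ` U) \<and>
     (\<forall>d\<in>A. compatible (U, \<phi>) d)}"

definition is_manifold :: "('a, 'e::model_space) manifold \<Rightarrow> bool" where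
  "is_manifold M \<longleftrightarrow>
     max_atlas M = M \<and> Hausdorff_space (man_top M) \<and> second_countable (man_top M)"

definition smooth_map ::
  "('a, 'e::model_space) manifold \<Rightarrow> ('b, 'f::model_space) manifold \<Rightarrow> ('a \<Rightarrow> 'b) \<Rightarrow> bool" where
  "smooth_map M N f \<longleftrightarrow> continuous_map (man_top M) (man_top N) f \<and>
     (\<forall>(U, \<phi>)\<in>M. \<forall>(V, \<psi>)\<in>N.
        smooth_on (\<phi> ` {x \<in> U. f x \<in> V}) (\<psi> \<circ> f \<circ> inv_into U \<phi>))"

definition diffeo ::
  "('a, 'e::model_space) manifold \<Rightarrow> ('b, 'f::model_space) manifold \<Rightarrow> ('a \<Rightarrow> 'b) \<Rightarrow> bool" where
  "diffeo M N f \<longleftrightarrow> bij_betw f (pts M) (pts N) \<and>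
     smooth_map M N f \<and> smooth_map N M (inv_into (pts M) f)"

definition open_sub :: "('a, 'e) manifold \<Rightarrow> 'a set \<Rightarrow> ('a, 'e) manifold" where
  "open_sub M U = {c \<in> M. fst c \<subseteq> U}"

definition prod_man ::
  "('a, 'e::model_space) manifold \<Rightarrow> ('b, 'f::model_space) manifold \<Rightarrow> ('a \<times> 'b, 'e \<times> 'f) manifold" where
  "prod_man M N = max_atlas {(U \<times> V, map_prod \<phi> \<psi>) | U \<phi> V \<psi>. (U, \<phi>) \<in> M \<and> (V, \<psi>) \<in> N}"

definition line :: "(real, real) manifold" where
  "line = max_atlas {(UNIV, id)}"

definition local_diffeo ::
  "('a, 'e::model_space) manifold \<Rightarrow> ('a, 'e) manifold \<Rightarrow> ('a \<Rightarrow> 'a) \<Rightarrow> bool" where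
  "local_diffeo M N f \<longleftrightarrow> f \<in> pts M \<rightarrow> pts N \<and>
     (\<forall>x\<in>pts M. \<exists>U. x \<in> U \<and> openin (man_top M) U \<and> openin (man_top N) (f ` U) \<and>
        diffeo (open_sub M U) (open_sub N (f ` U)) f)"

section \<open>Tangent vectors, vector fields, flows\<close>

text \<open>
  A tangent vector at \<open>p\<close> is the family of its coordinate vectors with respect to all charts at
  \<open>p\<close>, related by the derivatives of the transition maps. At all other charts the value is 0 by
  convention, so that tangent spaces are vector spaces under pointwise operations.
\<close>

type_synonym ('a, 'e) tangent = "('a, 'e) chart \<Rightarrow> 'e"

definition charts_at :: "('a, 'e) manifold \<Rightarrow> 'a \<Rightarrow> ('a, 'e) chart set" where
  "charts_at M p = {c \<in> M. p \<in> fst c}"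

definition tangent_space :: "('a, 'e::model_space) manifold \<Rightarrow> 'a \<Rightarrow> ('a, 'e) tangent set" where
  "tangent_space M p = {v.
     (\<forall>c. c \<notin> charts_at M p \<longrightarrow> v c = 0) \<and>
     (\<forall>c\<in>charts_at M p. \<forall>d\<in>charts_at M p.
        v d = frechet_derivative (transition c d) (at (snd c p)) (v c))}"

definition tzero :: "('a, 'e::model_space) tangent" where
  "tzero = (\<lambda>c. 0)"

definition tminus ::
  "('a, 'e::model_space) tangent \<Rightarrow> ('a, 'e) tangent \<Rightarrow> ('a, 'e) tangent" where
  "tminus v w = (\<lambda>c. v c - w c)"

definition tscale :: "real \<Rightarrow> ('a, 'e::model_space) tangent \<Rightarrow> ('a, 'e) tangent" where
  "tscale r v = (\<lambda>c. r *\<^sub>R v c)"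

text \<open>The tangent map \<open>T\<^sub>p f\<close>; the choice of the chart \<open>c\<close> does not matter.\<close>

definition tangent_map ::
  "('a, 'e::model_space) manifold \<Rightarrow> ('b, 'f::model_space) manifold \<Rightarrow> ('a \<Rightarrow> 'b) \<Rightarrow> 'a
     \<Rightarrow> ('a, 'e) tangent \<Rightarrow> ('b, 'f) tangent" where
  "tangent_map M N f p v =
     (let c = (SOME c. c \<in> charts_at M p)
      in (\<lambda>d. if d \<in> charts_at N (f p)
              then frechet_derivative (snd d \<circ> f \<circ> inv_into (fst c) (snd c)) (at (snd c p)) (v c)
              else 0))"

definition has_velocity ::
  "('a, 'e::model_space) manifold \<Rightarrow> (real \<Rightarrow> 'a) \<Rightarrow> ('a, 'e) tangent \<Rightarrow> real \<Rightarrow> bool" where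
  "has_velocity M \<gamma> v t \<longleftrightarrow> \<gamma> t \<in> pts M \<and> v \<in> tangent_space M (\<gamma> t) \<and>
     (\<forall>c\<in>charts_at M (\<gamma> t). (\<forall>\<^sub>F s in nhds t. \<gamma> s \<in> fst c) \<and>
        ((snd c \<circ> \<gamma>) has_vector_derivative v c) (at t))"

definition velocity ::
  "('a, 'e::model_space) manifold \<Rightarrow> (real \<Rightarrow> 'a) \<Rightarrow> real \<Rightarrow> ('a, 'e) tangent" where
  "velocity M \<gamma> t = (THE v. has_velocity M \<gamma> v t)"

text \<open>Off \<open>M\<close> vector fields are 0 by convention, so that a vector field is determined by its
  values on \<open>M\<close>.\<close>

definition vector_field ::
  "('a, 'e::model_space) manifold \<Rightarrow> ('a \<Rightarrow> ('a, 'e) tangent) \<Rightarrow> bool" where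
  "vector_field M X \<longleftrightarrow> (\<forall>p\<in>pts M. X p \<in> tangent_space M p) \<and> (\<forall>p. p \<notin> pts M \<longrightarrow> X p = tzero) \<and>
     (\<forall>(U, \<phi>)\<in>M. smooth_on (\<phi> ` U) (\<lambda>u. X (inv_into U \<phi> u) (U, \<phi>)))"

definition integral_curve ::
  "('a, 'e::model_space) manifold \<Rightarrow> ('a \<Rightarrow> ('a, 'e) tangent) \<Rightarrow> real set \<Rightarrow> (real \<Rightarrow> 'a) \<Rightarrow> bool" where
  "integral_curve M X I \<gamma> \<longleftrightarrow>
     open I \<and> is_interval I \<and> (\<forall>t\<in>I. has_velocity M \<gamma> (X (\<gamma> t)) t)"

definition flow_dom ::
  "('a, 'e::model_space) manifold \<Rightarrow> ('a \<Rightarrow> ('a, 'e) tangent) \<Rightarrow> real \<Rightarrow> 'a set" where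
  "flow_dom M X t =
     {x \<in> pts M. \<exists>I \<gamma>. integral_curve M X I \<gamma> \<and> 0 \<in> I \<and> t \<in> I \<and> \<gamma> 0 = x}"

definition flow ::
  "('a, 'e::model_space) manifold \<Rightarrow> ('a \<Rightarrow> ('a, 'e) tangent) \<Rightarrow> real \<Rightarrow> 'a \<Rightarrow> 'a" where
  "flow M X t x =
     (THE y. \<exists>I \<gamma>. integral_curve M X I \<gamma> \<and> 0 \<in> I \<and> t \<in> I \<and> \<gamma> 0 = x \<and> \<gamma> t = y)"

section \<open>Natural bundles\<close>

text \<open>Local trivialization \<open>p\<^sup>-\<^sup>1(U) \<cong> U \<times> S\<close> with second component \<open>\<tau>\<close>.\<close>

definition local_triv ::
  "('s, 'd::model_space) manifold \<Rightarrow> ('f, 'k::model_space) manifold \<Rightarrow> ('m, 'e::model_space) manifold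
     \<Rightarrow> ('f \<Rightarrow> 'm) \<Rightarrow> 'm set \<Rightarrow> ('f \<Rightarrow> 's) \<Rightarrow> bool" where
  "local_triv S E M p U \<tau> \<longleftrightarrow> openin (man_top M) U \<and>
     diffeo (open_sub E {z \<in> pts E. p z \<in> U}) (prod_man (open_sub M U) S) (\<lambda>z. (p z, \<tau> z))"

definition fiber_bundle ::
  "('s, 'd::model_space) manifold \<Rightarrow> ('f, 'k::model_space) manifold \<Rightarrow> ('m, 'e::model_space) manifold
     \<Rightarrow> ('f \<Rightarrow> 'm) \<Rightarrow> bool" where
  "fiber_bundle S E M p \<longleftrightarrow> is_manifold S \<and> is_manifold E \<and> is_manifold M \<and> smooth_map E M p \<and>
     (\<forall>x\<in>pts M. \<exists>U \<tau>. x \<in> U \<and> local_triv S E M p U \<tau>)"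

definition fibre_man ::
  "('s, 'd::model_space) manifold \<Rightarrow> ('f, 'k::model_space) manifold \<Rightarrow> ('m, 'e::model_space) manifold
     \<Rightarrow> ('f \<Rightarrow> 'm) \<Rightarrow> 'm \<Rightarrow> ('f, 'd) manifold" where
  "fibre_man S E M p x = max_atlas
     {({z \<in> pts E. p z = x \<and> \<tau> z \<in> V}, \<xi> \<circ> \<tau>) | U \<tau> V \<xi>.
        x \<in> U \<and> local_triv S E M p U \<tau> \<and> (V, \<xi>) \<in> S}"

text \<open>
  Data of a functor on the category of manifolds modelled on \<^typ>\<open>'e\<close> and local diffeomorphisms:
  \<open>nb_mor F M M' f\<close> is \<open>F(f) : F(M) \<rightarrow> F(M')\<close> for \<open>f : M \<rightarrow> M'\<close>. The universe of base manifolds is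
  that of all manifolds whose points are taken from the arbitrary type \<^typ>\<open>'m\<close>; it is closed under
  open submanifolds.
\<close>

record ('m, 'e, 'f, 'k) functor_data =
  nb_obj :: "('m, 'e) manifold \<Rightarrow> ('f, 'k) manifold"
  nb_mor :: "('m, 'e) manifold \<Rightarrow> ('m, 'e) manifold \<Rightarrow> ('m \<Rightarrow> 'm) \<Rightarrow> 'f \<Rightarrow> 'f"
  nb_proj :: "('m, 'e) manifold \<Rightarrow> 'f \<Rightarrow> 'm"

text \<open>\<open>S\<close> is the standard fibre. By naturality it is the same for all base manifolds.\<close>

definition natural_bundle ::
  "('s, 'd::model_space) manifold \<Rightarrow> ('m, 'e::model_space, 'f, 'k::model_space) functor_data \<Rightarrow> bool" where
  "natural_bundle S F \<longleftrightarrow>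
     (\<forall>M. is_manifold M \<longrightarrow> fiber_bundle S (nb_obj F M) M (nb_proj F M)) \<and>
     (\<forall>M N f. is_manifold M \<and> is_manifold N \<and> local_diffeo M N f \<longrightarrow>
        smooth_map (nb_obj F M) (nb_obj F N) (nb_mor F M N f) \<and>
        (\<forall>z\<in>pts (nb_obj F M). nb_proj F N (nb_mor F M N f z) = f (nb_proj F M z)) \<and>
        (\<forall>x\<in>pts M. diffeo (fibre_man S (nb_obj F M) M (nb_proj F M) x)
                          (fibre_man S (nb_obj F N) N (nb_proj F N) (f x)) (nb_mor F M N f))) \<and>
     (\<forall>M N f g. is_manifold M \<and> is_manifold N \<and> local_diffeo M N f \<and> (\<forall>x\<in>pts M. f x = g x) \<longrightarrow>
        (\<forall>z\<in>pts (nb_obj F M). nb_mor F M N f z = nb_mor F M N g z)) \<and>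
     (\<forall>M. is_manifold M \<longrightarrow> (\<forall>z\<in>pts (nb_obj F M). nb_mor F M M id z = z)) \<and>
     (\<forall>L M N f g. is_manifold L \<and> is_manifold M \<and> is_manifold N \<and>
        local_diffeo L M f \<and> local_diffeo M N g \<longrightarrow>
        (\<forall>z\<in>pts (nb_obj F L). nb_mor F L N (g \<circ> f) z = nb_mor F M N g (nb_mor F L M f z)))"

text \<open>Here \<open>U t\<close> is the open submanifold on which the time-\<open>t\<close> flow of \<open>X\<close> is defined and
  \<open>\<iota> t\<close> is \<open>F\<close> applied to its inclusion into \<open>M\<close>.\<close>

definition canonical_lift ::
  "('m, 'e::model_space, 'f, 'k::model_space) functor_data \<Rightarrow> ('m, 'e) manifold
     \<Rightarrow> ('m \<Rightarrow> ('m, 'e) tangent) \<Rightarrow> 'f \<Rightarrow> ('f, 'k) tangent" where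
  "canonical_lift F M X =
     (let U = (\<lambda>t. open_sub M (flow_dom M X t)); \<iota> = (\<lambda>t. nb_mor F (U t) M id)
      in THE Y. vector_field (nb_obj F M) Y \<and>
           (\<forall>t. flow_dom (nb_obj F M) Y t = \<iota> t ` pts (nb_obj F (U t))) \<and>
           (\<forall>t. \<forall>z\<in>pts (nb_obj F (U t)).
              flow (nb_obj F M) Y t (\<iota> t z) = \<iota> (- t) (nb_mor F (U t) (U (- t)) (flow M X t) z)))"

section \<open>Lie groups\<close>

record ('g, 'l) lie_group = "'g monoid" +
  mfd :: "('g, 'l) manifold"

definition is_lie_group :: "('g, 'l::model_space) lie_group \<Rightarrow> bool" where
  "is_lie_group G \<longleftrightarrow> group G \<and> is_manifold (mfd G) \<and> pts (mfd G) = carrier G \<and>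
     smooth_map (prod_man (mfd G) (mfd G)) (mfd G) (\<lambda>(g, k). g \<otimes>\<^bsub>G\<^esub> k) \<and>
     smooth_map (mfd G) (mfd G) (\<lambda>g. inv\<^bsub>G\<^esub> g)"

definition lie_algebra :: "('g, 'l::model_space) lie_group \<Rightarrow> ('g, 'l) tangent set" where
  "lie_algebra G = tangent_space (mfd G) \<one>\<^bsub>G\<^esub>"

text \<open>The manifold structure of the vector space \<open>lie_algebra G\<close>; taking coordinates in a chart
  at the unit is a linear isomorphism onto the model space.\<close>

definition lie_algebra_man ::
  "('g, 'l::model_space) lie_group \<Rightarrow> (('g, 'l) tangent, 'l) manifold" where
  "lie_algebra_man G = max_atlas {(lie_algebra G, \<lambda>v. v c) | c. c \<in> charts_at (mfd G) \<one>\<^bsub>G\<^esub>}"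

definition conj_act :: "('g, 'l) lie_group \<Rightarrow> 'g \<Rightarrow> 'g \<Rightarrow> 'g" where
  "conj_act G g k = g \<otimes>\<^bsub>G\<^esub> k \<otimes>\<^bsub>G\<^esub> inv\<^bsub>G\<^esub> g"

definition Ad ::
  "('g, 'l::model_space) lie_group \<Rightarrow> 'g \<Rightarrow> ('g, 'l) tangent \<Rightarrow> ('g, 'l) tangent" where
  "Ad G g = tangent_map (mfd G) (mfd G) (conj_act G g) \<one>\<^bsub>G\<^esub>"

definition left_field ::
  "('g, 'l::model_space) lie_group \<Rightarrow> ('g, 'l) tangent \<Rightarrow> 'g \<Rightarrow> ('g, 'l) tangent" where
  "left_field G \<alpha> g = tangent_map (mfd G) (mfd G) (\<lambda>k. g \<otimes>\<^bsub>G\<^esub> k) \<one>\<^bsub>G\<^esub> \<alpha>"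

definition lie_exp :: "('g, 'l::model_space) lie_group \<Rightarrow> ('g, 'l) tangent \<Rightarrow> 'g" where
  "lie_exp G \<alpha> = flow (mfd G) (left_field G \<alpha>) 1 \<one>\<^bsub>G\<^esub>"

definition maurer_cartan ::
  "('g, 'l::model_space) lie_group \<Rightarrow> 'g \<Rightarrow> ('g, 'l) tangent \<Rightarrow> ('g, 'l) tangent" where
  "maurer_cartan G g =
     inv_into (lie_algebra G) (tangent_map (mfd G) (mfd G) (\<lambda>k. g \<otimes>\<^bsub>G\<^esub> k) \<one>\<^bsub>G\<^esub>)"

section \<open>Principal and associated bundles\<close>

record ('p, 'q, 'm, 'g) principal_data =
  tot :: "('p, 'q) manifold"
  prj :: "'p \<Rightarrow> 'm"
  ract :: "'p \<Rightarrow> 'g \<Rightarrow> 'p"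

definition principal_bundle ::
  "('g, 'l::model_space) lie_group \<Rightarrow> ('m, 'e::model_space) manifold
     \<Rightarrow> ('p, 'q::model_space, 'm, 'g) principal_data \<Rightarrow> bool" where
  "principal_bundle G M P \<longleftrightarrow> is_lie_group G \<and> is_manifold M \<and> is_manifold (tot P) \<and>
     smooth_map (tot P) M (prj P) \<and>
     smooth_map (prod_man (tot P) (mfd G)) (tot P) (\<lambda>(p, g). ract P p g) \<and>
     (\<forall>p\<in>pts (tot P). ract P p \<one>\<^bsub>G\<^esub> = p) \<and>
     (\<forall>p\<in>pts (tot P). \<forall>g\<in>carrier G. \<forall>k\<in>carrier G.
        ract P (ract P p g) k = ract P p (g \<otimes>\<^bsub>G\<^esub> k)) \<and>
     (\<forall>p\<in>pts (tot P). \<forall>g\<in>carrier G. prj P (ract P p g) = prj P p) \<and>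
     (\<forall>x\<in>pts M. \<exists>U \<tau>. x \<in> U \<and> local_triv (mfd G) (tot P) M (prj P) U \<tau> \<and>
        (\<forall>p\<in>pts (tot P). \<forall>g\<in>carrier G. prj P p \<in> U \<longrightarrow> \<tau> (ract P p g) = \<tau> p \<otimes>\<^bsub>G\<^esub> g))"

text \<open>A manifold with a left action of the group.\<close>

type_synonym ('g, 'y, 'w) gspace = "('y, 'w) manifold \<times> ('g \<Rightarrow> 'y \<Rightarrow> 'y)"

definition conj_space :: "('g, 'l) lie_group \<Rightarrow> ('g, 'g, 'l) gspace" where
  "conj_space G = (mfd G, conj_act G)"

definition adj_space :: "('g, 'l::model_space) lie_group \<Rightarrow> ('g, ('g, 'l) tangent, 'l) gspace" where
  "adj_space G = (lie_algebra_man G, Ad G)"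

text \<open>The class \<open>[p, y]\<close>, i.e. the orbit of \<open>(p, y)\<close> under \<open>(p, y)g = (pg, g\<^sup>-\<^sup>1y)\<close>.\<close>

definition cls ::
  "('g, 'l) lie_group \<Rightarrow> ('p, 'q, 'm, 'g) principal_data \<Rightarrow> ('g, 'y, 'w) gspace
     \<Rightarrow> 'p \<Rightarrow> 'y \<Rightarrow> ('p \<times> 'y) set" where
  "cls G P N p y = {(ract P p g, snd N (inv\<^bsub>G\<^esub> g) y) | g. g \<in> carrier G}"

definition assoc_prj :: "('p, 'q, 'm, 'g) principal_data \<Rightarrow> ('p \<times> 'y) set \<Rightarrow> 'm" where
  "assoc_prj P z = (THE x. \<exists>p y. (p, y) \<in> z \<and> x = prj P p)"

text \<open>\<open>bslash G P N p z\<close> is \<open>p\z\<close>.\<close>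

definition bslash ::
  "('g, 'l) lie_group \<Rightarrow> ('p, 'q, 'm, 'g) principal_data \<Rightarrow> ('g, 'y, 'w) gspace
     \<Rightarrow> 'p \<Rightarrow> ('p \<times> 'y) set \<Rightarrow> 'y" where
  "bslash G P N p z = (THE y. y \<in> pts (fst N) \<and> z = cls G P N p y)"

text \<open>The manifold \<open>P \<times>\<^sub>G N\<close>: a local section \<open>s\<close> of \<open>P\<close> over \<open>U\<close> induces the trivialization
  \<open>[s(x), y] \<mapsto> (x, y)\<close>, which is composed with charts of the base and of \<open>N\<close>.\<close>

definition assoc_man ::
  "('g, 'l) lie_group \<Rightarrow> ('m, 'e::model_space) manifold \<Rightarrow> ('p, 'q::model_space, 'm, 'g) principal_data
     \<Rightarrow> ('g, 'y, 'w::model_space) gspace \<Rightarrow> (('p \<times> 'y) set, 'e \<times> 'w) manifold" where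
  "assoc_man G M P N = max_atlas
     {({cls G P N (s x) y | x y. x \<in> U \<and> y \<in> V},
       \<lambda>z. (\<phi> (assoc_prj P z), \<psi> (bslash G P N (s (assoc_prj P z)) z))) | U \<phi> V \<psi> s.
        (U, \<phi>) \<in> M \<and> (V, \<psi>) \<in> fst N \<and>
        smooth_map (open_sub M U) (tot P) s \<and> (\<forall>x\<in>U. prj P (s x) = x)}"

definition assoc_section ::
  "('g, 'l) lie_group \<Rightarrow> ('m, 'e::model_space) manifold \<Rightarrow> ('p, 'q::model_space, 'm, 'g) principal_data
     \<Rightarrow> ('g, 'y, 'w::model_space) gspace \<Rightarrow> ('m \<Rightarrow> ('p \<times> 'y) set) \<Rightarrow> bool" where
  "assoc_section G M P N a \<longleftrightarrow>
     smooth_map M (assoc_man G M P N) a \<and> (\<forall>x\<in>pts M. assoc_prj P (a x) = x)"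

text \<open>Fibre bundle maps over the identity of \<open>M\<close> from \<open>E\<close> with projection \<open>\<pi>\<close> to \<open>P \<times>\<^sub>G N\<close>.\<close>

definition bundle_map ::
  "('g, 'l) lie_group \<Rightarrow> ('m, 'e::model_space) manifold \<Rightarrow> ('p, 'q::model_space, 'm, 'g) principal_data
     \<Rightarrow> ('g, 'y, 'w::model_space) gspace \<Rightarrow> ('f, 'k::model_space) manifold \<Rightarrow> ('f \<Rightarrow> 'm)
     \<Rightarrow> ('f \<Rightarrow> ('p \<times> 'y) set) \<Rightarrow> bool" where
  "bundle_map G M P N E \<pi> h \<longleftrightarrow>
     smooth_map E (assoc_man G M P N) h \<and> (\<forall>y\<in>pts E. assoc_prj P (h y) = \<pi> y)"

text \<open>
  A chosen element of the fibre \<open>P\<^sub>x\<close>. The constructions below which are computed from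
  \<open>p \<in> P\<^sub>x\<close> are, by equivariance, independent of the choice of \<open>p\<close>.
\<close>

definition frame :: "('p, 'q, 'm, 'g) principal_data \<Rightarrow> 'm \<Rightarrow> 'p" where
  "frame P x = (SOME p. p \<in> pts (tot P) \<and> prj P p = x)"

text \<open>Subtraction in the vector bundle \<open>P \<times>\<^sub>G \<gg>\<close>, for two elements of the same fibre.\<close>

definition ad_minus ::
  "('g, 'l::model_space) lie_group \<Rightarrow> ('p, 'q, 'm, 'g) principal_data
     \<Rightarrow> ('p \<times> ('g, 'l) tangent) set \<Rightarrow> ('p \<times> ('g, 'l) tangent) set
     \<Rightarrow> ('p \<times> ('g, 'l) tangent) set" where
  "ad_minus G P z w =
     (let p = frame P (assoc_prj P z)
      in cls G P (adj_space G) p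
           (tminus (bslash G P (adj_space G) p z) (bslash G P (adj_space G) p w)))"

definition fibre_inv ::
  "('g, 'l) lie_group \<Rightarrow> ('p, 'q, 'm, 'g) principal_data
     \<Rightarrow> ('f \<Rightarrow> ('p \<times> 'g) set) \<Rightarrow> 'f \<Rightarrow> ('p \<times> 'g) set" where
  "fibre_inv G P h y =
     (let p = frame P (assoc_prj P (h y))
      in cls G P (conj_space G) p (inv\<^bsub>G\<^esub> (bslash G P (conj_space G) p (h y))))"

definition Ad_map ::
  "('g, 'l::model_space) lie_group \<Rightarrow> ('p, 'q, 'm, 'g) principal_data
     \<Rightarrow> ('f \<Rightarrow> ('p \<times> 'g) set) \<Rightarrow> ('m \<Rightarrow> ('p \<times> ('g, 'l) tangent) set)
     \<Rightarrow> 'f \<Rightarrow> ('p \<times> ('g, 'l) tangent) set" where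
  "Ad_map G P h a y =
     (let x = assoc_prj P (h y); p = frame P x
      in cls G P (adj_space G) p
           (Ad G (bslash G P (conj_space G) p (h y)) (bslash G P (adj_space G) p (a x))))"

section \<open>The Darboux--Lie derivative\<close>

text \<open>The vector fields \<open>X\<^sup>a\<close> on \<open>P\<close> and \<open>X\<^sub>G\<close> on \<open>P \<times>\<^sub>G G\<close> are the
  infinitesimal generators of the flows \<open>p \<mapsto> p exp((p\a(x))t)\<close> and
  \<open>[p, g] \<mapsto> [\<Phi>\<^sup>t p, g]\<close>, where \<open>\<Phi>\<^sup>t\<close> is the flow of \<open>X\<close>.\<close>

definition gauge_field ::
  "('g, 'l::model_space) lie_group \<Rightarrow> ('p, 'q::model_space, 'm, 'g) principal_data
     \<Rightarrow> ('m \<Rightarrow> ('p \<times> ('g, 'l) tangent) set) \<Rightarrow> 'p \<Rightarrow> ('p, 'q) tangent" where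
  "gauge_field G P a p =
     velocity (tot P)
       (\<lambda>t. ract P p (lie_exp G (tscale t (bslash G P (adj_space G) p (a (prj P p)))))) 0"

definition assoc_field ::
  "('g, 'l::model_space) lie_group \<Rightarrow> ('m, 'e::model_space) manifold
     \<Rightarrow> ('p, 'q::model_space, 'm, 'g) principal_data \<Rightarrow> ('p \<Rightarrow> ('p, 'q) tangent)
     \<Rightarrow> ('p \<times> 'g) set \<Rightarrow> (('p \<times> 'g) set, 'e \<times> 'l) tangent" where
  "assoc_field G M P X z =
     (let p = frame P (assoc_prj P z); g = bslash G P (conj_space G) p z
      in velocity (assoc_man G M P (conj_space G))
           (\<lambda>t. cls G P (conj_space G) (flow (tot P) X t p) g) 0)"

text \<open>The vector field on \<open>M\<close> under an invariant vector field on \<open>P\<close>.\<close>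

definition base_field ::
  "('m, 'e::model_space) manifold \<Rightarrow> ('p, 'q::model_space, 'm, 'g) principal_data
     \<Rightarrow> ('p \<Rightarrow> ('p, 'q) tangent) \<Rightarrow> 'm \<Rightarrow> ('m, 'e) tangent" where
  "base_field M P X x =
     (if x \<in> pts M then tangent_map (tot P) M (prj P) (frame P x) (X (frame P x)) else tzero)"

text \<open>
  The value at \<open>y\<close> of the derivative of \<open>h : F(M) \<rightarrow> P \<times>\<^sub>G G\<close> along an invariant vector field
  \<open>X\<close> on \<open>P\<close>: \<open>W\<close> is the vertical vector \<open>T\<^sub>yh(\<F>(X)\<^sub>y) - (X\<^sub>G)\<^bsub>h(y)\<^esub>\<close>, and \<open>Z\<close> is the velocity
  at \<open>0\<close> of a curve \<open>\<gamma>\<close> in \<open>G\<close> such that \<open>W\<close> is the velocity of \<open>[p, \<gamma>(t)]\<close>.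
\<close>

definition darboux_lie ::
  "('m, 'e::model_space, 'f, 'k::model_space) functor_data \<Rightarrow> ('g, 'l::model_space) lie_group
     \<Rightarrow> ('m, 'e) manifold \<Rightarrow> ('p, 'q::model_space, 'm, 'g) principal_data
     \<Rightarrow> ('p \<Rightarrow> ('p, 'q) tangent) \<Rightarrow> ('f \<Rightarrow> ('p \<times> 'g) set)
     \<Rightarrow> 'f \<Rightarrow> ('p \<times> ('g, 'l) tangent) set" where
  "darboux_lie F G M P X h y =
     (let N = conj_space G;
          Q = assoc_man G M P N;
          p = frame P (nb_proj F M y);
          g = bslash G P N p (h y);
          W = tminus (tangent_map (nb_obj F M) Q h y (canonical_lift F M (base_field M P X) y))
                     (assoc_field G M P X (h y));
          Z = (THE Z. \<exists>I \<gamma>. open I \<and> is_interval I \<and> 0 \<in> I \<and>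
                 smooth_map (open_sub line I) (mfd G) \<gamma> \<and> \<gamma> 0 = g \<and>
                 has_velocity (mfd G) \<gamma> Z 0 \<and> has_velocity Q (\<lambda>t. cls G P N p (\<gamma> t)) W 0)
      in cls G P (adj_space G) p (maurer_cartan G g Z))"

end

theory Submission
  imports Defs
begin

text \<open>
  The field \<open>X\<^sup>a\<close> is vertical, so it covers the zero field on \<open>M\<close>. The zero field has the
  identity as its flow, and a vector field on \<open>F(M)\<close> with identity flow vanishes; hence the canonical
  lift is zero and only \<open>-X\<^sub>G\<close> contributes to the derivative. With \<open>\<alpha> = p\a(x)\<close> and
  \<open>g = p\h(y)\<close>, the flow of \<open>X\<^sub>G\<close> through \<open>h(y) = [p, g]\<close> is
  \<open>[p exp(t\<alpha>), g] = [p, exp(t\<alpha>) g exp(-t\<alpha>)]\<close>, whose fibre component is \<open>g\<close> times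
  \<open>(g\<^sup>-\<^sup>1 exp(t\<alpha>) g) exp(-t\<alpha>)\<close>. Its logarithmic velocity at \<open>0\<close> is
  \<open>Ad(g\<^sup>-\<^sup>1)\<alpha> - \<alpha>\<close>, and the sign change gives \<open>\<alpha> - Ad(g\<^sup>-\<^sup>1)\<alpha>\<close>.
\<close>

section \<open>Smooth maps between model spaces\<close>

text \<open>The objects compared are definite descriptions: \<open>flow\<close>,
  \<open>velocity\<close>, \<open>canonical_lift\<close> and the vector \<open>Z\<close> of
  \<open>darboux_lie\<close>. Each must be shown to exist and to be unique before its formula can be
  used. For the zero field and for left-invariant fields this is uniqueness of integral curves of
  locally Lipschitz fields; the exponential also needs completeness, obtained by doubling local
  solutions. The flow of \<open>gauge_field\<close> is found inside one fibre, by solving the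
  equation in \<open>G\<close>. The manifold of [p, g] is a second obstacle: it is a maximal atlas
  over charts whose mutual compatibility is not established. Hence the weak notion
  \<open>smooth_atlas\<close>, which every \<open>max_atlas\<close> of injective charts satisfies.
  Only first-order data at one point enter the formula, hence the pointwise notion
  \<open>mdiff\<close>, and velocities of curves in place of computations with tangent maps.
  Uniqueness of \<open>Z\<close> comes from a left inverse of the fibre inclusion g \<mapsto> [p, g]
  that is differentiable at h(y). Both sides are evaluated in the same frame p, which reduces the
  claim to an identity in the Lie algebra.\<close>

lemma model_space_orthonormal_basis:
  obtains B :: "'a::model_space set"
  where "finite B" "\<And>b. b \<in> B \<Longrightarrow> norm b = 1" "\<And>x. (\<Sum>b\<in>B. (x \<bullet> b) *\<^sub>R b) = x"
proof -
  obtain A :: "'a set" where A: "finite A" "\<forall>x. \<exists>c. x = (\<Sum>b\<in>A. c b *\<^sub>R b)"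
    using finite_dimensional by blast
  \<comment> \<open>The class only provides a finite spanning set. Gram-Schmidt keeps its span, and
    the zero vectors it may produce are removed in \<open>D\<close>.\<close>
  obtain C where C: "finite C" "span C = span A" "pairwise orthogonal C"
    using basis_orthogonal[OF A(1)] by blast
  have spanA: "span A = UNIV"
  proof -
    have "x \<in> span A" for x
    proof -
      obtain c where "x = (\<Sum>b\<in>A. c b *\<^sub>R b)" using A by blast
      then show ?thesis by (simp add: span_sum span_scale span_base)
    qed
    then show ?thesis by auto
  qed
  define D where "D = C - {0}"
  define B where "B = (\<lambda>x. x /\<^sub>R norm x) ` D"
  have D: "finite D" "pairwise orthogonal D" "span D = UNIV"
    using C spanA by (auto simp: D_def pairwise_def)
  have exp: "x = (\<Sum>d\<in>D. ((x \<bullet> d) / (d \<bullet> d)) *\<^sub>R d)" for x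
  proof -
    have "x \<in> span D" using D by simp
    then obtain u where u: "x = (\<Sum>v\<in>D. u v *\<^sub>R v)"
      using D(1) by (auto simp: span_finite)
    have "(x \<bullet> d) / (d \<bullet> d) = u d" if "d \<in> D" for d
    proof -
      have "x \<bullet> d = (\<Sum>v\<in>D. u v * (v \<bullet> d))"
        by (simp add: u inner_sum_left)
      also have "\<dots> = (\<Sum>v\<in>D. if v = d then u d * (d \<bullet> d) else 0)"
        using D(2) that by (intro sum.cong) (auto simp: pairwise_def orthogonal_def)
      also have "\<dots> = u d * (d \<bullet> d)" using D(1) that by simp
      finally show ?thesis using that by (simp add: D_def)
    qed
    then show ?thesis using u by simp
  qed
  \<comment> \<open>Needed to reindex the sum over \<open>B\<close> as a sum over \<open>D\<close>:
    distinct orthogonal vectors with the same normalization would give a unit vector orthogonal to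
    itself.\<close>
  have inj: "inj_on (\<lambda>x. x /\<^sub>R norm x) D"
  proof (rule inj_onI)
    fix x y assume xy: "x \<in> D" "y \<in> D" "x /\<^sub>R norm x = y /\<^sub>R norm y"
    show "x = y"
    proof (rule ccontr)
      assume "x \<noteq> y"
      then have "x \<bullet> y = 0" using D(2) xy by (auto simp: pairwise_def orthogonal_def)
      then have "(x /\<^sub>R norm x) \<bullet> (y /\<^sub>R norm y) = 0" by simp
      then have "(x /\<^sub>R norm x) \<bullet> (x /\<^sub>R norm x) = 0" using xy(3) by simp
      then show False using xy(1) by (simp add: D_def)
    qed
  qed
  show thesis
  proof (rule that[of B])
    show "finite B" using D by (simp add: B_def)
    show "norm b = 1" if "b \<in> B" for b using that by (auto simp: B_def D_def field_simps split: if_splits)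
    show "(\<Sum>b\<in>B. (x \<bullet> b) *\<^sub>R b) = x" for x
    proof -
      have "(\<Sum>b\<in>B. (x \<bullet> b) *\<^sub>R b) = (\<Sum>d\<in>D. ((x \<bullet> d) / (d \<bullet> d)) *\<^sub>R d)"
        unfolding B_def sum.reindex[OF inj]
        by (intro sum.cong) (auto simp: field_simps power2_norm_eq_inner[symmetric] power2_eq_square)
      then show ?thesis using exp[of x] by simp
    qed
  qed
qed

lemma frechet_derivative_eqI:
  "(f has_derivative D) (at x) \<Longrightarrow> frechet_derivative f (at x) v = D v"
  by (metis frechet_derivative_at)

section \<open>Calculus of k times continuously differentiable maps\<close>

lemma Ck_on_subset: "Ck_on k S f \<Longrightarrow> T \<subseteq> S \<Longrightarrow> Ck_on k T f"
  by (induction k arbitrary: f) (auto intro: continuous_on_subset)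

lemma frechet_derivative_cong_open:
  assumes "open S" "x \<in> S" "\<And>y. y \<in> S \<Longrightarrow> f y = g y"
  shows "frechet_derivative f (at x) = frechet_derivative g (at x)"
    and "f differentiable at x \<longleftrightarrow> g differentiable at x"
proof -
  have *: "(f has_derivative D) (at x) \<longleftrightarrow> (g has_derivative D) (at x)" for D
    using assms by (metis has_derivative_transform_within_open)
  show "frechet_derivative f (at x) = frechet_derivative g (at x)"
    by (simp add: frechet_derivative_def *)
  show "f differentiable at x \<longleftrightarrow> g differentiable at x"
    by (simp add: differentiable_def *)
qed

text \<open>The derivative at a point of \<open>S\<close> sees the values near that point, and these
  lie in \<open>S\<close> because \<open>S\<close> is open.\<close>

lemma Ck_on_cong:
  assumes "open S" "\<And>x. x \<in> S \<Longrightarrow> f x = g x" "Ck_on k S f"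
  shows "Ck_on k S g"
  using assms(2,3)
proof (induction k arbitrary: f g)
  case 0
  have "continuous_on S f \<longleftrightarrow> continuous_on S g"
    by (rule continuous_on_cong[OF refl 0(1)])
  then show ?case using 0(2) by simp
next
  case (Suc k)
  have eq: "frechet_derivative f (at x) = frechet_derivative g (at x) \<and> (f differentiable at x \<longleftrightarrow> g differentiable at x)"
    if "x \<in> S" for x
    using frechet_derivative_cong_open[OF assms(1) that, of f g] Suc.prems(1) by simp
  have "Ck_on k S (\<lambda>x. frechet_derivative g (at x) v)" for v
  proof (rule Suc.IH)
    show "Ck_on k S (\<lambda>x. frechet_derivative f (at x) v)" using Suc.prems(2) by simp
    show "\<And>x. x \<in> S \<Longrightarrow> frechet_derivative f (at x) v = frechet_derivative g (at x) v"
      using eq by simp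
  qed
  moreover have "\<forall>x\<in>S. g differentiable at x"
    using eq Suc.prems(2) unfolding Ck_on.simps by blast
  ultimately show ?case by simp
qed

lemma Ck_on_SucD: "Ck_on (Suc k) S f \<Longrightarrow> Ck_on k S f"
proof (induction k arbitrary: f)
  case 0
  then show ?case
    by (auto intro!: continuous_at_imp_continuous_on differentiable_imp_continuous_within)
next
  case (Suc k)
  then show ?case using Ck_on.simps(2)[of "Suc k" S f] Ck_on.simps(2)[of k S f] by blast
qed

lemma Ck_on_local:
  assumes "\<And>x. x \<in> S \<Longrightarrow> \<exists>T. open T \<and> x \<in> T \<and> Ck_on k T f"
  shows "Ck_on k S f"
  using assms
proof (induction k arbitrary: f)
  case 0
  then show ?case
    by (auto intro!: continuous_at_imp_continuous_on) (metis continuous_on_eq_continuous_at)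
next
  case (Suc k)
  show ?case
    unfolding Ck_on.simps
  proof (intro conjI ballI allI)
    show "f differentiable at x" if "x \<in> S" for x
      using Suc.prems[OF that] by auto
    show "Ck_on k S (\<lambda>x. frechet_derivative f (at x) v)" for v
      using Suc.prems by (intro Suc.IH) fastforce
  qed
qed

lemma Ck_on_const [simp]: "Ck_on k S (\<lambda>x. c)"
  by (induction k arbitrary: c) auto

lemma Ck_on_bounded_linear:
  assumes "bounded_linear f" shows "Ck_on k S f"
proof (cases k)
  case 0
  then show ?thesis using assms by (simp add: linear_continuous_on)
next
  case (Suc n)
  have "frechet_derivative f (at x) = f" for x
    using bounded_linear_imp_has_derivative[OF assms] frechet_derivative_at by metis
  then show ?thesis
    using assms Suc bounded_linear_imp_differentiable by auto
qed

lemma Ck_on_bounded_linear_comp: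
  assumes "open S" "bounded_linear L" "Ck_on k S f"
  shows "Ck_on k S (\<lambda>x. L (f x))"
  using assms(3)
proof (induction k arbitrary: f)
  case 0
  then show ?case using assms(2) by (simp add: bounded_linear.continuous_on)
next
  case (Suc k)
  have D: "((\<lambda>x. L (f x)) has_derivative (\<lambda>v. L (frechet_derivative f (at x) v))) (at x)"
    if "x \<in> S" for x
    using Suc.prems that
    by (intro bounded_linear.has_derivative[OF assms(2)]) (simp add: frechet_derivative_works)
  have "Ck_on k S (\<lambda>x. frechet_derivative (\<lambda>x. L (f x)) (at x) v)" for v
  proof (rule Ck_on_cong[OF assms(1)])
    show "Ck_on k S (\<lambda>x. L (frechet_derivative f (at x) v))"
      using Suc by simp
  qed (simp add: frechet_derivative_eqI[OF D])
  then show ?case using D by (auto simp: differentiable_def)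
qed

lemma Ck_on_add:
  assumes "open S" "Ck_on k S f" "Ck_on k S g"
  shows "Ck_on k S (\<lambda>x. f x + g x)"
  using assms(2,3)
proof (induction k arbitrary: f g)
  case 0
  then show ?case by (simp add: continuous_on_add)
next
  case (Suc k)
  have D: "((\<lambda>x. f x + g x) has_derivative
      (\<lambda>v. frechet_derivative f (at x) v + frechet_derivative g (at x) v)) (at x)"
    if "x \<in> S" for x
    using Suc.prems that by (intro has_derivative_add) (simp_all add: frechet_derivative_works)
  have "Ck_on k S (\<lambda>x. frechet_derivative (\<lambda>x. f x + g x) (at x) v)" for v
  proof (rule Ck_on_cong[OF assms(1)])
    show "Ck_on k S (\<lambda>x. frechet_derivative f (at x) v + frechet_derivative g (at x) v)"
      using Suc by simp
  qed (simp add: frechet_derivative_eqI[OF D])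
  then show ?case using D by (auto simp: differentiable_def)
qed

text \<open>The Leibniz rule leaves undifferentiated factors; \<open>Ck_on_SucD\<close> lowers their
  order so that the induction hypothesis applies.\<close>

lemma Ck_on_scaleR:
  fixes f :: "'a::real_normed_vector \<Rightarrow> real"
  assumes "open S" "Ck_on k S f" "Ck_on k S g"
  shows "Ck_on k S (\<lambda>x. f x *\<^sub>R g x)"
  using assms(2,3)
proof (induction k arbitrary: f g)
  case 0
  then show ?case by (simp add: continuous_on_scaleR)
next
  case (Suc k)
  have D: "((\<lambda>x. f x *\<^sub>R g x) has_derivative
      (\<lambda>v. f x *\<^sub>R frechet_derivative g (at x) v + frechet_derivative f (at x) v *\<^sub>R g x)) (at x)"
    if "x \<in> S" for x
    using Suc.prems that by (intro has_derivative_scaleR) (simp_all add: frechet_derivative_works)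
  have "Ck_on k S (\<lambda>x. frechet_derivative (\<lambda>x. f x *\<^sub>R g x) (at x) v)" for v
  proof (rule Ck_on_cong[OF assms(1)])
    show "Ck_on k S (\<lambda>x. f x *\<^sub>R frechet_derivative g (at x) v + frechet_derivative f (at x) v *\<^sub>R g x)"
      using Suc.prems Ck_on_SucD[OF Suc.prems(1)] Ck_on_SucD[OF Suc.prems(2)]
      by (intro Ck_on_add[OF assms(1)] Suc.IH) auto
  qed (simp add: frechet_derivative_eqI[OF D])
  then show ?case using D by (auto simp: differentiable_def)
qed

lemma Ck_on_sum:
  assumes "open S" "\<And>i. i \<in> I \<Longrightarrow> Ck_on k S (f i)"
  shows "Ck_on k S (\<lambda>x. \<Sum>i\<in>I. f i x)"
  using assms(2)
  by (induction I rule: infinite_finite_induct) (auto intro: Ck_on_add[OF assms(1)])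

text \<open>The chain rule yields g'(f x)(f'(x) v), where the direction f'(x) v varies with x, while
  \<open>Ck_on\<close> speaks of fixed directions only. Expansion in an orthonormal basis of the
  middle space turns this into a finite sum of scalar functions times derivatives of
  \<open>g\<close> in fixed directions, to which the induction applies.\<close>

lemma Ck_on_compose:
  fixes f :: "'a::real_normed_vector \<Rightarrow> 'b::model_space" and g :: "'b \<Rightarrow> 'c::real_normed_vector"
  assumes "open S" "open T" "f ` S \<subseteq> T" "Ck_on k S f" "Ck_on k T g"
  shows "Ck_on k S (\<lambda>x. g (f x))"
  using assms(4,5)
proof (induction k arbitrary: g)
  case 0
  then show ?case using assms(3) by (auto intro: continuous_on_compose2)
next
  case (Suc k)
  obtain B :: "'b set" where B: "finite B" "\<And>b. b \<in> B \<Longrightarrow> norm b = 1" "\<And>x. (\<Sum>b\<in>B. (x \<bullet> b) *\<^sub>R b) = x"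
    by (rule model_space_orthonormal_basis) (rule that)
  let ?f' = "\<lambda>x. frechet_derivative f (at x)" and ?g' = "\<lambda>y. frechet_derivative g (at y)"
  have D: "((\<lambda>x. g (f x)) has_derivative (\<lambda>v. ?g' (f x) (?f' x v))) (at x)" if "x \<in> S" for x
  proof -
    have "(f has_derivative ?f' x) (at x)" "(g has_derivative ?g' (f x)) (at (f x))"
      using Suc.prems that assms(3) by (auto simp: frechet_derivative_works[symmetric])
    then show ?thesis by (rule has_derivative_compose)
  qed
  have lin: "?g' (f x) w = (\<Sum>b\<in>B. (w \<bullet> b) *\<^sub>R ?g' (f x) b)" if "x \<in> S" for x w
  proof -
    have "linear (?g' (f x))"
      using Suc.prems(2) that assms(3) by (intro linear_frechet_derivative) auto
    then have "?g' (f x) (\<Sum>b\<in>B. (w \<bullet> b) *\<^sub>R b) = (\<Sum>b\<in>B. (w \<bullet> b) *\<^sub>R ?g' (f x) b)"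
      by (simp add: linear_sum linear_scale)
    then show ?thesis using B(3)[of w] by simp
  qed
  have "Ck_on k S (\<lambda>x. frechet_derivative (\<lambda>x. g (f x)) (at x) v)" for v
  proof (rule Ck_on_cong[OF assms(1)])
    show "Ck_on k S (\<lambda>x. \<Sum>b\<in>B. (?f' x v \<bullet> b) *\<^sub>R ?g' (f x) b)"
    proof (intro Ck_on_sum Ck_on_scaleR assms(1))
      fix b assume "b \<in> B"
      show "Ck_on k S (\<lambda>x. ?f' x v \<bullet> b)"
        by (rule Ck_on_bounded_linear_comp[OF assms(1) bounded_linear_inner_left])
          (use Suc.prems in simp)
      show "Ck_on k S (\<lambda>x. ?g' (f x) b)"
        by (rule Suc.IH) (use Suc.prems Ck_on_SucD[OF Suc.prems(1)] in auto)
    qed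
  qed (simp add: frechet_derivative_eqI[OF D] lin)
  then show ?case using D by (auto simp: differentiable_def)
qed

text \<open>A directional derivative of a product map is again a product map, with the two
  components of the direction in the factors, so the induction closes on this form.\<close>

lemma Ck_on_map_prod:
  assumes "open S" "open T" "Ck_on k S f" "Ck_on k T g"
  shows "Ck_on k (S \<times> T) (map_prod f g)"
  using assms(3,4)
proof (induction k arbitrary: f g)
  case 0
  have "continuous_on (S \<times> T) (\<lambda>z. (f (fst z), g (snd z)))"
    using 0 by (auto intro!: continuous_on_Pair
        intro: continuous_on_compose2[OF _ continuous_on_fst[OF continuous_on_id]]
        continuous_on_compose2[OF _ continuous_on_snd[OF continuous_on_id]])
  then show ?case by (simp add: map_prod_def case_prod_beta')
next
  case (Suc k)
  let ?f' = "\<lambda>x. frechet_derivative f (at x)" and ?g' = "\<lambda>y. frechet_derivative g (at y)"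
  have D: "(map_prod f g has_derivative (\<lambda>v. (?f' (fst z) (fst v), ?g' (snd z) (snd v)))) (at z)"
    if "z \<in> S \<times> T" for z
  proof -
    have "(f has_derivative ?f' (fst z)) (at (fst z))" "(g has_derivative ?g' (snd z)) (at (snd z))"
      using Suc.prems that by (auto simp: frechet_derivative_works)
    then have "((\<lambda>z. (f (fst z), g (snd z))) has_derivative
        (\<lambda>v. (?f' (fst z) (fst v), ?g' (snd z) (snd v)))) (at z)"
      by (intro has_derivative_Pair has_derivative_compose[OF bounded_linear_imp_has_derivative[OF bounded_linear_fst]]
          has_derivative_compose[OF bounded_linear_imp_has_derivative[OF bounded_linear_snd]])
    then show ?thesis by (simp add: map_prod_def case_prod_beta')
  qed
  have "Ck_on k (S \<times> T) (\<lambda>x. frechet_derivative (map_prod f g) (at x) v)" for v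
  proof (rule Ck_on_cong[OF open_Times[OF assms(1,2)]])
    show "Ck_on k (S \<times> T) (map_prod (\<lambda>x. ?f' x (fst v)) (\<lambda>y. ?g' y (snd v)))"
      using Suc by simp
  qed (auto simp: frechet_derivative_eqI[OF D])
  then show ?case using D unfolding Ck_on.simps differentiable_def by blast
qed

text \<open>The mean value inequality on a ball where the derivative is bounded. It supplies the
  local Lipschitz condition for integral curves.\<close>

lemma Ck_on_Suc_lipschitz:
  fixes f :: "'a::model_space \<Rightarrow> 'b::real_normed_vector"
  assumes "open S" "x \<in> S" "Ck_on (Suc 0) S f"
  obtains r L where "r > 0" "ball x r \<subseteq> S" "L-lipschitz_on (ball x r) f"
proof -
  obtain B :: "'a set" where B: "finite B" "\<And>b. b \<in> B \<Longrightarrow> norm b = 1"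
      "\<And>x. (\<Sum>b\<in>B. (x \<bullet> b) *\<^sub>R b) = x"
    by (rule model_space_orthonormal_basis) (rule that)
  let ?f' = "\<lambda>x. frechet_derivative f (at x)"
  \<comment> \<open>Continuous in \<open>y\<close>, since the derivatives in fixed directions are,
    and an upper bound for the operator norm by Cauchy-Schwarz.\<close>
  define h where "h y = (\<Sum>b\<in>B. norm (?f' y b))" for y
  have "continuous_on S h"
    unfolding h_def using assms(3) by (intro continuous_intros) auto
  then have "isCont h x" using assms(1,2) by (simp add: continuous_on_eq_continuous_at)
  then have "\<forall>\<^sub>F y in nhds x. h y < h x + 1"
    unfolding isCont_def tendsto_at_iff_tendsto_nhds by (rule order_tendstoD) simp
  moreover have "\<forall>\<^sub>F y in nhds x. y \<in> S" using assms eventually_nhds by blast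
  ultimately have "\<forall>\<^sub>F y in nhds x. h y < h x + 1 \<and> y \<in> S" by eventually_elim simp
  then obtain r where r: "r > 0" "\<And>y. dist y x < r \<Longrightarrow> h y < h x + 1 \<and> y \<in> S"
    unfolding eventually_nhds_metric by blast
  define L where "L = h x + 1"
  have "h x \<ge> 0" by (simp add: h_def sum_nonneg)
  have on: "onorm (?f' y) \<le> L" and der: "(f has_derivative ?f' y) (at y within ball x r)" if "y \<in> ball x r" for y
  proof -
    have y: "h y < h x + 1" "y \<in> S" using r(2)[of y] that by (auto simp: dist_commute)
    then have d: "(f has_derivative ?f' y) (at y)"
      using assms(3) by (simp add: frechet_derivative_works)
    then show "(f has_derivative ?f' y) (at y within ball x r)" by (rule has_derivative_at_withinI)
    have lin: "linear (?f' y)" using d has_derivative_linear by blast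
    have "norm (?f' y v) \<le> L * norm v" for v
    proof -
      have "?f' y (\<Sum>b\<in>B. (v \<bullet> b) *\<^sub>R b) = (\<Sum>b\<in>B. (v \<bullet> b) *\<^sub>R ?f' y b)"
        by (simp add: linear_sum[OF lin] linear_scale[OF lin])
      then have "?f' y v = (\<Sum>b\<in>B. (v \<bullet> b) *\<^sub>R ?f' y b)" using B(3)[of v] by simp
      also have "norm \<dots> \<le> (\<Sum>b\<in>B. \<bar>v \<bullet> b\<bar> * norm (?f' y b))"
        by (rule order_trans[OF norm_sum]) simp
      also have "\<dots> \<le> (\<Sum>b\<in>B. norm v * norm (?f' y b))"
      proof (intro sum_mono mult_right_mono)
        fix b assume "b \<in> B"
        then show "\<bar>v \<bullet> b\<bar> \<le> norm v" using Cauchy_Schwarz_ineq2[of v b] B(2) by simp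
      qed simp
      also have "\<dots> = h y * norm v" by (simp add: h_def sum_distrib_left mult.commute)
      also have "\<dots> \<le> L * norm v" using y by (intro mult_right_mono) (auto simp: L_def)
      finally show ?thesis .
    qed
    then show "onorm (?f' y) \<le> L" using \<open>h x \<ge> 0\<close> by (intro onorm_bound) (auto simp: L_def)
  qed
  have "L-lipschitz_on (ball x r) f"
  proof (rule lipschitz_onI)
    fix y z assume yz: "y \<in> ball x r" "z \<in> ball x r"
    show "dist (f y) (f z) \<le> L * dist y z"
      unfolding dist_norm
      by (rule differentiable_bound[OF convex_ball der on yz])
  qed (use \<open>h x \<ge> 0\<close> L_def in simp)
  moreover have "ball x r \<subseteq> S" using r(2) by (auto simp: dist_commute)
  ultimately show thesis using r(1) that by blast
qed

lemma smooth_on_differentiable: "smooth_on S f \<Longrightarrow> x \<in> S \<Longrightarrow> f differentiable at x"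
  unfolding smooth_on_def using Ck_on.simps(2)[of 0 S f] by blast

lemma smooth_on_compose:
  fixes f :: "'a::real_normed_vector \<Rightarrow> 'b::model_space"
  assumes "open S" "open T" "f ` S \<subseteq> T" "smooth_on S f" "smooth_on T g"
  shows "smooth_on S (\<lambda>x. g (f x))"
  using assms Ck_on_compose unfolding smooth_on_def by blast

lemma smooth_on_cong:
  "open S \<Longrightarrow> (\<And>x. x \<in> S \<Longrightarrow> f x = g x) \<Longrightarrow> smooth_on S f \<Longrightarrow> smooth_on S g"
  unfolding smooth_on_def by (metis Ck_on_cong)

lemma smooth_on_subset: "smooth_on S f \<Longrightarrow> T \<subseteq> S \<Longrightarrow> smooth_on T f"
  unfolding smooth_on_def by (metis Ck_on_subset)

lemma smooth_on_local:
  "(\<And>x. x \<in> S \<Longrightarrow> \<exists>T. open T \<and> x \<in> T \<and> smooth_on T f) \<Longrightarrow> smooth_on S f"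
  unfolding smooth_on_def by (meson Ck_on_local)

lemma smooth_on_bounded_linear: "bounded_linear f \<Longrightarrow> smooth_on S f"
  by (simp add: smooth_on_def Ck_on_bounded_linear)

lemma smooth_on_const: "smooth_on S (\<lambda>x. c)"
  by (simp add: smooth_on_def)

lemma smooth_on_add:
  "open S \<Longrightarrow> smooth_on S f \<Longrightarrow> smooth_on S g \<Longrightarrow> smooth_on S (\<lambda>x. f x + g x)"
  by (simp add: smooth_on_def Ck_on_add)

lemma smooth_on_map_prod:
  "open S \<Longrightarrow> open T \<Longrightarrow> smooth_on S f \<Longrightarrow> smooth_on T g \<Longrightarrow> smooth_on (S \<times> T) (map_prod f g)"
  by (simp add: smooth_on_def Ck_on_map_prod)

section \<open>Maximal atlases\<close>

abbreviation chart_inv :: "('a, 'e) chart \<Rightarrow> 'e \<Rightarrow> 'a" where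
  "chart_inv c \<equiv> inv_into (fst c) (snd c)"

text \<open>What remains of \<open>is_manifold\<close> without maximality and the topological
  axioms. It holds for the maximal atlas of any family of injective charts, hence for products, the
  line and associated bundles alike.\<close>

definition smooth_atlas :: "('a, 'e::model_space) manifold \<Rightarrow> bool" where
  "smooth_atlas M \<longleftrightarrow> (\<forall>c\<in>M. inj_on (snd c) (fst c) \<and> open (snd c ` fst c)) \<and>
     (\<forall>c\<in>M. \<forall>d\<in>M. compatible c d)"

lemma transition_apply:
  "inj_on (snd c) (fst c) \<Longrightarrow> x \<in> fst c \<Longrightarrow> transition c d (snd c x) = snd d x"
  by (simp add: transition_def)

lemma compatible_sym: "compatible c d \<Longrightarrow> compatible d c"
  by (simp add: compatible_def Int_commute)

lemma compatible_smooth: "compatible c d \<Longrightarrow> smooth_on (snd c ` (fst c \<inter> fst d)) (transition c d)"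
  by (simp add: compatible_def)

lemma open_preimage_continuous_on:
  assumes "open S" "open T" "continuous_on S f"
  shows "open {x \<in> S. f x \<in> T}"
proof -
  have "open (f -` T \<inter> S)"
    using continuous_on_open_vimage[OF assms(1), of f] assms(2,3) by blast
  moreover have "{x \<in> S. f x \<in> T} = f -` T \<inter> S" by auto
  ultimately show ?thesis by simp
qed

lemma smooth_on_continuous: "smooth_on S f \<Longrightarrow> continuous_on S f"
  unfolding smooth_on_def by (metis Ck_on.simps(1))

text \<open>In the coordinates of \<open>d\<close> the set is the preimage of an open set under the
  continuous map \<open>transition d c\<close>.\<close>

lemma compatible_open_image:
  assumes "compatible c d" "inj_on (snd c) (fst c)" "inj_on (snd d) (fst d)"
    and "W \<subseteq> fst c" "open (snd c ` (W \<inter> fst d))"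
  shows "open (snd d ` (W \<inter> fst d))"
proof -
  have "open {u \<in> snd d ` (fst c \<inter> fst d). transition d c u \<in> snd c ` (W \<inter> fst d)}"
    using assms by (intro open_preimage_continuous_on smooth_on_continuous) (auto simp: compatible_def)
  also have "{u \<in> snd d ` (fst c \<inter> fst d). transition d c u \<in> snd c ` (W \<inter> fst d)} = snd d ` (W \<inter> fst d)"
  proof -
    have "snd c y \<in> snd c ` (W \<inter> fst d) \<longleftrightarrow> y \<in> W \<inter> fst d" if "y \<in> fst c" for y
      using inj_on_image_mem_iff[OF assms(2) that, of "W \<inter> fst d"] assms(4) by blast
    then have "transition d c (snd d y) \<in> snd c ` (W \<inter> fst d) \<longleftrightarrow> y \<in> W \<inter> fst d"
      if "y \<in> fst c \<inter> fst d" for y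
      using that by (simp add: transition_apply[OF assms(3)])
    then show ?thesis using assms(4) by blast
  qed
  finally show ?thesis .
qed

lemma transition_restrict:
  assumes "inj_on (snd c) (fst c)" "W \<subseteq> fst c" "x \<in> W"
  shows "transition (W, snd c) d (snd c x) = transition c d (snd c x)"
proof -
  have "inj_on (snd c) W" "x \<in> fst c" using assms by (auto intro: inj_on_subset)
  then show ?thesis
    using transition_apply[of "(W, snd c)" x d] transition_apply[of c x d] assms by simp
qed

lemma compatible_restrict:
  assumes "compatible c d" "inj_on (snd c) (fst c)" "inj_on (snd d) (fst d)"
    and "W \<subseteq> fst c" "open (snd c ` (W \<inter> fst d))"
  shows "compatible (W, snd c) d"
proof -
  have o: "open (snd d ` (W \<inter> fst d))" using compatible_open_image[OF assms] .
  have s1: "smooth_on (snd c ` (W \<inter> fst d)) (transition c d)"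
    using assms(4) by (intro smooth_on_subset[OF compatible_smooth[OF assms(1)]]) blast
  have s2: "smooth_on (snd d ` (W \<inter> fst d)) (transition d (W, snd c))"
    using assms(4) smooth_on_subset[OF compatible_smooth[OF compatible_sym[OF assms(1)]], of "snd d ` (W \<inter> fst d)"]
    unfolding transition_def snd_conv by blast
  have "smooth_on (snd c ` (W \<inter> fst d)) (transition (W, snd c) d)"
    by (rule smooth_on_cong[OF assms(5) _ s1]) (use assms in \<open>auto simp: transition_restrict\<close>)
  then show ?thesis using assms(5) o s2 by (simp add: compatible_def)
qed

text \<open>On a triple overlap the transition from \<open>c\<close> to \<open>c'\<close> factors
  through \<open>d\<close>. Such overlaps cover the common domain, and openness and smoothness are
  local.\<close>

lemma compatible_trans_aux:
  assumes "\<And>d. d \<in> A \<Longrightarrow> compatible c d \<and> compatible d c' \<and> inj_on (snd d) (fst d)"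
    and "inj_on (snd c) (fst c)" "inj_on (snd c') (fst c')"
    and "fst c \<inter> fst c' \<subseteq> \<Union>(fst ` A)"
  shows "open (snd c ` (fst c \<inter> fst c'))" "smooth_on (snd c ` (fst c \<inter> fst c')) (transition c c')"
proof -
  have loc: "open (snd c ` (fst c \<inter> fst c' \<inter> fst d)) \<and>
      smooth_on (snd c ` (fst c \<inter> fst c' \<inter> fst d)) (transition c c')" if d: "d \<in> A" for d
  proof -
    let ?W = "fst c \<inter> fst c' \<inter> fst d"
    have cd: "compatible c d" and dc: "compatible d c'" and inj: "inj_on (snd d) (fst d)"
      using assms(1) d by auto
    have "snd d ` ?W = snd d ` (fst c \<inter> fst d) \<inter> snd d ` (fst d \<inter> fst c')"
      using inj by (subst inj_on_image_Int[symmetric, OF inj]) (auto intro!: arg_cong[of _ _ "image (snd d)"])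
    then have oW: "open (snd d ` ?W)"
      using cd dc by (auto simp: compatible_def)
    have W: "?W \<inter> fst c = ?W" "?W \<subseteq> fst d" by blast+
    have o: "open (snd c ` ?W)"
      using compatible_open_image[OF compatible_sym[OF cd] inj assms(2) W(2)] oW
      unfolding W(1) .
    have "smooth_on (snd c ` ?W) (\<lambda>u. transition d c' (transition c d u))"
    proof (rule smooth_on_compose[where f = "transition c d" and g = "transition d c'", OF o oW])
      show "transition c d ` snd c ` ?W \<subseteq> snd d ` ?W"
        using assms(2) by (auto simp: transition_apply)
      show "smooth_on (snd c ` ?W) (transition c d)"
        by (rule smooth_on_subset[OF compatible_smooth[OF cd]]) blast
      show "smooth_on (snd d ` ?W) (transition d c')"
        by (rule smooth_on_subset[OF compatible_smooth[OF dc]]) blast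
    qed
    then have "smooth_on (snd c ` ?W) (transition c c')"
      by (rule smooth_on_cong[OF o, rotated]) (use assms(2) inj in \<open>auto simp: transition_apply\<close>)
    then show ?thesis using o by simp
  qed
  have "snd c ` (fst c \<inter> fst c') = (\<Union>d\<in>A. snd c ` (fst c \<inter> fst c' \<inter> fst d))"
    using assms(4) by blast
  then show "open (snd c ` (fst c \<inter> fst c'))" using loc by auto
  show "smooth_on (snd c ` (fst c \<inter> fst c')) (transition c c')"
  proof (rule smooth_on_local)
    fix u assume "u \<in> snd c ` (fst c \<inter> fst c')"
    then obtain x where x: "x \<in> fst c \<inter> fst c'" "u = snd c x" by auto
    then obtain d where "d \<in> A" "x \<in> fst d" using assms(4) by auto
    then show "\<exists>T. open T \<and> u \<in> T \<and> smooth_on T (transition c c')"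
      using loc[of d] x by blast
  qed
qed

lemma compatible_trans:
  assumes "\<And>d. d \<in> A \<Longrightarrow> compatible c d \<and> compatible d c' \<and> inj_on (snd d) (fst d)"
    and "inj_on (snd c) (fst c)" "inj_on (snd c') (fst c')"
    and "fst c \<inter> fst c' \<subseteq> \<Union>(fst ` A)"
  shows "compatible c c'"
proof -
  note 1 = compatible_trans_aux[OF assms]
  have 2: "open (snd c' ` (fst c' \<inter> fst c))" "smooth_on (snd c' ` (fst c' \<inter> fst c)) (transition c' c)"
    using assms by (intro compatible_trans_aux[of A]; auto intro: compatible_sym)+
  show ?thesis using 1 2 by (simp add: compatible_def Int_commute)
qed

lemma max_atlas_iff:
  "c \<in> max_atlas A \<longleftrightarrow> fst c \<subseteq> \<Union>(fst ` A) \<and> inj_on (snd c) (fst c) \<and> open (snd c ` fst c) \<and>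
     (\<forall>d\<in>A. compatible c d)"
  by (cases c) (simp add: max_atlas_def)

text \<open>Two members of \<open>max_atlas A\<close> are compatible with every generator and
  covered by the generators, so \<open>compatible_trans\<close> links them. The generators
  themselves are only asked to be injective.\<close>

lemma smooth_atlas_max_atlas:
  assumes "\<And>d. d \<in> A \<Longrightarrow> inj_on (snd d) (fst d)"
  shows "smooth_atlas (max_atlas A)"
  unfolding smooth_atlas_def
proof (intro conjI ballI)
  fix c d assume "c \<in> max_atlas A" "d \<in> max_atlas A"
  then show "compatible c d"
    using assms by (intro compatible_trans[of A]) (auto simp: max_atlas_iff intro: compatible_sym)
qed (auto simp: max_atlas_iff)

lemma is_manifold_smooth_atlas:
  assumes "is_manifold M" shows "smooth_atlas M"
proof -
  have M: "max_atlas M = M" using assms by (simp add: is_manifold_def)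
  then have "inj_on (snd d) (fst d)" if "d \<in> M" for d
    using that max_atlas_iff[of d M] by simp
  then show ?thesis using smooth_atlas_max_atlas[of M] M by simp
qed

lemma max_atlas_restrict:
  assumes "\<And>d. d \<in> A \<Longrightarrow> inj_on (snd d) (fst d)" "c \<in> max_atlas A"
    and "W \<subseteq> fst c" "open (snd c ` W)"
  shows "(W, snd c) \<in> max_atlas A"
proof -
  have "compatible (W, snd c) d" if d: "d \<in> A" for d
  proof (rule compatible_restrict)
    have "snd c ` (W \<inter> fst d) = snd c ` W \<inter> snd c ` (fst c \<inter> fst d)"
      using assms(2,3) by (subst inj_on_image_Int[symmetric, of _ "fst c"])
        (auto simp: max_atlas_iff intro!: arg_cong[of _ _ "image (snd c)"])
    then show "open (snd c ` (W \<inter> fst d))"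
      using assms d by (auto simp: max_atlas_iff compatible_def)
  qed (use assms d in \<open>auto simp: max_atlas_iff\<close>)
  then show ?thesis using assms by (auto simp: max_atlas_iff intro: inj_on_subset)
qed

text \<open>A generating chart need not be compatible with the other generating charts, but it becomes
  so once it is cut down to the domain of an admissible chart.\<close>

lemma max_atlas_restrict_generator:
  assumes "\<And>d. d \<in> A \<Longrightarrow> inj_on (snd d) (fst d)" "c \<in> max_atlas A" "d \<in> A"
  shows "(fst d \<inter> fst c, snd d) \<in> max_atlas A"
proof -
  let ?e = "(fst d \<inter> fst c, snd d)"
  have c: "inj_on (snd c) (fst c)" "\<And>d. d \<in> A \<Longrightarrow> compatible c d"
    using assms(2) by (auto simp: max_atlas_iff)
  have o: "open (snd d ` (fst d \<inter> fst c))"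
    using c(2)[OF assms(3)] by (simp add: compatible_def Int_commute)
  have e: "inj_on (snd ?e) (fst ?e)" using assms(1)[OF assms(3)] by (auto intro: inj_on_subset)
  have ec: "compatible ?e c"
    by (rule compatible_restrict[OF compatible_sym[OF c(2)[OF assms(3)]]])
      (use o c assms(1)[OF assms(3)] in \<open>auto simp: Int_assoc\<close>)
  have "compatible ?e d'" if "d' \<in> A" for d'
    by (rule compatible_trans[of "{c}"]) (use ec c e assms(1) that in auto)
  then show ?thesis using o e assms(3) by (auto simp: max_atlas_iff)
qed

section \<open>The topology generated by the chart domains\<close>

lemma topspace_man_top: "topspace (man_top M) = pts M"
  by (simp add: man_top_def pts_def topology_generated_by_topspace)

lemma openin_chart_domain: "c \<in> M \<Longrightarrow> openin (man_top M) (fst c)"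
  by (simp add: man_top_def topology_generated_by_Basis)

text \<open>Induction over the generation of open sets from chart domains; the image commutes with
  intersections because a chart is injective.\<close>

lemma open_chart_image:
  assumes M: "smooth_atlas M" and c: "c \<in> M" and W: "openin (man_top M) W"
  shows "open (snd c ` (fst c \<inter> W))"
proof -
  have "generate_topology_on (fst ` M) W"
    using W by (simp add: man_top_def openin_topology_generated_by_iff)
  then show ?thesis
  proof induction
    case Empty
    then show ?case by simp
  next
    case (Int a b)
    have "snd c ` (fst c \<inter> (a \<inter> b)) = snd c ` (fst c \<inter> a) \<inter> snd c ` (fst c \<inter> b)"
      using M c by (subst inj_on_image_Int[symmetric, of _ "fst c"])
        (auto simp: smooth_atlas_def intro!: arg_cong[of _ _ "image (snd c)"])
    then show ?case using Int by auto
  next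
    case (UN K)
    have "snd c ` (fst c \<inter> \<Union>K) = (\<Union>k\<in>K. snd c ` (fst c \<inter> k))" by blast
    then show ?case using UN by auto
  next
    case (Basis s)
    then show ?case using M c by (auto simp: smooth_atlas_def compatible_def)
  qed
qed

lemma open_sub_iff: "c \<in> open_sub M U \<longleftrightarrow> c \<in> M \<and> fst c \<subseteq> U"
  by (simp add: open_sub_def)

lemma smooth_atlas_subset: "smooth_atlas M \<Longrightarrow> N \<subseteq> M \<Longrightarrow> smooth_atlas N"
  unfolding smooth_atlas_def by blast

lemma smooth_atlas_open_sub: "smooth_atlas M \<Longrightarrow> smooth_atlas (open_sub M U)"
  by (rule smooth_atlas_subset) (auto simp: open_sub_iff)

text \<open>The restricted chart is compatible with all charts, and maximality readmits it.\<close>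

lemma is_manifold_restrict:
  assumes M: "is_manifold M" and c: "c \<in> M" and W: "openin (man_top M) W"
  shows "(fst c \<inter> W, snd c) \<in> M"
proof -
  have at: "smooth_atlas M" using M by (rule is_manifold_smooth_atlas)
  have "(fst c \<inter> W, snd c) \<in> max_atlas M"
  proof (rule max_atlas_restrict)
    show "inj_on (snd d) (fst d)" if "d \<in> M" for d
      using at that by (simp add: smooth_atlas_def)
    show "c \<in> max_atlas M" using M c by (simp add: is_manifold_def)
    show "open (snd c ` (fst c \<inter> W))" by (rule open_chart_image[OF at c W])
  qed auto
  then show ?thesis using M by (simp add: is_manifold_def)
qed

lemma charts_at_iff: "c \<in> charts_at M p \<longleftrightarrow> c \<in> M \<and> p \<in> fst c"
  by (simp add: charts_at_def)

lemma pts_iff_charts_at: "p \<in> pts M \<longleftrightarrow> (\<exists>c. c \<in> charts_at M p)"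
  unfolding pts_def charts_at_def by blast

lemma pts_chart: "p \<in> pts M \<Longrightarrow> \<exists>c. c \<in> charts_at M p"
  by (simp add: pts_iff_charts_at)

lemma charts_at_pts: "c \<in> charts_at M p \<Longrightarrow> p \<in> pts M"
  unfolding pts_def charts_at_def by blast

lemma chart_in_open:
  assumes "is_manifold M" "openin (man_top M) W" "p \<in> W"
  obtains c where "c \<in> charts_at M p" "fst c \<subseteq> W"
proof -
  have "p \<in> pts M" using openin_subset[OF assms(2)] assms(3) by (auto simp: topspace_man_top)
  then obtain c where "c \<in> M" "p \<in> fst c" unfolding pts_def by blast
  then have "(fst c \<inter> W, snd c) \<in> charts_at M p"
    using is_manifold_restrict[OF assms(1) _ assms(2)] assms(3) by (simp add: charts_at_iff)
  then show thesis by (rule that) simp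
qed

lemma pts_open_sub:
  assumes "is_manifold M" "openin (man_top M) W" shows "pts (open_sub M W) = W"
proof
  show "pts (open_sub M W) \<subseteq> W" by (auto simp: pts_def open_sub_iff)
  show "W \<subseteq> pts (open_sub M W)"
  proof
    fix p assume "p \<in> W"
    from chart_in_open[OF assms this] obtain c where "c \<in> charts_at M p" "fst c \<subseteq> W" .
    then show "p \<in> pts (open_sub M W)" by (auto simp: pts_def open_sub_iff charts_at_iff)
  qed
qed

section \<open>Products of manifolds\<close>

lemma inv_into_map_prod:
  assumes "inj_on f U" "inj_on g V" "x \<in> f ` U" "y \<in> g ` V"
  shows "inv_into (U \<times> V) (map_prod f g) (x, y) = (inv_into U f x, inv_into V g y)"
  by (rule inv_into_f_eq) (use assms in \<open>auto simp: map_prod_inj_on f_inv_into_f inv_into_into\<close>)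

lemma compatible_prod:
  assumes "compatible c c'" "compatible d d'"
    and inj: "inj_on (snd c) (fst c)" "inj_on (snd c') (fst c')" "inj_on (snd d) (fst d)" "inj_on (snd d') (fst d')"
  shows "compatible (fst c \<times> fst d, map_prod (snd c) (snd d)) (fst c' \<times> fst d', map_prod (snd c') (snd d'))"
proof -
  \<comment> \<open>Stated for arbitrary charts so that it covers the transitions in both
    directions.\<close>
  have *: "smooth_on (map_prod (snd c) (snd d) ` (fst c \<times> fst d \<inter> fst c' \<times> fst d'))
      (transition (fst c \<times> fst d, map_prod (snd c) (snd d)) (fst c' \<times> fst d', map_prod (snd c') (snd d')))"
    if "compatible c c'" "compatible d d'" "inj_on (snd c) (fst c)" "inj_on (snd d) (fst d)"
    for c c' :: "'a set \<times> ('a \<Rightarrow> 'b)" and d d' :: "'c set \<times> ('c \<Rightarrow> 'd)"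
  proof (rule smooth_on_cong)
    let ?S = "snd c ` (fst c \<inter> fst c')" and ?T = "snd d ` (fst d \<inter> fst d')"
    have eq: "map_prod (snd c) (snd d) ` (fst c \<times> fst d \<inter> fst c' \<times> fst d') = ?S \<times> ?T"
      by (auto simp: image_iff)
    show "open (map_prod (snd c) (snd d) ` (fst c \<times> fst d \<inter> fst c' \<times> fst d'))"
      unfolding eq using that by (auto simp: compatible_def intro: open_Times)
    show "smooth_on (map_prod (snd c) (snd d) ` (fst c \<times> fst d \<inter> fst c' \<times> fst d'))
        (map_prod (transition c c') (transition d d'))"
      unfolding eq using that by (auto simp: compatible_def intro: smooth_on_map_prod)
    fix u assume "u \<in> map_prod (snd c) (snd d) ` (fst c \<times> fst d \<inter> fst c' \<times> fst d')"
    then show "map_prod (transition c c') (transition d d') u =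
        transition (fst c \<times> fst d, map_prod (snd c) (snd d)) (fst c' \<times> fst d', map_prod (snd c') (snd d')) u"
      using that(3,4) by (auto simp: transition_def inv_into_map_prod)
  qed
  have o: "open (map_prod (snd c) (snd d) ` (fst c \<times> fst d \<inter> fst c' \<times> fst d'))"
    if "compatible c c'" "compatible d d'"
    for c c' :: "'a set \<times> ('a \<Rightarrow> 'b)" and d d' :: "'c set \<times> ('c \<Rightarrow> 'd)"
  proof -
    have eq: "map_prod (snd c) (snd d) ` (fst c \<times> fst d \<inter> fst c' \<times> fst d') =
        (snd c ` (fst c \<inter> fst c')) \<times> (snd d ` (fst d \<inter> fst d'))"
      by (auto simp: image_iff)
    show ?thesis unfolding eq using that by (auto simp: compatible_def intro: open_Times)
  qed
  show ?thesis
    using *[OF assms(1,2) inj(1,3)] *[OF compatible_sym[OF assms(1)] compatible_sym[OF assms(2)] inj(2,4)]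
      o[OF assms(1,2)] o[OF compatible_sym[OF assms(1)] compatible_sym[OF assms(2)]]
    by (simp add: compatible_def Int_commute)
qed

definition prod_chart :: "('a, 'e) chart \<Rightarrow> ('b, 'f) chart \<Rightarrow> ('a \<times> 'b, 'e \<times> 'f) chart" where
  "prod_chart c d = (fst c \<times> fst d, map_prod (snd c) (snd d))"

lemma prod_man_eq: "prod_man M N = max_atlas {prod_chart c d | c d. c \<in> M \<and> d \<in> N}"
  unfolding prod_man_def prod_chart_def by (rule arg_cong[of _ _ max_atlas]) force

lemma inj_prod_chart:
  "inj_on (snd c) (fst c) \<Longrightarrow> inj_on (snd d) (fst d) \<Longrightarrow>
    inj_on (snd (prod_chart c d)) (fst (prod_chart c d))"
  by (simp add: prod_chart_def map_prod_inj_on)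

lemma smooth_atlas_prod:
  assumes "smooth_atlas M" "smooth_atlas N" shows "smooth_atlas (prod_man M N)"
  unfolding prod_man_eq
proof (rule smooth_atlas_max_atlas)
  fix e assume "e \<in> {prod_chart c d | c d. c \<in> M \<and> d \<in> N}"
  then obtain c d where "e = prod_chart c d" "c \<in> M" "d \<in> N" by blast
  then show "inj_on (snd e) (fst e)" using assms by (simp add: inj_prod_chart smooth_atlas_def)
qed

text \<open>\<open>max_atlas\<close> retains a generator only if it is compatible with all
  generators; for product charts this is \<open>compatible_prod\<close>.\<close>

lemma prod_chart_in:
  assumes "smooth_atlas M" "smooth_atlas N" "c \<in> M" "d \<in> N"
  shows "prod_chart c d \<in> prod_man M N"
proof -
  have "open (snd (prod_chart c d) ` fst (prod_chart c d))"
  proof -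
    have "snd (prod_chart c d) ` fst (prod_chart c d) = (snd c ` fst c) \<times> (snd d ` fst d)"
      by (auto simp: prod_chart_def image_iff)
    then show ?thesis using assms by (auto simp: smooth_atlas_def intro: open_Times)
  qed
  moreover have "compatible (prod_chart c d) (prod_chart c' d')" if "c' \<in> M" "d' \<in> N" for c' d'
    unfolding prod_chart_def using assms that by (intro compatible_prod) (auto simp: smooth_atlas_def)
  moreover have "inj_on (snd (prod_chart c d)) (fst (prod_chart c d))"
    using assms by (intro inj_prod_chart) (auto simp: smooth_atlas_def)
  moreover have "fst (prod_chart c d) \<subseteq> \<Union>(fst ` {prod_chart c d | c d. c \<in> M \<and> d \<in> N})"
    using assms(3,4) by blast
  ultimately show ?thesis
    unfolding prod_man_eq max_atlas_iff by blast
qed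

lemma pts_prod_man:
  assumes "smooth_atlas M" "smooth_atlas N" shows "pts (prod_man M N) = pts M \<times> pts N"
proof
  show "pts (prod_man M N) \<subseteq> pts M \<times> pts N"
  proof clarify
    fix x y assume "(x, y) \<in> pts (prod_man M N)"
    then obtain e where "e \<in> prod_man M N" "(x, y) \<in> fst e" unfolding pts_def by blast
    then have "(x, y) \<in> \<Union>(fst ` {prod_chart c d | c d. c \<in> M \<and> d \<in> N})"
      unfolding prod_man_eq max_atlas_iff by blast
    then obtain c d where "c \<in> M" "d \<in> N" "(x, y) \<in> fst (prod_chart c d)" by blast
    then show "x \<in> pts M \<and> y \<in> pts N"
      unfolding pts_def by (auto simp: prod_chart_def)
  qed
  show "pts M \<times> pts N \<subseteq> pts (prod_man M N)"
  proof clarify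
    fix x y assume "x \<in> pts M" "y \<in> pts N"
    then obtain c d where "c \<in> M" "x \<in> fst c" "d \<in> N" "y \<in> fst d" unfolding pts_def by blast
    then have "prod_chart c d \<in> prod_man M N" "(x, y) \<in> fst (prod_chart c d)"
      using prod_chart_in[OF assms] by (auto simp: prod_chart_def)
    then show "(x, y) \<in> pts (prod_man M N)"
      unfolding pts_def by blast
  qed
qed

section \<open>Tangent vectors and velocities\<close>

lemma smooth_atlas_inj: "smooth_atlas M \<Longrightarrow> c \<in> M \<Longrightarrow> inj_on (snd c) (fst c)"
  by (simp add: smooth_atlas_def)

lemma smooth_atlas_compatible: "smooth_atlas M \<Longrightarrow> c \<in> M \<Longrightarrow> d \<in> M \<Longrightarrow> compatible c d"
  by (simp add: smooth_atlas_def)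

lemma chart_inv_apply:
  "smooth_atlas M \<Longrightarrow> c \<in> charts_at M x \<Longrightarrow> chart_inv c (snd c x) = x"
  by (simp add: charts_at_iff smooth_atlas_inj)

lemma transition_differentiable:
  assumes "smooth_atlas M" "c \<in> charts_at M p" "d \<in> charts_at M p"
  shows "transition c d differentiable at (snd c p)"
proof (rule smooth_on_differentiable)
  show "smooth_on (snd c ` (fst c \<inter> fst d)) (transition c d)"
    using assms by (intro compatible_smooth smooth_atlas_compatible[of M]) (auto simp: charts_at_iff)
qed (use assms in \<open>auto simp: charts_at_iff\<close>)

lemma open_chart_overlap:
  assumes "smooth_atlas M" "c \<in> M" "d \<in> M"
  shows "open (snd c ` (fst c \<inter> fst d))"
  using smooth_atlas_compatible[OF assms] by (simp add: compatible_def)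

lemma eventually_chart_inv:
  assumes "smooth_atlas M" "c \<in> charts_at M p" "d \<in> charts_at M p"
  shows "\<forall>\<^sub>F u in nhds (snd c p). chart_inv c u \<in> fst c \<inter> fst d \<and>
    snd c (chart_inv c u) = u"
proof -
  have c: "c \<in> M" "d \<in> M" "p \<in> fst c" "p \<in> fst d" using assms by (auto simp: charts_at_iff)
  have "\<forall>\<^sub>F u in nhds (snd c p). u \<in> snd c ` (fst c \<inter> fst d)"
    using open_chart_overlap[OF assms(1) c(1,2)] c by (intro eventually_nhds_in_open) auto
  then show ?thesis
  proof eventually_elim
    case (elim u)
    then obtain x where "x \<in> fst c \<inter> fst d" "u = snd c x" by blast
    then show ?case using smooth_atlas_inj[OF assms(1) c(1)] by simp
  qed
qed

lemma has_derivative_cong_nhds: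
  assumes "(f has_derivative D) (at x)" "\<forall>\<^sub>F u in nhds x. f u = g u"
  shows "(g has_derivative D) (at x)"
proof -
  obtain S where "open S" "x \<in> S" "\<And>u. u \<in> S \<Longrightarrow> f u = g u"
    using assms(2) unfolding eventually_nhds by blast
  then show ?thesis using has_derivative_transform_within_open[OF assms(1)] by blast
qed

lemma differentiable_cong_nhds:
  assumes "f differentiable (at x)" "\<forall>\<^sub>F u in nhds x. f u = g u"
  shows "g differentiable (at x)"
proof -
  obtain D where "(f has_derivative D) (at x)" using assms(1) unfolding differentiable_def ..
  from has_derivative_cong_nhds[OF this assms(2)] show ?thesis by (rule differentiableI)
qed

lemma has_vector_derivative_cong_nhds:
  assumes "(f has_vector_derivative D) (at x)" "\<forall>\<^sub>F u in nhds x. f u = g u"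
  shows "(g has_vector_derivative D) (at x)"
  using assms unfolding has_vector_derivative_def by (rule has_derivative_cong_nhds)

lemma has_vector_derivative_chain:
  assumes "(f has_vector_derivative w) (at t)" "(g has_derivative D) (at (f t))"
  shows "((\<lambda>s. g (f s)) has_vector_derivative D w) (at t)"
proof -
  have "linear D" using assms(2) has_derivative_linear by blast
  moreover have "((\<lambda>s. g (f s)) has_derivative (\<lambda>s. D (s *\<^sub>R w))) (at t)"
    using has_derivative_compose[OF assms(1)[unfolded has_vector_derivative_def] assms(2)] .
  ultimately show ?thesis by (simp add: has_vector_derivative_def linear_scale)
qed

lemma eventually_nhds_continuous:
  assumes "isCont f x" "\<forall>\<^sub>F u in nhds (f x). P u"
  shows "\<forall>\<^sub>F s in nhds x. P (f s)"
proof -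
  have "filterlim f (nhds (f x)) (nhds x)"
    using assms(1) by (simp add: isCont_def tendsto_at_iff_tendsto_nhds)
  then show ?thesis using assms(2) by (simp add: filterlim_iff)
qed

text \<open>The cocycle rule for derivatives: near the point, passing from \<open>c\<close> to
  \<open>e\<close> by way of \<open>d\<close> is the direct transition.\<close>

lemma transition_chain:
  assumes "smooth_atlas M" "c \<in> charts_at M p" "d \<in> charts_at M p" "e \<in> charts_at M p"
  shows "frechet_derivative (transition d e) (at (snd d p))
      (frechet_derivative (transition c d) (at (snd c p)) w) =
    frechet_derivative (transition c e) (at (snd c p)) w"
proof -
  have inj: "inj_on (snd c) (fst c)" "inj_on (snd d) (fst d)"
    using assms by (auto simp: charts_at_iff smooth_atlas_inj)
  have "(transition c d has_derivative frechet_derivative (transition c d) (at (snd c p))) (at (snd c p))"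
    using transition_differentiable[OF assms(1,2,3)] by (simp add: frechet_derivative_works)
  moreover have "transition c d (snd c p) = snd d p"
    using inj assms(2) by (simp add: transition_apply charts_at_iff)
  then have "(transition d e has_derivative frechet_derivative (transition d e) (at (snd d p)))
      (at (transition c d (snd c p)))"
    using transition_differentiable[OF assms(1,3,4)] by (simp add: frechet_derivative_works)
  ultimately have "((\<lambda>u. transition d e (transition c d u)) has_derivative
      (\<lambda>w. frechet_derivative (transition d e) (at (snd d p)) (frechet_derivative (transition c d) (at (snd c p)) w)))
      (at (snd c p))"
    by (rule has_derivative_compose)
  moreover have "\<forall>\<^sub>F u in nhds (snd c p). transition d e (transition c d u) = transition c e u"
    using eventually_chart_inv[OF assms(1-3)]
  proof eventually_elim
    case (elim u)
    then show ?case using inj by (simp add: transition_def)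
  qed
  ultimately have "(transition c e has_derivative
      (\<lambda>w. frechet_derivative (transition d e) (at (snd d p)) (frechet_derivative (transition c d) (at (snd c p)) w)))
      (at (snd c p))"
    by (rule has_derivative_cong_nhds)
  from frechet_derivative_eqI[OF this, of w] show ?thesis by simp
qed

lemma transition_derivative_linear:
  assumes "smooth_atlas M" "c \<in> charts_at M p" "d \<in> charts_at M p"
  shows "linear (frechet_derivative (transition c d) (at (snd c p)))"
  using transition_differentiable[OF assms] by (rule linear_frechet_derivative)

section \<open>Tangent spaces\<close>

lemma tangent_space_outside: "v \<in> tangent_space M p \<Longrightarrow> c \<notin> charts_at M p \<Longrightarrow> v c = 0"
  unfolding tangent_space_def by blast

lemma tangent_space_transition:
  "v \<in> tangent_space M p \<Longrightarrow> c \<in> charts_at M p \<Longrightarrow> d \<in> charts_at M p \<Longrightarrow>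
    v d = frechet_derivative (transition c d) (at (snd c p)) (v c)"
  unfolding tangent_space_def by blast

lemma tangent_spaceI:
  assumes "\<And>c. c \<notin> charts_at M p \<Longrightarrow> v c = 0"
    and "\<And>c d. c \<in> charts_at M p \<Longrightarrow> d \<in> charts_at M p \<Longrightarrow>
      v d = frechet_derivative (transition c d) (at (snd c p)) (v c)"
  shows "v \<in> tangent_space M p"
  using assms unfolding tangent_space_def by blast

lemma tzero_in_tangent_space:
  assumes "smooth_atlas M" shows "tzero \<in> tangent_space M p"
  by (rule tangent_spaceI)
    (use transition_derivative_linear[OF assms] in \<open>auto simp: tzero_def linear_0\<close>)

lemma tminus_in_tangent_space:
  assumes "smooth_atlas M" "v \<in> tangent_space M p" "w \<in> tangent_space M p"
  shows "tminus v w \<in> tangent_space M p"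
proof (rule tangent_spaceI)
  fix c d assume cd: "c \<in> charts_at M p" "d \<in> charts_at M p"
  show "tminus v w d = frechet_derivative (transition c d) (at (snd c p)) (tminus v w c)"
    unfolding tminus_def
    by (simp only: linear_diff[OF transition_derivative_linear[OF assms(1) cd]]
        tangent_space_transition[OF assms(2) cd] tangent_space_transition[OF assms(3) cd])
qed (use assms in \<open>simp add: tminus_def tangent_space_outside\<close>)

lemma tscale_in_tangent_space:
  assumes "smooth_atlas M" "v \<in> tangent_space M p"
  shows "tscale r v \<in> tangent_space M p"
proof (rule tangent_spaceI)
  fix c d assume cd: "c \<in> charts_at M p" "d \<in> charts_at M p"
  show "tscale r v d = frechet_derivative (transition c d) (at (snd c p)) (tscale r v c)"
    unfolding tscale_def
    by (simp only: linear_scale[OF transition_derivative_linear[OF assms(1) cd]]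
        tangent_space_transition[OF assms(2) cd])
qed (use assms in \<open>simp add: tscale_def tangent_space_outside\<close>)

lemma tangent_eqI:
  assumes "v \<in> tangent_space M p" "w \<in> tangent_space M p" "c \<in> charts_at M p" "v c = w c"
  shows "v = w"
proof
  fix d
  show "v d = w d"
  proof (cases "d \<in> charts_at M p")
    case True
    show ?thesis
      using tangent_space_transition[OF assms(1,3) True] tangent_space_transition[OF assms(2,3) True] assms(4)
      by simp
  next
    case False
    then show ?thesis
      using tangent_space_outside[OF assms(1)] tangent_space_outside[OF assms(2)] by simp
  qed
qed

lemma frechet_transition_id:
  assumes "smooth_atlas M" "c \<in> charts_at M p"
  shows "frechet_derivative (transition c c) (at (snd c p)) w = w"
proof (rule frechet_derivative_eqI)
  have "\<forall>\<^sub>F u in nhds (snd c p). u = transition c c u"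
    using eventually_chart_inv[OF assms assms(2)] by eventually_elim (simp add: transition_def)
  with has_derivative_ident show "(transition c c has_derivative (\<lambda>w. w)) (at (snd c p))"
    by (rule has_derivative_cong_nhds)
qed

text \<open>A prescribed coordinate is transported to the other charts by derivatives of
  transitions; the cocycle rule makes the family consistent. It later gives surjectivity of the
  charts of the Lie algebra.\<close>

lemma tangent_with_coordinate:
  assumes "smooth_atlas M" "c \<in> charts_at M p"
  obtains v where "v \<in> tangent_space M p" "v c = w"
proof
  let ?v = "\<lambda>d. if d \<in> charts_at M p then frechet_derivative (transition c d) (at (snd c p)) w else 0"
  show "?v \<in> tangent_space M p"
    by (rule tangent_spaceI) (use transition_chain[OF assms] in auto)
  show "?v c = w" using frechet_transition_id[OF assms] assms(2) by simp
qed

section \<open>Velocities of curves\<close>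

lemma has_velocityD:
  assumes "has_velocity M \<gamma> v t"
  shows "\<gamma> t \<in> pts M" "v \<in> tangent_space M (\<gamma> t)"
    and "c \<in> charts_at M (\<gamma> t) \<Longrightarrow> \<forall>\<^sub>F s in nhds t. \<gamma> s \<in> fst c"
    and "c \<in> charts_at M (\<gamma> t) \<Longrightarrow> ((\<lambda>s. snd c (\<gamma> s)) has_vector_derivative v c) (at t)"
  using assms unfolding has_velocity_def comp_def by blast+

lemma has_velocity_unique:
  assumes "has_velocity M \<gamma> v t" "has_velocity M \<gamma> w t" shows "v = w"
proof -
  obtain c where c: "c \<in> charts_at M (\<gamma> t)"
    using pts_chart[OF has_velocityD(1)[OF assms(1)]] by blast
  show ?thesis
    by (rule tangent_eqI[OF has_velocityD(2)[OF assms(1)] has_velocityD(2)[OF assms(2)] c])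
      (rule vector_derivative_unique_at[OF has_velocityD(4)[OF assms(1) c] has_velocityD(4)[OF assms(2) c]])
qed

lemma velocity_eq: "has_velocity M \<gamma> v t \<Longrightarrow> velocity M \<gamma> t = v"
  unfolding velocity_def by (rule the_equality) (auto intro: has_velocity_unique)

lemma has_velocity_cong:
  assumes v: "has_velocity M \<gamma> v t" and ev: "\<forall>\<^sub>F s in nhds t. \<gamma> s = \<delta> s"
  shows "has_velocity M \<delta> v t"
proof -
  have t: "\<delta> t = \<gamma> t" using eventually_nhds_x_imp_x[OF ev] by simp
  show ?thesis
    unfolding has_velocity_def t comp_def
  proof (intro conjI ballI)
    fix c assume c: "c \<in> charts_at M (\<gamma> t)"
    show "\<forall>\<^sub>F s in nhds t. \<delta> s \<in> fst c"
      using has_velocityD(3)[OF v c] ev by eventually_elim simp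
    have "\<forall>\<^sub>F s in nhds t. snd c (\<gamma> s) = snd c (\<delta> s)"
      using ev by eventually_elim simp
    with has_velocityD(4)[OF v c]
    show "((\<lambda>s. snd c (\<delta> s)) has_vector_derivative v c) (at t)"
      by (rule has_vector_derivative_cong_nhds)
  qed (rule has_velocityD[OF v])+
qed

text \<open>One chart suffices: another coordinate expression is the first followed by a transition
  map, and \<open>v\<close> transforms by the derivative of that map.\<close>

lemma has_velocityI:
  assumes M: "smooth_atlas M" and c: "c \<in> charts_at M (\<gamma> t)" and v: "v \<in> tangent_space M (\<gamma> t)"
    and ev: "\<forall>\<^sub>F s in nhds t. \<gamma> s \<in> fst c"
    and der: "((\<lambda>s. snd c (\<gamma> s)) has_vector_derivative v c) (at t)"
  shows "has_velocity M \<gamma> v t"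
  unfolding has_velocity_def comp_def
proof (intro conjI ballI)
  show "\<gamma> t \<in> pts M" using charts_at_pts[OF c] .
  show "v \<in> tangent_space M (\<gamma> t)" by (rule v)
  fix d assume d: "d \<in> charts_at M (\<gamma> t)"
  have inj: "inj_on (snd c) (fst c)" using M c by (auto simp: charts_at_iff smooth_atlas_inj)
  have cont: "isCont (\<lambda>s. snd c (\<gamma> s)) t"
    using der has_vector_derivative_continuous by blast
  have "\<forall>\<^sub>F s in nhds t. chart_inv c (snd c (\<gamma> s)) \<in> fst c \<inter> fst d \<and>
     snd c (chart_inv c (snd c (\<gamma> s))) = snd c (\<gamma> s)"
    by (rule eventually_nhds_continuous[OF cont eventually_chart_inv[OF M c d]])
  then show evd: "\<forall>\<^sub>F s in nhds t. \<gamma> s \<in> fst d"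
    using ev by eventually_elim (simp add: inj)
  have "transition c d differentiable at (snd c (\<gamma> t))"
    by (rule transition_differentiable[OF M c d])
  then have "((\<lambda>s. transition c d (snd c (\<gamma> s))) has_vector_derivative
      frechet_derivative (transition c d) (at (snd c (\<gamma> t))) (v c)) (at t)"
    by (intro has_vector_derivative_chain[OF der]) (simp add: frechet_derivative_works)
  then have "((\<lambda>s. transition c d (snd c (\<gamma> s))) has_vector_derivative v d) (at t)"
    using tangent_space_transition[OF v c d] by simp
  moreover have "\<forall>\<^sub>F s in nhds t. transition c d (snd c (\<gamma> s)) = snd d (\<gamma> s)"
    using ev by eventually_elim (simp add: transition_apply[OF inj])
  ultimately show "((\<lambda>s. snd d (\<gamma> s)) has_vector_derivative v d) (at t)"
    by (rule has_vector_derivative_cong_nhds)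
qed

lemma has_velocity_const:
  assumes "smooth_atlas M" "p \<in> pts M" shows "has_velocity M (\<lambda>s. p) tzero t"
proof -
  obtain c where c: "c \<in> charts_at M p" using pts_chart[OF assms(2)] by blast
  show ?thesis
    by (rule has_velocityI[where c=c])
      (use assms c tzero_in_tangent_space in \<open>auto simp: tzero_def charts_at_iff\<close>)
qed

lemma has_velocity_reparam:
  assumes "has_velocity M \<gamma> v (f t)" and f: "(f has_real_derivative r) (at t)" and M: "smooth_atlas M"
  shows "has_velocity M (\<lambda>s. \<gamma> (f s)) (tscale r v) t"
proof -
  obtain c where c: "c \<in> charts_at M (\<gamma> (f t))"
    using pts_chart[OF has_velocityD(1)[OF assms(1)]] by blast
  have cont: "isCont f t" using f DERIV_isCont by blast
  show ?thesis
  proof (rule has_velocityI[where c=c, OF M])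
    show "c \<in> charts_at M (\<gamma> (f t))" by (rule c)
    show "tscale r v \<in> tangent_space M (\<gamma> (f t))"
      using tscale_in_tangent_space[OF M has_velocityD(2)[OF assms(1)]] .
    show "\<forall>\<^sub>F s in nhds t. \<gamma> (f s) \<in> fst c"
      by (rule eventually_nhds_continuous[OF cont has_velocityD(3)[OF assms(1) c]])
    have g: "((\<lambda>s. snd c (\<gamma> s)) has_derivative (\<lambda>s. s *\<^sub>R v c)) (at (f t))"
      using has_velocityD(4)[OF assms(1) c] by (simp add: has_vector_derivative_def)
    have "(f has_vector_derivative r) (at t)"
      using f by (simp add: has_real_derivative_iff_has_vector_derivative)
    from has_vector_derivative_chain[OF this g]
    show "((\<lambda>s. snd c (\<gamma> (f s))) has_vector_derivative tscale r v c) (at t)"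
      by (simp add: tscale_def)
  qed
qed

lemma has_velocity_continuous:
  assumes "is_manifold M" "has_velocity M \<gamma> v t" "openin (man_top M) W" "\<gamma> t \<in> W"
  shows "\<forall>\<^sub>F s in nhds t. \<gamma> s \<in> W"
proof -
  obtain c where c: "c \<in> charts_at M (\<gamma> t)" "fst c \<subseteq> W"
    using chart_in_open[OF assms(1,3,4)] .
  show ?thesis
    using has_velocityD(3)[OF assms(2) c(1)] by eventually_elim (use c(2) in blast)
qed

text \<open>In a chart the derivative vanishes near each time, so the curve is locally constant, and
  an interval is connected.\<close>

lemma zero_velocity_constant:
  assumes M: "smooth_atlas M" and I: "open I" "is_interval I"
    and v: "\<And>t. t \<in> I \<Longrightarrow> has_velocity M \<gamma> tzero t" and ab: "a \<in> I" "b \<in> I"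
  shows "\<gamma> a = \<gamma> b"
proof (rule connected_local_const[OF _ ab])
  show "connected I" using I(2) by (simp add: is_interval_connected)
  show "\<forall>t\<in>I. \<forall>\<^sub>F s in at t within I. \<gamma> t = \<gamma> s"
  proof
    fix t assume t: "t \<in> I"
    obtain c where c: "c \<in> charts_at M (\<gamma> t)"
      using pts_chart[OF has_velocityD(1)[OF v[OF t]]] by blast
    have "\<forall>\<^sub>F s in nhds t. \<gamma> s \<in> fst c \<and> s \<in> I"
      using has_velocityD(3)[OF v[OF t] c] eventually_nhds_in_open[OF I(1) t] by eventually_elim simp
    then obtain e where e: "e > 0" "\<And>s. dist s t < e \<Longrightarrow> \<gamma> s \<in> fst c \<and> s \<in> I"
      unfolding eventually_nhds_metric by blast
    have "((\<lambda>s. snd c (\<gamma> s)) has_vector_derivative 0) (at s within ball t e)" if "s \<in> ball t e" for s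
    proof (rule has_vector_derivative_at_within)
      have s: "\<gamma> s \<in> fst c" "s \<in> I" using e(2)[of s] that by (auto simp: dist_commute)
      then have "c \<in> charts_at M (\<gamma> s)" using c by (simp add: charts_at_iff)
      from has_velocityD(4)[OF v[OF s(2)] this]
      show "((\<lambda>s. snd c (\<gamma> s)) has_vector_derivative 0) (at s)"
        by (simp add: tzero_def)
    qed
    then obtain k where k: "\<And>s. s \<in> ball t e \<Longrightarrow> snd c (\<gamma> s) = k"
      using has_vector_derivative_zero_constant[OF convex_ball, of t e "\<lambda>s. snd c (\<gamma> s)"] by metis
    have "\<gamma> t = \<gamma> s" if "dist s t < e" for s
    proof -
      have "snd c (\<gamma> t) = snd c (\<gamma> s)" using k that e(1) by (simp add: dist_commute)
      moreover have "inj_on (snd c) (fst c)" using M c by (simp add: charts_at_iff smooth_atlas_inj)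
      ultimately show ?thesis using e(2)[of s] e(2)[of t] e(1) that by (simp add: inj_on_eq_iff)
    qed
    then have "\<forall>\<^sub>F s in nhds t. \<gamma> t = \<gamma> s" unfolding eventually_nhds_metric using e(1) by blast
    then show "\<forall>\<^sub>F s in at t within I. \<gamma> t = \<gamma> s"
      by (simp add: eventually_at_filter eventually_mono)
  qed
qed

text \<open>Differentiability at a single point. The clause on eventual membership is continuity as
  seen in charts; it keeps the coordinate expression away from the arbitrary values of a chart map
  off its domain.\<close>

definition mdiff :: "('a, 'e::model_space) manifold \<Rightarrow> ('b, 'f::model_space) manifold \<Rightarrow> ('a \<Rightarrow> 'b) \<Rightarrow> 'a \<Rightarrow> bool" where
  "mdiff M N f p \<longleftrightarrow> p \<in> pts M \<and> f p \<in> pts N \<and>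
     (\<forall>c\<in>charts_at M p. \<forall>d\<in>charts_at N (f p).
        (\<forall>\<^sub>F u in nhds (snd c p). f (chart_inv c u) \<in> fst d) \<and>
        (\<lambda>u. snd d (f (chart_inv c u))) differentiable at (snd c p))"

lemma mdiffD:
  assumes "mdiff M N f p"
  shows "p \<in> pts M" "f p \<in> pts N"
    and "c \<in> charts_at M p \<Longrightarrow> d \<in> charts_at N (f p) \<Longrightarrow>
      \<forall>\<^sub>F u in nhds (snd c p). f (chart_inv c u) \<in> fst d"
    and "c \<in> charts_at M p \<Longrightarrow> d \<in> charts_at N (f p) \<Longrightarrow>
      (\<lambda>u. snd d (f (chart_inv c u))) differentiable at (snd c p)"
  using assms unfolding mdiff_def by blast+

text \<open>A change of charts composes the coordinate expression with a transition on each side.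
  These compositions are meaningful only near the point, hence the eventual statements
  \<open>ev1\<close> to \<open>ev3\<close>.\<close>

lemma mdiffI:
  assumes M: "smooth_atlas M" and N: "smooth_atlas N"
    and c: "c \<in> charts_at M p" and d: "d \<in> charts_at N (f p)"
    and ev: "\<forall>\<^sub>F u in nhds (snd c p). f (chart_inv c u) \<in> fst d"
    and der: "(\<lambda>u. snd d (f (chart_inv c u))) differentiable at (snd c p)"
  shows "mdiff M N f p"
  unfolding mdiff_def
proof (intro conjI ballI)
  show "p \<in> pts M" "f p \<in> pts N" using charts_at_pts[OF c] charts_at_pts[OF d] .
  fix c' d' assume c': "c' \<in> charts_at M p" and d': "d' \<in> charts_at N (f p)"
  let ?F = "\<lambda>u. snd d (f (chart_inv c u))"
  have injc: "inj_on (snd c) (fst c)" using M c by (simp add: charts_at_iff smooth_atlas_inj)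
  have injd: "inj_on (snd d) (fst d)" using N d by (simp add: charts_at_iff smooth_atlas_inj)
  have injc': "inj_on (snd c') (fst c')" using M c' by (simp add: charts_at_iff smooth_atlas_inj)
  have tp: "transition c' c (snd c' p) = snd c p"
    using c' by (simp add: transition_apply[OF injc'] charts_at_iff)
  have Fp: "?F (snd c p) = snd d (f p)" using chart_inv_apply[OF M c] by simp
  have dt: "(transition c' c has_derivative frechet_derivative (transition c' c) (at (snd c' p))) (at (snd c' p))"
    using transition_differentiable[OF M c' c] by (simp add: frechet_derivative_works)
  have dF: "(?F has_derivative frechet_derivative ?F (at (snd c p))) (at (transition c' c (snd c' p)))"
    using der unfolding tp by (simp add: frechet_derivative_works)
  have dd: "(transition d d' has_derivative frechet_derivative (transition d d') (at (snd d (f p))))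
     (at (?F (transition c' c (snd c' p))))"
    using transition_differentiable[OF N d d'] unfolding tp Fp by (simp add: frechet_derivative_works)
  note comp1 = has_derivative_compose[OF dt dF]
  have comp: "(\<lambda>u. transition d d' (?F (transition c' c u))) differentiable at (snd c' p)"
    using has_derivative_compose[OF comp1 dd] unfolding differentiable_def by blast
  have cont1: "isCont (transition c' c) (snd c' p)"
    using dt has_derivative_continuous by blast
  have cont: "isCont (\<lambda>u. ?F (transition c' c u)) (snd c' p)"
    using comp1 has_derivative_continuous by blast
  have ev1: "\<forall>\<^sub>F u in nhds (snd c' p). f (chart_inv c (transition c' c u)) \<in> fst d"
    by (rule eventually_nhds_continuous[OF cont1]) (use ev in \<open>simp add: tp\<close>)
  have ev2: "\<forall>\<^sub>F u in nhds (snd c' p). chart_inv d (?F (transition c' c u)) \<in> fst d \<inter> fst d' \<and>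
      snd d (chart_inv d (?F (transition c' c u))) = ?F (transition c' c u)"
    by (rule eventually_nhds_continuous[OF cont]) (use eventually_chart_inv[OF N d d'] in \<open>simp add: tp Fp\<close>)
  have ev3: "\<forall>\<^sub>F u in nhds (snd c' p). chart_inv c (transition c' c u) = chart_inv c' u"
    using eventually_chart_inv[OF M c' c]
    by eventually_elim (simp add: transition_def injc)
  show "\<forall>\<^sub>F u in nhds (snd c' p). f (chart_inv c' u) \<in> fst d'"
    using ev1 ev2 ev3 by eventually_elim (simp add: injd)
  have "\<forall>\<^sub>F u in nhds (snd c' p). transition d d' (?F (transition c' c u)) = snd d' (f (chart_inv c' u))"
    using ev1 ev3 by eventually_elim (simp add: transition_apply[OF injd])
  with comp show "(\<lambda>u. snd d' (f (chart_inv c' u))) differentiable at (snd c' p)"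
    by (rule differentiable_cong_nhds)
qed

text \<open>The chain rule. \<open>tangent_map\<close> computes in a chart selected by
  \<open>SOME\<close>, so the proof works in the same chart. Tangent maps are mostly evaluated
  through this lemma, as velocities of image curves.\<close>

lemma mdiff_velocity:
  assumes M: "smooth_atlas M" and N: "smooth_atlas N"
    and f: "mdiff M N f (\<gamma> t)" and v: "has_velocity M \<gamma> v t"
  shows "has_velocity N (\<lambda>s. f (\<gamma> s)) (tangent_map M N f (\<gamma> t) v) t"
proof -
  define c where "c = (SOME c. c \<in> charts_at M (\<gamma> t))"
  have c: "c \<in> charts_at M (\<gamma> t)"
    unfolding c_def using pts_chart[OF has_velocityD(1)[OF v]] by (rule someI_ex)
  let ?F = "\<lambda>d u. snd d (f (chart_inv c u))"
  let ?w = "tangent_map M N f (\<gamma> t) v"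
  have injc: "inj_on (snd c) (fst c)" using M c by (simp add: charts_at_iff smooth_atlas_inj)
  have w: "?w d = (if d \<in> charts_at N (f (\<gamma> t)) then frechet_derivative (?F d) (at (snd c (\<gamma> t))) (v c) else 0)" for d
    by (simp add: tangent_map_def c_def[symmetric] comp_def)
  have F: "(?F d has_derivative frechet_derivative (?F d) (at (snd c (\<gamma> t)))) (at (snd c (\<gamma> t)))"
    if "d \<in> charts_at N (f (\<gamma> t))" for d
    using mdiffD(4)[OF f c that] by (simp add: frechet_derivative_works)
  have Fp: "?F d (snd c (\<gamma> t)) = snd d (f (\<gamma> t))" for d using chart_inv_apply[OF M c] by simp
  have wt: "?w \<in> tangent_space N (f (\<gamma> t))"
  proof (rule tangent_spaceI)
    fix d e assume d: "d \<in> charts_at N (f (\<gamma> t))" and e: "e \<in> charts_at N (f (\<gamma> t))"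
    have injd: "inj_on (snd d) (fst d)" using N d by (simp add: charts_at_iff smooth_atlas_inj)
    have "(transition d e has_derivative frechet_derivative (transition d e) (at (snd d (f (\<gamma> t))))) (at (?F d (snd c (\<gamma> t))))"
      using transition_differentiable[OF N d e] unfolding Fp by (simp add: frechet_derivative_works)
    from has_derivative_compose[OF F[OF d] this]
    have "((\<lambda>u. transition d e (?F d u)) has_derivative
        (\<lambda>x. frechet_derivative (transition d e) (at (snd d (f (\<gamma> t)))) (frechet_derivative (?F d) (at (snd c (\<gamma> t))) x)))
        (at (snd c (\<gamma> t)))" .
    moreover have "\<forall>\<^sub>F u in nhds (snd c (\<gamma> t)). transition d e (?F d u) = ?F e u"
      using mdiffD(3)[OF f c d] by eventually_elim (simp add: transition_apply[OF injd])
    ultimately have "(?F e has_derivative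
        (\<lambda>x. frechet_derivative (transition d e) (at (snd d (f (\<gamma> t)))) (frechet_derivative (?F d) (at (snd c (\<gamma> t))) x)))
        (at (snd c (\<gamma> t)))"
      by (rule has_derivative_cong_nhds)
    from frechet_derivative_eqI[OF this]
    show "?w e = frechet_derivative (transition d e) (at (snd d (f (\<gamma> t)))) (?w d)"
      using d e by (simp add: w)
  qed (simp add: w)
  obtain d where d: "d \<in> charts_at N (f (\<gamma> t))" using pts_chart[OF mdiffD(2)[OF f]] by blast
  have cont: "isCont (\<lambda>s. snd c (\<gamma> s)) t"
    using has_velocityD(4)[OF v c] has_vector_derivative_continuous by blast
  have evc: "\<forall>\<^sub>F s in nhds t. \<gamma> s \<in> fst c" by (rule has_velocityD(3)[OF v c])
  show ?thesis
  proof (rule has_velocityI[where c=d, OF N])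
    show "d \<in> charts_at N (f (\<gamma> t))" "?w \<in> tangent_space N (f (\<gamma> t))" by (rule d wt)+
    have "\<forall>\<^sub>F s in nhds t. f (chart_inv c (snd c (\<gamma> s))) \<in> fst d"
      by (rule eventually_nhds_continuous[OF cont mdiffD(3)[OF f c d]])
    then show "\<forall>\<^sub>F s in nhds t. f (\<gamma> s) \<in> fst d"
      using evc by eventually_elim (simp add: injc)
    have "((\<lambda>s. ?F d (snd c (\<gamma> s))) has_vector_derivative ?w d) (at t)"
      using has_vector_derivative_chain[OF has_velocityD(4)[OF v c] F[OF d]] d by (simp add: w)
    moreover have "\<forall>\<^sub>F s in nhds t. ?F d (snd c (\<gamma> s)) = snd d (f (\<gamma> s))"
      using evc by eventually_elim (simp add: injc)
    ultimately show "((\<lambda>s. snd d (f (\<gamma> s))) has_vector_derivative ?w d) (at t)"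
      by (rule has_vector_derivative_cong_nhds)
  qed
qed

text \<open>In charts at \<open>f p\<close> the derivative in the selected chart is linear; at all
  other charts both sides are 0 by convention.\<close>

lemma tangent_map_linear:
  assumes "mdiff M N f p"
  shows "tangent_map M N f p (tminus v w) = tminus (tangent_map M N f p v) (tangent_map M N f p w)"
    and "tangent_map M N f p (tscale r v) = tscale r (tangent_map M N f p v)"
    and "tangent_map M N f p tzero = tzero"
proof -
  define c where "c = (SOME c. c \<in> charts_at M p)"
  have c: "c \<in> charts_at M p"
    unfolding c_def using pts_chart[OF mdiffD(1)[OF assms]] by (rule someI_ex)
  let ?D = "\<lambda>d. frechet_derivative (\<lambda>u. snd d (f (chart_inv c u))) (at (snd c p))"
  have t: "tangent_map M N f p v d = (if d \<in> charts_at N (f p) then ?D d (v c) else 0)" for d v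
    by (simp add: tangent_map_def c_def[symmetric] comp_def)
  have lin: "linear (?D d)" if "d \<in> charts_at N (f p)" for d
    by (rule linear_frechet_derivative[OF mdiffD(4)[OF assms c that]])
  show "tangent_map M N f p (tminus v w) = tminus (tangent_map M N f p v) (tangent_map M N f p w)"
    by (rule ext) (simp add: t tminus_def linear_diff[OF lin])
  show "tangent_map M N f p (tscale r v) = tscale r (tangent_map M N f p v)"
    by (rule ext) (simp add: t tscale_def linear_scale[OF lin])
  show "tangent_map M N f p tzero = tzero"
    by (rule ext) (simp add: t tzero_def linear_0[OF lin])
qed

section \<open>Differentiable maps\<close>

lemma smooth_map_pts: "smooth_map M N f \<Longrightarrow> p \<in> pts M \<Longrightarrow> f p \<in> pts N"
  unfolding smooth_map_def by (metis continuous_map_image_subset_topspace image_subset_iff topspace_man_top)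

lemma smooth_map_smooth_on:
  assumes "smooth_map M N f" "c \<in> M" "d \<in> N"
  shows "smooth_on (snd c ` {x \<in> fst c. f x \<in> fst d}) (\<lambda>u. snd d (f (chart_inv c u)))"
  using assms unfolding smooth_map_def by (cases c; cases d) (auto simp: comp_def)

text \<open>The ambient atlases \<open>M\<close> and \<open>N\<close> let a map that is smooth only
  on an open submanifold, such as a local trivialization, count as differentiable in the whole
  manifold.\<close>

lemma smooth_map_mdiff:
  assumes f: "smooth_map M' N' f" and M: "smooth_atlas M" "M' \<subseteq> M" and N: "smooth_atlas N" "N' \<subseteq> N"
    and p: "p \<in> pts M'"
  shows "mdiff M N f p"
proof -
  obtain c where c: "c \<in> charts_at M' p" using pts_chart[OF p] by blast
  obtain d where d: "d \<in> charts_at N' (f p)" using pts_chart[OF smooth_map_pts[OF f p]] by blast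
  have M': "smooth_atlas M'" using M by (rule smooth_atlas_subset)
  have cd: "c \<in> M'" "p \<in> fst c" "d \<in> N'" "f p \<in> fst d" using c d by (auto simp: charts_at_iff)
  let ?W = "{x \<in> pts M'. f x \<in> fst d}"
  have "openin (man_top M') {x \<in> topspace (man_top M'). f x \<in> fst d}"
    using f openin_chart_domain[OF cd(3)] unfolding smooth_map_def
    by (intro openin_continuous_map_preimage) auto
  then have W: "openin (man_top M') ?W" by (simp add: topspace_man_top)
  have o: "open (snd c ` (fst c \<inter> ?W))" by (rule open_chart_image[OF M' cd(1) W])
  have "snd c p \<in> snd c ` (fst c \<inter> ?W)" using cd p by blast
  then have "\<forall>\<^sub>F u in nhds (snd c p). u \<in> snd c ` (fst c \<inter> ?W)" by (rule eventually_nhds_in_open[OF o])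
  then have ev: "\<forall>\<^sub>F u in nhds (snd c p). f (chart_inv c u) \<in> fst d"
  proof eventually_elim
    case (elim u)
    then obtain x where "x \<in> fst c" "f x \<in> fst d" "u = snd c x" by blast
    then show ?case using smooth_atlas_inj[OF M' cd(1)] by simp
  qed
  have der: "(\<lambda>u. snd d (f (chart_inv c u))) differentiable at (snd c p)"
    by (rule smooth_on_differentiable[OF smooth_map_smooth_on[OF f cd(1,3)]]) (use cd in blast)
  have c': "c \<in> charts_at M p" and d': "d \<in> charts_at N (f p)"
    using c d M(2) N(2) by (auto simp: charts_at_iff)
  show ?thesis by (rule mdiffI[OF M(1) N(1) c' d' ev der])
qed

lemma mdiff_compose:
  assumes M: "smooth_atlas M" and N: "smooth_atlas N" and K: "smooth_atlas K"
    and f: "mdiff M N f p" and g: "mdiff N K g (f p)"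
  shows "mdiff M K (\<lambda>x. g (f x)) p"
proof -
  obtain c where c: "c \<in> charts_at M p" using pts_chart[OF mdiffD(1)[OF f]] by blast
  obtain d where d: "d \<in> charts_at N (f p)" using pts_chart[OF mdiffD(2)[OF f]] by blast
  obtain e where e: "e \<in> charts_at K (g (f p))" using pts_chart[OF mdiffD(2)[OF g]] by blast
  let ?F = "\<lambda>u. snd d (f (chart_inv c u))"
  let ?G = "\<lambda>u. snd e (g (chart_inv d u))"
  have injd: "inj_on (snd d) (fst d)" using N d by (simp add: charts_at_iff smooth_atlas_inj)
  have Fp: "?F (snd c p) = snd d (f p)" using chart_inv_apply[OF M c] by simp
  have F: "?F differentiable at (snd c p)" by (rule mdiffD(4)[OF f c d])
  have cont: "isCont ?F (snd c p)"
    using differentiable_imp_continuous_within[OF F] .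
  have evf: "\<forall>\<^sub>F u in nhds (snd c p). f (chart_inv c u) \<in> fst d"
    by (rule mdiffD(3)[OF f c d])
  have "\<forall>\<^sub>F u in nhds (snd c p). g (chart_inv d (?F u)) \<in> fst e"
    by (rule eventually_nhds_continuous[OF cont]) (simp only: Fp mdiffD(3)[OF g d e])
  then have ev: "\<forall>\<^sub>F u in nhds (snd c p). g (f (chart_inv c u)) \<in> fst e"
    using evf by eventually_elim (simp add: injd)
  have "(?F has_derivative frechet_derivative ?F (at (snd c p))) (at (snd c p))"
    using F by (simp add: frechet_derivative_works)
  moreover have "(?G has_derivative frechet_derivative ?G (at (snd d (f p)))) (at (?F (snd c p)))"
    using mdiffD(4)[OF g d e] unfolding Fp by (simp add: frechet_derivative_works)
  ultimately have "(\<lambda>u. ?G (?F u)) differentiable at (snd c p)"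
    by (rule differentiableI[OF has_derivative_compose])
  moreover have "\<forall>\<^sub>F u in nhds (snd c p). ?G (?F u) = snd e (g (f (chart_inv c u)))"
    using evf by eventually_elim (simp add: injd)
  ultimately have der: "(\<lambda>u. snd e (g (f (chart_inv c u)))) differentiable at (snd c p)"
    by (rule differentiable_cong_nhds)
  show ?thesis by (rule mdiffI[where f = "\<lambda>x. g (f x)", OF M K c e ev der])
qed

lemma mdiff_ident:
  assumes M: "smooth_atlas M" and p: "p \<in> pts M" shows "mdiff M M (\<lambda>x. x) p"
proof -
  obtain c where c: "c \<in> charts_at M p" using pts_chart[OF p] by blast
  note ev = eventually_chart_inv[OF M c c]
  show ?thesis
  proof (rule mdiffI[where f = "\<lambda>x. x", OF M M c c])
    show "\<forall>\<^sub>F u in nhds (snd c p). chart_inv c u \<in> fst c"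
      using ev by eventually_elim simp
    have "\<forall>\<^sub>F u in nhds (snd c p). u = snd c (chart_inv c u)"
      using ev by eventually_elim simp
    with differentiable_ident show "(\<lambda>u. snd c (chart_inv c u)) differentiable at (snd c p)"
      by (rule differentiable_cong_nhds)
  qed
qed

lemma mdiff_const:
  assumes M: "smooth_atlas M" and N: "smooth_atlas N" and p: "p \<in> pts M" and q: "q \<in> pts N"
  shows "mdiff M N (\<lambda>x. q) p"
proof -
  obtain c where c: "c \<in> charts_at M p" using pts_chart[OF p] by blast
  obtain d where d: "d \<in> charts_at N q" using pts_chart[OF q] by blast
  show ?thesis
    by (rule mdiffI[where f = "\<lambda>x. q", OF M N c d]) (use d in \<open>auto simp: charts_at_iff\<close>)
qed

lemma charts_at_prod_chart:
  "smooth_atlas M \<Longrightarrow> smooth_atlas N \<Longrightarrow> c \<in> charts_at M p \<Longrightarrow> d \<in> charts_at N q \<Longrightarrow>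
    prod_chart c d \<in> charts_at (prod_man M N) (p, q)"
  unfolding charts_at_iff using prod_chart_in[of M N c d] by (simp add: prod_chart_def)

lemma snd_prod_chart [simp]: "snd (prod_chart c d) (x, y) = (snd c x, snd d y)"
  and fst_prod_chart [simp]: "fst (prod_chart c d) = fst c \<times> fst d"
  by (simp_all add: prod_chart_def)

lemma inv_prod_chart:
  assumes "smooth_atlas M" "smooth_atlas N" "c \<in> M" "d \<in> N" "u \<in> snd c ` fst c" "v \<in> snd d ` fst d"
  shows "inv_into (fst c \<times> fst d) (snd (prod_chart c d)) (u, v) = (chart_inv c u, chart_inv d v)"
  using inv_into_map_prod[OF smooth_atlas_inj[OF assms(1,3)] smooth_atlas_inj[OF assms(2,4)] assms(5,6)]
  by (simp add: prod_chart_def)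

lemma mdiff_Pair:
  assumes M: "smooth_atlas M" and N: "smooth_atlas N" and K: "smooth_atlas K"
    and f: "mdiff M N f p" and g: "mdiff M K g p"
  shows "mdiff M (prod_man N K) (\<lambda>x. (f x, g x)) p"
proof -
  obtain c where c: "c \<in> charts_at M p" using pts_chart[OF mdiffD(1)[OF f]] by blast
  obtain d where d: "d \<in> charts_at N (f p)" using pts_chart[OF mdiffD(2)[OF f]] by blast
  obtain e where e: "e \<in> charts_at K (g p)" using pts_chart[OF mdiffD(2)[OF g]] by blast
  show ?thesis
  proof (rule mdiffI[where f = "\<lambda>x. (f x, g x)", OF M smooth_atlas_prod[OF N K] c charts_at_prod_chart[OF N K d e]])
    show "\<forall>\<^sub>F u in nhds (snd c p). (f (chart_inv c u), g (chart_inv c u)) \<in> fst (prod_chart d e)"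
      using mdiffD(3)[OF f c d] mdiffD(3)[OF g c e] by eventually_elim simp
    have "(\<lambda>u. snd d (f (chart_inv c u))) differentiable at (snd c p)"
      "(\<lambda>u. snd e (g (chart_inv c u))) differentiable at (snd c p)"
      by (rule mdiffD(4)[OF f c d] mdiffD(4)[OF g c e])+
    then obtain D E where "((\<lambda>u. snd d (f (chart_inv c u))) has_derivative D) (at (snd c p))"
      "((\<lambda>u. snd e (g (chart_inv c u))) has_derivative E) (at (snd c p))"
      unfolding differentiable_def by blast
    from differentiableI[OF has_derivative_Pair[OF this]]
    show "(\<lambda>u. snd (prod_chart d e) (f (chart_inv c u), g (chart_inv c u)))
      differentiable at (snd c p)" by simp
  qed
qed

lemma eventually_chart_image:
  assumes M: "smooth_atlas M" and c: "c \<in> charts_at M p"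
  shows "\<forall>\<^sub>F u in nhds (snd c p). u \<in> snd c ` fst c"
  using M c by (intro eventually_nhds_in_open) (auto simp: smooth_atlas_def charts_at_iff)

text \<open>Serves to extract the fibre component of a local trivialization.\<close>

lemma mdiff_snd:
  assumes M: "smooth_atlas M" and N: "smooth_atlas N" and p: "p \<in> pts M" and q: "q \<in> pts N"
  shows "mdiff (prod_man M N) N snd (p, q)"
proof -
  obtain c where c: "c \<in> charts_at M p" using pts_chart[OF p] by blast
  obtain d where d: "d \<in> charts_at N q" using pts_chart[OF q] by blast
  have cd: "c \<in> M" "d \<in> N" using c d by (auto simp: charts_at_iff)
  have d': "d \<in> charts_at N (snd (p, q))" using d by simp
  have "\<forall>\<^sub>F u in nhds (snd c p, snd d q). fst u \<in> snd c ` fst c \<and> snd u \<in> snd d ` fst d"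
    unfolding nhds_prod
    by (rule eventually_prodI[OF eventually_chart_image[OF M c] eventually_chart_image[OF N d], simplified])
  then have ev: "\<forall>\<^sub>F u in nhds (snd (prod_chart c d) (p, q)).
      snd (inv_into (fst (prod_chart c d)) (snd (prod_chart c d)) u) = chart_inv d (snd u) \<and>
      snd u \<in> snd d ` fst d"
    unfolding snd_prod_chart
  proof eventually_elim
    case (elim u)
    then show ?case
      using inv_prod_chart[OF M N cd, of "fst u" "snd u"] by simp
  qed
  show ?thesis
  proof (rule mdiffI[where f = snd, OF smooth_atlas_prod[OF M N] N charts_at_prod_chart[OF M N c d] d'])
    show "\<forall>\<^sub>F u in nhds (snd (prod_chart c d) (p, q)).
        snd (inv_into (fst (prod_chart c d)) (snd (prod_chart c d)) u) \<in> fst d"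
      using ev by eventually_elim (auto intro: inv_into_into)
    have eq: "\<forall>\<^sub>F u in nhds (snd (prod_chart c d) (p, q)).
        snd u = snd d (snd (inv_into (fst (prod_chart c d)) (snd (prod_chart c d)) u))"
      using ev by eventually_elim (auto simp: f_inv_into_f)
    show "(\<lambda>u. snd d (snd (inv_into (fst (prod_chart c d)) (snd (prod_chart c d)) u)))
        differentiable at (snd (prod_chart c d) (p, q))"
      by (rule differentiable_cong_nhds[OF bounded_linear_imp_differentiable[OF bounded_linear_snd] eq])
  qed
qed

text \<open>The addition that the product rule requires, beside the given \<open>tminus\<close> and
  \<open>tscale\<close>.\<close>

definition tplus :: "('a, 'e::model_space) tangent \<Rightarrow> ('a, 'e) tangent \<Rightarrow> ('a, 'e) tangent" where
  "tplus v w = (\<lambda>c. v c + w c)"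

lemma mdiff_slice:
  assumes M: "smooth_atlas M" and N: "smooth_atlas N" and K: "smooth_atlas K"
    and f: "mdiff (prod_man M N) K f (p, q)"
  shows "mdiff M K (\<lambda>x. f (x, q)) p" "mdiff N K (\<lambda>y. f (p, y)) q"
proof -
  have pq: "p \<in> pts M" "q \<in> pts N"
    using mdiffD(1)[OF f] pts_prod_man[OF M N] by auto
  show "mdiff M K (\<lambda>x. f (x, q)) p"
    by (rule mdiff_compose[where f = "\<lambda>x. (x, q)", OF M smooth_atlas_prod[OF M N] K
          mdiff_Pair[OF M M N mdiff_ident[OF M pq(1)] mdiff_const[OF M N pq]] f])
  show "mdiff N K (\<lambda>y. f (p, y)) q"
    by (rule mdiff_compose[where f = "\<lambda>y. (p, y)", OF N smooth_atlas_prod[OF M N] K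
          mdiff_Pair[OF N M N mdiff_const[OF N M pq(2,1)] mdiff_ident[OF N pq(2)]] f])
qed

text \<open>The total derivative at a pair is linear, and (v, w) = (v, 0) + (0, w). Each summand is
  recognized as the tangent map of a slice by holding the other curve constant.\<close>

lemma has_velocity_product:
  fixes M :: "('a, 'e::model_space) manifold" and N :: "('b, 'f::model_space) manifold"
    and K :: "('c, 'h::model_space) manifold"
  assumes M: "smooth_atlas M" and N: "smooth_atlas N" and K: "smooth_atlas K"
    and f: "mdiff (prod_man M N) K f (\<gamma> t, \<delta> t)"
    and v: "has_velocity M \<gamma> v t" and w: "has_velocity N \<delta> w t"
  shows "has_velocity K (\<lambda>s. f (\<gamma> s, \<delta> s))
    (tplus (tangent_map M K (\<lambda>x. f (x, \<delta> t)) (\<gamma> t) v) (tangent_map N K (\<lambda>y. f (\<gamma> t, y)) (\<delta> t) w)) t"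
    (is "has_velocity K _ (tplus ?v ?w) t")
proof -
  let ?p = "\<gamma> t" and ?q = "\<delta> t"
  obtain c where c: "c \<in> charts_at M ?p" using pts_chart[OF has_velocityD(1)[OF v]] by blast
  obtain d where d: "d \<in> charts_at N ?q" using pts_chart[OF has_velocityD(1)[OF w]] by blast
  have cd: "c \<in> M" "d \<in> N" using c d by (auto simp: charts_at_iff)
  note P = charts_at_prod_chart[OF M N c d]
  let ?C = "prod_chart c d"
  let ?i = "inv_into (fst c \<times> fst d) (snd ?C)"
  define F where "F e u = snd e (f (?i u))" for e :: "('c, 'h) chart" and u
  define D where "D e = frechet_derivative (F e) (at (snd c ?p, snd d ?q))" for e
  have F: "(F e has_derivative D e) (at (snd c ?p, snd d ?q))"
    and Fev: "\<forall>\<^sub>F u in nhds (snd c ?p, snd d ?q). f (?i u) \<in> fst e" if e: "e \<in> charts_at K (f (?p, ?q))" for e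
  proof -
    have "F e differentiable at (snd c ?p, snd d ?q)"
      using mdiffD(4)[OF f P e] by (simp add: F_def[abs_def])
    then show "(F e has_derivative D e) (at (snd c ?p, snd d ?q))" by (simp add: D_def frechet_derivative_works)
    show "\<forall>\<^sub>F u in nhds (snd c ?p, snd d ?q). f (?i u) \<in> fst e"
      using mdiffD(3)[OF f P e] by simp
  qed
  have inv: "?i (snd c x, snd d y) = (x, y)" if "x \<in> fst c" "y \<in> fst d" for x y
    using inv_prod_chart[OF M N cd, of "snd c x" "snd d y"] that smooth_atlas_inj[OF M cd(1)] smooth_atlas_inj[OF N cd(2)]
    by simp
  \<comment> \<open>Stated for arbitrary curves through the same point, since it is applied to the
    given pair and to the pairs in which one curve is constant.\<close>
  have curve: "((\<lambda>s. snd e (f (\<gamma>' s, \<delta>' s))) has_vector_derivative D e (v' c, w' d)) (at t)"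
      and curve_ev: "\<forall>\<^sub>F s in nhds t. f (\<gamma>' s, \<delta>' s) \<in> fst e"
    if v': "has_velocity M \<gamma>' v' t" and w': "has_velocity N \<delta>' w' t" and eq: "\<gamma>' t = ?p" "\<delta>' t = ?q"
      and e: "e \<in> charts_at K (f (?p, ?q))" for \<gamma>' \<delta>' v' w' e
  proof -
    have c': "c \<in> charts_at M (\<gamma>' t)" "d \<in> charts_at N (\<delta>' t)" using c d eq by simp_all
    have pair: "((\<lambda>s. (snd c (\<gamma>' s), snd d (\<delta>' s))) has_vector_derivative (v' c, w' d)) (at t)"
      by (rule has_vector_derivative_Pair[OF has_velocityD(4)[OF v' c'(1)] has_velocityD(4)[OF w' c'(2)]])
    have ev: "\<forall>\<^sub>F s in nhds t. \<gamma>' s \<in> fst c \<and> \<delta>' s \<in> fst d"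
      using has_velocityD(3)[OF v' c'(1)] has_velocityD(3)[OF w' c'(2)] by eventually_elim simp
    have "((\<lambda>s. F e (snd c (\<gamma>' s), snd d (\<delta>' s))) has_vector_derivative D e (v' c, w' d)) (at t)"
      by (rule has_vector_derivative_chain[OF pair]) (simp only: eq F[OF e])
    moreover have "\<forall>\<^sub>F s in nhds t. F e (snd c (\<gamma>' s), snd d (\<delta>' s)) = snd e (f (\<gamma>' s, \<delta>' s))"
      using ev by eventually_elim (simp add: F_def inv)
    ultimately show "((\<lambda>s. snd e (f (\<gamma>' s, \<delta>' s))) has_vector_derivative D e (v' c, w' d)) (at t)"
      by (rule has_vector_derivative_cong_nhds)
    have cont: "isCont (\<lambda>s. (snd c (\<gamma>' s), snd d (\<delta>' s))) t"
      using pair has_vector_derivative_continuous by blast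
    have "\<forall>\<^sub>F s in nhds t. f (?i (snd c (\<gamma>' s), snd d (\<delta>' s))) \<in> fst e"
      by (rule eventually_nhds_continuous[OF cont]) (simp only: eq Fev[OF e])
    then show "\<forall>\<^sub>F s in nhds t. f (\<gamma>' s, \<delta>' s) \<in> fst e"
      using ev by eventually_elim (simp add: inv)
  qed
  have pts: "?p \<in> pts M" "?q \<in> pts N" using has_velocityD(1)[OF v] has_velocityD(1)[OF w] .
  have V: "has_velocity K (\<lambda>s. f (\<gamma> s, ?q)) ?v t"
    using mdiff_velocity[OF M K _ v, of "\<lambda>x. f (x, ?q)"] mdiff_slice(1)[OF M N K f] by simp
  have W: "has_velocity K (\<lambda>s. f (?p, \<delta> s)) ?w t"
    using mdiff_velocity[OF N K _ w, of "\<lambda>y. f (?p, y)"] mdiff_slice(2)[OF M N K f] by simp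
  have vD: "?v e = D e (v c, 0)" if e: "e \<in> charts_at K (f (?p, ?q))" for e
  proof -
    have "((\<lambda>s. snd e (f (\<gamma> s, ?q))) has_vector_derivative D e (v c, tzero d)) (at t)"
      by (rule curve[where \<delta>' = "\<lambda>_. ?q"]) (use v has_velocity_const[OF N pts(2)] e in simp_all)
    from vector_derivative_unique_at[OF has_velocityD(4)[OF V e] this] show ?thesis by (simp add: tzero_def)
  qed
  have wD: "?w e = D e (0, w d)" if e: "e \<in> charts_at K (f (?p, ?q))" for e
  proof -
    have "((\<lambda>s. snd e (f (?p, \<delta> s))) has_vector_derivative D e (tzero c, w d)) (at t)"
      by (rule curve[where \<gamma>' = "\<lambda>_. ?p"]) (use w has_velocity_const[OF M pts(1)] e in simp_all)
    from vector_derivative_unique_at[OF has_velocityD(4)[OF W e] this] show ?thesis by (simp add: tzero_def)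
  qed
  obtain e where e: "e \<in> charts_at K (f (?p, ?q))" using pts_chart[OF mdiffD(2)[OF f]] by blast
  show ?thesis
  proof (rule has_velocityI[where c = e, OF K])
    show "e \<in> charts_at K (f (?p, ?q))" by (rule e)
    have "tplus ?v ?w = tminus ?v (tscale (-1) ?w)" by (simp add: tplus_def tminus_def tscale_def)
    then show "tplus ?v ?w \<in> tangent_space K (f (?p, ?q))"
      using tminus_in_tangent_space[OF K has_velocityD(2)[OF V] tscale_in_tangent_space[OF K has_velocityD(2)[OF W]]]
      by simp
    show "\<forall>\<^sub>F s in nhds t. f (\<gamma> s, \<delta> s) \<in> fst e" by (rule curve_ev[OF v w refl refl e])
    have "linear (D e)" using F[OF e] has_derivative_linear by blast
    from linear_add[OF this, of "(v c, 0)" "(0, w d)"]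
    have "D e (v c, w d) = tplus ?v ?w e" by (simp add: tplus_def vD[OF e] wD[OF e])
    then show "((\<lambda>s. snd e (f (\<gamma> s, \<delta> s))) has_vector_derivative tplus ?v ?w e) (at t)"
      using curve[OF v w refl refl e] by simp
  qed
qed

section \<open>The real line and smooth curves with given velocity\<close>

lemma smooth_atlas_line: "smooth_atlas line"
  unfolding line_def by (rule smooth_atlas_max_atlas) simp

lemma line_chart:
  assumes "open (I :: real set)" shows "(I, id) \<in> line"
proof -
  have inj: "inj_on (snd d) (fst d)" if "d \<in> {(UNIV, id :: real \<Rightarrow> real)}" for d using that by simp
  have "smooth_on UNIV (transition (UNIV, id) (UNIV, id :: real \<Rightarrow> real))"
    by (rule smooth_on_bounded_linear) (simp add: transition_def inv_id comp_def bounded_linear_ident id_def)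
  then have "(UNIV, id) \<in> max_atlas {(UNIV, id :: real \<Rightarrow> real)}"
    by (simp add: max_atlas_iff compatible_def)
  from max_atlas_restrict[OF inj this, of I] show ?thesis using assms by (simp add: line_def)
qed

lemma line_chart_smooth:
  assumes "c \<in> line"
  shows "open (fst c)" "smooth_on (snd c ` fst c) (chart_inv c)"
proof -
  have "compatible c (UNIV, id)" using assms by (simp add: line_def max_atlas_iff)
  then show "open (fst c)" "smooth_on (snd c ` fst c) (chart_inv c)"
    by (simp_all add: compatible_def transition_def)
qed

text \<open>A straight line in a chart. It is shown to be smooth, and not merely differentiable at
  0, because \<open>darboux_lie\<close> admits only smooth curves as witnesses for
  \<open>Z\<close>.\<close>

lemma tangent_smooth_curve:
  assumes M: "smooth_atlas M" and p: "p \<in> pts M" and v: "v \<in> tangent_space M p"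
  obtains I \<gamma> where "open I" "is_interval I" "0 \<in> I" "smooth_map (open_sub line I) M \<gamma>"
    "\<gamma> 0 = p" "has_velocity M \<gamma> v 0"
proof -
  obtain c where c: "c \<in> charts_at M p" using pts_chart[OF p] by blast
  have cM: "c \<in> M" "p \<in> fst c" using c by (auto simp: charts_at_iff)
  have inj: "inj_on (snd c) (fst c)" using smooth_atlas_inj[OF M cM(1)] .
  let ?l = "\<lambda>s::real. snd c p + s *\<^sub>R v c"
  define \<gamma> where "\<gamma> s = chart_inv c (?l s)" for s
  have contl: "continuous_on UNIV ?l" by (intro continuous_intros)
  have "open (snd c ` fst c)" using M cM by (simp add: smooth_atlas_def)
  then have "open {s \<in> UNIV. ?l s \<in> snd c ` fst c}"
    by (intro open_preimage_continuous_on contl) auto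
  moreover have "0 \<in> {s \<in> UNIV. ?l s \<in> snd c ` fst c}" using cM by simp
  ultimately obtain r where r: "r > 0" "ball 0 r \<subseteq> {s \<in> UNIV. ?l s \<in> snd c ` fst c}"
    using open_contains_ball by blast
  define I where "I = ball (0::real) r"
  have I: "?l s \<in> snd c ` fst c" if "s \<in> I" for s using r(2) that by (auto simp: I_def)
  have \<gamma>c: "\<gamma> s \<in> fst c" "snd c (\<gamma> s) = ?l s" if "s \<in> I" for s
    using I[OF that] by (simp_all add: \<gamma>_def inv_into_into f_inv_into_f)
  have oI: "open I" "0 \<in> I" using r(1) by (simp_all add: I_def)
  \<comment> \<open>Both continuity of \<gamma> and openness of the domains of its coordinate
    expressions reduce to this.\<close>
  have pre: "open {s \<in> O'. \<gamma> s \<in> fst d}" if "open O'" "O' \<subseteq> I" "d \<in> M" for O' d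
  proof -
    have "open {s \<in> O'. ?l s \<in> snd c ` (fst c \<inter> fst d)}"
      by (rule open_preimage_continuous_on[OF that(1) open_chart_overlap[OF M cM(1) that(3)]])
        (intro continuous_intros)
    moreover have "?l s \<in> snd c ` (fst c \<inter> fst d) \<longleftrightarrow> \<gamma> s \<in> fst d" if "s \<in> I" for s
      using inj_on_image_mem_iff[OF inj \<gamma>c(1)[OF that], of "fst c \<inter> fst d"] \<gamma>c[OF that] by auto
    then have "{s \<in> O'. ?l s \<in> snd c ` (fst c \<inter> fst d)} = {s \<in> O'. \<gamma> s \<in> fst d}"
      using that(2) by blast
    ultimately show ?thesis by simp
  qed
  have ptsI: "pts (open_sub line I) = I"
    using line_chart[OF oI(1)] by (force simp: pts_def open_sub_iff)
  have "continuous_map (man_top (open_sub line I)) (man_top M) \<gamma>"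
    unfolding man_top_def[of M]
  proof (rule continuous_on_generated_topo)
    fix U assume "U \<in> fst ` M"
    then obtain d where d: "d \<in> M" "U = fst d" by blast
    have "openin (man_top (open_sub line I)) (fst ({s \<in> I. \<gamma> s \<in> fst d}, id :: real \<Rightarrow> real))"
      using line_chart[OF pre[OF oI(1) subset_refl d(1)]]
      by (intro openin_chart_domain) (auto simp: open_sub_iff)
    moreover have "{s \<in> I. \<gamma> s \<in> fst d} = \<gamma> -` U \<inter> topspace (man_top (open_sub line I))"
      by (auto simp: topspace_man_top ptsI d(2))
    ultimately show "openin (man_top (open_sub line I)) (\<gamma> -` U \<inter> topspace (man_top (open_sub line I)))" by simp
  next
    show "\<gamma> ` topspace (man_top (open_sub line I)) \<subseteq> \<Union>(fst ` M)"
      using \<gamma>c(1) cM(1) by (auto simp: topspace_man_top ptsI)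
  qed
  moreover have "smooth_on (snd e ` {x \<in> fst e. \<gamma> x \<in> fst d}) (\<lambda>u. snd d (\<gamma> (chart_inv e u)))"
    if e: "e \<in> open_sub line I" and d: "d \<in> M" for e d
  proof -
    have eI: "e \<in> line" "fst e \<subseteq> I" using e by (auto simp: open_sub_iff)
    let ?O = "{x \<in> fst e. \<gamma> x \<in> fst d}"
    note es = line_chart_smooth[OF eI(1)]
    have oO: "open ?O" by (rule pre[OF es(1) eI(2) d])
    have inje: "inj_on (snd e) (fst e)" by (rule smooth_atlas_inj[OF smooth_atlas_line eI(1)])
    have "open (snd e ` (fst e \<inter> fst (?O, id :: real \<Rightarrow> real)))"
      by (rule open_chart_overlap[OF smooth_atlas_line eI(1) line_chart[OF oO]])
    moreover have "fst e \<inter> ?O = ?O" by blast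
    ultimately have oeO: "open (snd e ` ?O)" by simp
    \<comment> \<open>In the chart \<open>d\<close> the curve is a transition map applied to an
      affine map.\<close>
    have "smooth_on ?O (\<lambda>s. transition c d (?l s))"
    proof (rule smooth_on_compose[where f = ?l and g = "transition c d", OF oO open_chart_overlap[OF M cM(1) d]])
      show "?l ` ?O \<subseteq> snd c ` (fst c \<inter> fst d)"
      proof clarify
        fix s assume s: "s \<in> fst e" "\<gamma> s \<in> fst d"
        then have sI: "s \<in> I" using eI(2) by blast
        show "?l s \<in> snd c ` (fst c \<inter> fst d)"
          using \<gamma>c[OF sI] s(2) by (metis IntI image_eqI)
      qed
      show "smooth_on ?O ?l"
        by (rule smooth_on_add[OF oO smooth_on_const smooth_on_bounded_linear[OF bounded_linear_scaleR_left]])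
      show "smooth_on (snd c ` (fst c \<inter> fst d)) (transition c d)"
        by (rule compatible_smooth[OF smooth_atlas_compatible[OF M cM(1) d]])
    qed
    then have s1: "smooth_on ?O (\<lambda>s. snd d (\<gamma> s))"
      by (rule smooth_on_cong[OF oO, rotated]) (simp add: transition_def \<gamma>_def)
    show ?thesis
    proof (rule smooth_on_compose[where f = "chart_inv e" and g = "\<lambda>s. snd d (\<gamma> s)", OF oeO oO])
      show "chart_inv e ` snd e ` ?O \<subseteq> ?O" using inje by auto
      show "smooth_on (snd e ` ?O) (chart_inv e)"
        by (rule smooth_on_subset[OF es(2)]) blast
    qed (rule s1)
  qed
  ultimately have "smooth_map (open_sub line I) M \<gamma>"
    unfolding smooth_map_def by (auto simp: comp_def)
  moreover have \<gamma>0: "\<gamma> 0 = p" by (simp add: \<gamma>_def inj cM)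
  moreover have "has_velocity M \<gamma> v 0"
  proof (rule has_velocityI[OF M])
    show "c \<in> charts_at M (\<gamma> 0)" "v \<in> tangent_space M (\<gamma> 0)" using c v by (simp_all add: \<gamma>0)
    have ev: "\<forall>\<^sub>F s in nhds 0. s \<in> I" by (rule eventually_nhds_in_open[OF oI])
    then show "\<forall>\<^sub>F s in nhds 0. \<gamma> s \<in> fst c" by eventually_elim (rule \<gamma>c)
    have "(?l has_vector_derivative v c) (at 0)"
      by (auto intro!: derivative_eq_intros)
    moreover have "\<forall>\<^sub>F s in nhds 0. ?l s = snd c (\<gamma> s)" using ev by eventually_elim (simp add: \<gamma>c)
    ultimately show "((\<lambda>s. snd c (\<gamma> s)) has_vector_derivative v c) (at 0)"
      by (rule has_vector_derivative_cong_nhds)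
  qed
  ultimately show thesis using that[of I \<gamma>] oI by (simp add: I_def is_interval_ball_real)
qed

section \<open>Integral curves and flows\<close>

lemma vector_derivative_bound:
  fixes w :: "real \<Rightarrow> 'a::real_normed_vector"
  assumes "convex T" and d: "\<And>s. s \<in> T \<Longrightarrow> (w has_vector_derivative w' s) (at s within T)"
    and B: "\<And>s. s \<in> T \<Longrightarrow> norm (w' s) \<le> B" and st: "s \<in> T" "t \<in> T"
  shows "norm (w s - w t) \<le> B * \<bar>s - t\<bar>"
proof -
  have B0: "0 \<le> B" using B[OF st(1)] norm_ge_zero order_trans by blast
  have "norm (w s - w t) \<le> B * norm (s - t)"
  proof (rule differentiable_bound[OF assms(1) _ _ st])
    show "(w has_derivative (\<lambda>h. h *\<^sub>R w' x)) (at x within T)" if "x \<in> T" for x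
      using d[OF that] by (simp add: has_vector_derivative_def)
    show "onorm (\<lambda>h. h *\<^sub>R w' x) \<le> B" if "x \<in> T" for x
    proof (rule onorm_bound[OF B0])
      show "norm (h *\<^sub>R w' x) \<le> B * norm h" for h
        using mult_left_mono[OF B[OF that], of "\<bar>h\<bar>"] by (simp add: mult.commute)
    qed
  qed
  then show ?thesis by simp
qed

text \<open>Banach's fixed point theorem for the integral operator, on bounded continuous curves
  with values in a closed ball about \<open>x0\<close>.\<close>

lemma picard_existence:
  fixes f :: "'a::banach \<Rightarrow> 'a"
  assumes r: "r > 0" and lip: "L-lipschitz_on (ball x0 r) f"
  obtains e x where "e > 0" "x 0 = x0" "\<And>t. \<bar>t\<bar> < e \<Longrightarrow> x t \<in> ball x0 r"
    "\<And>t. \<bar>t\<bar> < e \<Longrightarrow> (x has_vector_derivative f (x t)) (at t)"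
proof -
  \<comment> \<open>A closed ball inside the Lipschitz ball; the curves with values in it form a
    complete space.\<close>
  define R where "R = r / 2"
  have R: "R > 0" "cball x0 R \<subseteq> ball x0 r" using r by (auto simp: R_def)
  have L: "L \<ge> 0" and lipD: "\<And>y z. y \<in> ball x0 r \<Longrightarrow> z \<in> ball x0 r \<Longrightarrow> norm (f y - f z) \<le> L * norm (y - z)"
    using lip by (auto simp: lipschitz_on_def dist_norm)
  define B where "B = norm (f x0) + L * R"
  have B0: "B \<ge> 0" using L R by (simp add: B_def)
  have B: "norm (f y) \<le> B" if "y \<in> cball x0 R" for y
  proof -
    have "norm (f y - f x0) \<le> L * norm (y - x0)" using that R r by (intro lipD) auto
    also have "\<dots> \<le> L * R" using that L by (intro mult_left_mono) (auto simp: dist_norm norm_minus_commute)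
    finally show ?thesis
      using norm_triangle_ineq[of "f x0" "f y - f x0"] by (simp add: B_def)
  qed
  \<comment> \<open>The first bound gives B e \<le> R, which keeps the iterates in the closed ball;
    the second gives L e \<le> 1/2, which makes the operator a contraction. The added ones prevent
    division by zero.\<close>
  define e where "e = min (R / (B + 1)) (1 / (2 * (L + 1)))"
  have e: "e > 0" using R B0 L by (simp add: e_def)
  have eB: "B * e \<le> R"
  proof -
    have "B * e \<le> (B + 1) * (R / (B + 1))"
      using e B0 by (intro mult_mono) (auto simp: e_def)
    then show ?thesis using B0 by simp
  qed
  have eL: "L * e \<le> 1 / 2"
  proof -
    have "L * e \<le> (L + 1) * (1 / (2 * (L + 1)))"
      using e L by (intro mult_mono) (auto simp: e_def)
    also have "\<dots> = 1 / 2" using L by (simp add: field_simps)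
    finally show ?thesis .
  qed
  define I where "I = {-e..e}"
  have I0: "0 \<in> I" using e by (simp add: I_def)
  have cI: "convex I" by (simp add: I_def)
  \<comment> \<open>Clamps the time to \<open>I\<close>, so that the iterates are bounded continuous
    functions on the whole line, as the type of the function space demands.\<close>
  define cl where "cl t = max (-e) (min e t)" for t :: real
  have cl: "cl t \<in> I" for t using e by (auto simp: cl_def I_def)
  have clI: "cl t = t" if "t \<in> I" for t using that by (auto simp: cl_def I_def)
  have clabs: "\<bar>cl t - 0\<bar> \<le> e" for t using cl[of t] by (auto simp: I_def)
  define S :: "(real \<Rightarrow>\<^sub>C 'a) set" where "S = PiC UNIV (\<lambda>_. cball x0 R)"
  have S: "apply_bcontfun x t \<in> cball x0 R" if "x \<in> S" for x t
    using that by (auto simp: S_def mem_PiC_iff)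
  \<comment> \<open>The primitive starts at the left end, so that \<open>J x t - J x 0\<close> is
    the integral from 0 to \<open>t\<close> for either sign of \<open>t\<close>.\<close>
  define J where "J x t = integral {-e..t} (\<lambda>s. f (apply_bcontfun x s))" for x :: "real \<Rightarrow>\<^sub>C 'a" and t
  have fc: "continuous_on (ball x0 r) f" using lip by (rule lipschitz_on_continuous_on)
  have Jd: "(J x has_vector_derivative f (apply_bcontfun x t)) (at t within I)" if "x \<in> S" "t \<in> I" for x t
    unfolding I_def J_def
  proof (rule integral_has_vector_derivative)
    show "continuous_on {-e..e} (\<lambda>s. f (apply_bcontfun x s))"
      by (rule continuous_on_compose2[OF fc]) (use S[OF that(1)] R(2) in auto)
  qed (use that in \<open>simp add: I_def\<close>)
  have Jcont: "continuous_on I (J x)" if "x \<in> S" for x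
    by (rule continuous_on_vector_derivative[OF Jd[OF that]])
  define \<Phi> where "\<Phi> x t = x0 + (J x (cl t) - J x 0)" for x t
  have \<Phi>B: "dist x0 (\<Phi> x t) \<le> R" if "x \<in> S" for x t
  proof -
    have "norm (J x (cl t) - J x 0) \<le> B * \<bar>cl t - 0\<bar>"
      by (rule vector_derivative_bound[OF cI Jd[OF that] B[OF S[OF that]] cl I0])
    also have "\<dots> \<le> B * e" using B0 clabs by (intro mult_left_mono)
    finally show ?thesis using eB by (simp add: \<Phi>_def dist_norm norm_minus_commute)
  qed
  have \<Phi>b: "\<Phi> x \<in> bcontfun" if "x \<in> S" for x
  proof (rule bcontfun_normI)
    have "continuous_on UNIV cl" unfolding cl_def by (intro continuous_intros)
    then have "continuous_on UNIV (\<lambda>t. J x (cl t))"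
      by (rule continuous_on_compose2[OF Jcont[OF that]]) (use cl in auto)
    then show "continuous_on UNIV (\<Phi> x)" unfolding \<Phi>_def by (intro continuous_intros)
    show "norm (\<Phi> x t) \<le> norm x0 + R" for t
      using \<Phi>B[OF that, of t] norm_triangle_ineq[of x0 "\<Phi> x t - x0"] by (simp add: dist_norm norm_minus_commute)
  qed
  define T where "T x = Bcontfun (\<Phi> x)" for x
  have T: "apply_bcontfun (T x) t = \<Phi> x t" if "x \<in> S" for x t
    using \<Phi>b[OF that] by (simp add: T_def Bcontfun_inverse)
  have "\<exists>!x. x \<in> S \<and> T x = x"
  proof (rule Banach_fix[of _ "1/2"])
    show "complete S" unfolding S_def by (intro closed_PiC closed_cball complete_eq_closed[THEN iffD2])
    have "const_bcontfun x0 \<in> S" using R(1) by (auto simp: S_def mem_PiC_iff const_bcontfun.rep_eq)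
    then show "S \<noteq> {}" by blast
    show "T ` S \<subseteq> S"
    proof clarify
      fix x assume x: "x \<in> S"
      show "T x \<in> S"
        unfolding S_def mem_PiC_iff using \<Phi>B[OF x] by (auto simp: T[OF x])
    qed
    show "dist (T x) (T y) \<le> 1/2 * dist x y" if xy: "x \<in> S" "y \<in> S" for x y
    proof (rule dist_bound)
      fix t
      have "norm ((J x (cl t) - J y (cl t)) - (J x 0 - J y 0)) \<le> L * dist x y * \<bar>cl t - 0\<bar>"
      proof (rule vector_derivative_bound[where w = "\<lambda>t. J x t - J y t", OF cI _ _ cl I0])
        fix s assume s: "s \<in> I"
        show "((\<lambda>t. J x t - J y t) has_vector_derivative f (apply_bcontfun x s) - f (apply_bcontfun y s)) (at s within I)"
          by (intro has_vector_derivative_diff Jd xy s)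
        have "norm (f (apply_bcontfun x s) - f (apply_bcontfun y s)) \<le> L * norm (apply_bcontfun x s - apply_bcontfun y s)"
          using S xy R(2) by (intro lipD) blast+
        also have "\<dots> \<le> L * dist x y"
          using L dist_bounded[of x s y] by (intro mult_left_mono) (auto simp: dist_norm)
        finally show "norm (f (apply_bcontfun x s) - f (apply_bcontfun y s)) \<le> L * dist x y" .
      qed
      also have "\<dots> \<le> L * dist x y * e" using L clabs by (intro mult_left_mono) auto
      also have "\<dots> = (L * e) * dist x y" by simp
      also have "\<dots> \<le> 1/2 * dist x y" using eL by (intro mult_right_mono) auto
      finally show "dist (apply_bcontfun (T x) t) (apply_bcontfun (T y) t) \<le> 1/2 * dist x y"
        by (simp add: T xy \<Phi>_def dist_norm algebra_simps)
    qed
  qed auto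
  then obtain x where x: "x \<in> S" "T x = x" by blast
  have xt: "apply_bcontfun x t = x0 + (J x t - J x 0)" if "t \<in> I" for t
    using T[OF x(1), of t] x(2) clI[OF that] by (simp add: \<Phi>_def)
  show thesis
  proof (rule that[of e "apply_bcontfun x"])
    show "apply_bcontfun x 0 = x0" using xt[OF I0] by simp
    fix t :: real assume t: "\<bar>t\<bar> < e"
    show "apply_bcontfun x t \<in> ball x0 r" using S[OF x(1)] R(2) by blast
    have tI: "t \<in> interior I" "t \<in> I" using t by (auto simp: I_def)
    have "((\<lambda>t. x0 + (J x t - J x 0)) has_vector_derivative f (apply_bcontfun x t)) (at t within I)"
      using Jd[OF x(1) tI(2)] by (auto intro!: derivative_eq_intros)
    then have "((\<lambda>t. x0 + (J x t - J x 0)) has_vector_derivative f (apply_bcontfun x t)) (at t)"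
      unfolding at_within_interior[OF tI(1)] .
    moreover have "\<forall>\<^sub>F s in nhds t. x0 + (J x s - J x 0) = apply_bcontfun x s"
      using eventually_nhds_in_open[OF open_interior tI(1)]
    proof eventually_elim
      case (elim s)
      then have "s \<in> I" using interior_subset by blast
      then show ?case by (simp add: xt)
    qed
    ultimately show "(apply_bcontfun x has_vector_derivative f (apply_bcontfun x t)) (at t)"
      by (rule has_vector_derivative_cong_nhds)
  qed (rule e)
qed

text \<open>In place of Gronwall's inequality: let m be the maximum of |x - y| on the interval of
  half-length \<open>h\<close> about \<open>t0\<close>. The derivative of x - y is bounded by L m,
  whence m \<le> L h m \<le> m/2 and m = 0.\<close>

lemma ode_local_uniqueness:
  fixes x y :: "real \<Rightarrow> 'a::real_normed_vector"
  assumes r: "r > 0" and lip: "L-lipschitz_on (ball (x t0) r) f" and eq: "x t0 = y t0"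
    and x: "\<forall>\<^sub>F t in nhds t0. (x has_vector_derivative f (x t)) (at t)"
    and y: "\<forall>\<^sub>F t in nhds t0. (y has_vector_derivative f (y t)) (at t)"
  shows "\<forall>\<^sub>F t in nhds t0. x t = y t"
proof -
  have L: "L \<ge> 0" and lipD: "\<And>u v. u \<in> ball (x t0) r \<Longrightarrow> v \<in> ball (x t0) r \<Longrightarrow> norm (f u - f v) \<le> L * norm (u - v)"
    using lip by (auto simp: lipschitz_on_def dist_norm)
  have "isCont x t0" "isCont y t0"
    using eventually_nhds_x_imp_x[OF x] eventually_nhds_x_imp_x[OF y] has_vector_derivative_continuous by blast+
  note cont = this
  have "\<forall>\<^sub>F u in nhds (x t0). u \<in> ball (x t0) r"
    using r by (intro eventually_nhds_in_open) auto
  then have "\<forall>\<^sub>F t in nhds t0. x t \<in> ball (x t0) r" "\<forall>\<^sub>F t in nhds t0. y t \<in> ball (x t0) r"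
    using eventually_nhds_continuous[OF cont(1)] eventually_nhds_continuous[OF cont(2)] eq by simp_all
  with x y have "\<forall>\<^sub>F t in nhds t0. (x has_vector_derivative f (x t)) (at t) \<and>
      (y has_vector_derivative f (y t)) (at t) \<and> x t \<in> ball (x t0) r \<and> y t \<in> ball (x t0) r"
    by eventually_elim simp
  then obtain d where d: "d > 0" "\<And>t. dist t t0 < d \<Longrightarrow> (x has_vector_derivative f (x t)) (at t) \<and>
      (y has_vector_derivative f (y t)) (at t) \<and> x t \<in> ball (x t0) r \<and> y t \<in> ball (x t0) r"
    unfolding eventually_nhds_metric by blast
  define h where "h = min (d / 2) (1 / (2 * (L + 1)))"
  have h: "h > 0" "h < d" using d(1) L by (auto simp: h_def)
  have hL: "L * h \<le> 1 / 2"
  proof -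
    have "L * h \<le> (L + 1) * (1 / (2 * (L + 1)))" using h L by (intro mult_mono) (auto simp: h_def)
    also have "\<dots> = 1 / 2" using L by (simp add: field_simps)
    finally show ?thesis .
  qed
  let ?K = "cball t0 h"
  have K: "dist t t0 < d" if "t \<in> ?K" for t using that h by (auto simp: dist_commute)
  have xK: "(x has_vector_derivative f (x t)) (at t)" and yK: "(y has_vector_derivative f (y t)) (at t)"
    and bK: "x t \<in> ball (x t0) r" "y t \<in> ball (x t0) r" if "t \<in> ?K" for t
    using d(2)[OF K[OF that]] by blast+
  have w: "((\<lambda>t. x t - y t) has_vector_derivative f (x t) - f (y t)) (at t within ?K)" if "t \<in> ?K" for t
    by (rule has_vector_derivative_at_within[OF has_vector_derivative_diff[OF xK[OF that] yK[OF that]]])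
  have "continuous_on ?K (\<lambda>t. x t - y t)"
    by (rule continuous_on_vector_derivative[OF w])
  then have "continuous_on ?K (\<lambda>t. norm (x t - y t))" by (rule continuous_on_norm)
  moreover have "?K \<noteq> {}" using h by auto
  ultimately have "\<exists>t1\<in>?K. \<forall>t\<in>?K. norm (x t - y t) \<le> norm (x t1 - y t1)"
    by (intro continuous_attains_sup compact_cball)
  then obtain t1 where t1: "t1 \<in> ?K" "\<And>t. t \<in> ?K \<Longrightarrow> norm (x t - y t) \<le> norm (x t1 - y t1)"
    by blast
  let ?m = "norm (x t1 - y t1)"
  have "norm ((x t1 - y t1) - (x t0 - y t0)) \<le> L * ?m * \<bar>t1 - t0\<bar>"
  proof (rule vector_derivative_bound[where w = "\<lambda>t. x t - y t", OF convex_cball w _ t1(1)])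
    show "norm (f (x s) - f (y s)) \<le> L * ?m" if "s \<in> ?K" for s
      using lipD[OF bK[OF that]] mult_left_mono[OF t1(2)[OF that] L] by linarith
    show "t0 \<in> ?K" using h by simp
  qed
  also have "\<dots> \<le> L * ?m * h"
    using t1(1) L by (intro mult_left_mono) (auto simp: dist_real_def abs_minus_commute)
  also have "\<dots> = (L * h) * ?m" by simp
  also have "\<dots> \<le> 1 / 2 * ?m" using hL by (intro mult_right_mono) auto
  finally have m: "?m = 0" using eq by simp
  have "x t = y t" if "dist t t0 < h" for t
    using t1(2)[of t] that m by (auto simp: dist_commute)
  then show ?thesis unfolding eventually_nhds_metric using h(1) by blast
qed

text \<open>The regularity on which existence and uniqueness of integral curves rest. It is derived
  both for smooth vector fields and, directly from the multiplication, for left-invariant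
  fields.\<close>

definition loc_lipschitz_field :: "('a, 'e::model_space) manifold \<Rightarrow> ('a \<Rightarrow> ('a, 'e) tangent) \<Rightarrow> bool" where
  "loc_lipschitz_field M X \<longleftrightarrow> (\<forall>p\<in>pts M. \<exists>c\<in>charts_at M p. \<exists>r>0. \<exists>L.
     ball (snd c p) r \<subseteq> snd c ` fst c \<and>
     L-lipschitz_on (ball (snd c p) r) (\<lambda>u. X (chart_inv c u) c))"

lemma loc_lipschitz_fieldE:
  assumes "loc_lipschitz_field M X" "p \<in> pts M"
  obtains c r L where "c \<in> charts_at M p" "r > 0" "ball (snd c p) r \<subseteq> snd c ` fst c"
    "L-lipschitz_on (ball (snd c p) r) (\<lambda>u. X (chart_inv c u) c)"
  using bspec[OF assms(1)[unfolded loc_lipschitz_field_def] assms(2)]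
  by (elim bexE exE conjE) (rule that)

lemma vector_field_loc_lipschitz:
  assumes M: "smooth_atlas M" and X: "vector_field M X" shows "loc_lipschitz_field M X"
  unfolding loc_lipschitz_field_def
proof
  fix p assume p: "p \<in> pts M"
  obtain c where c: "c \<in> charts_at M p" using pts_chart[OF p] by blast
  then have cM: "c \<in> M" "p \<in> fst c" by (auto simp: charts_at_iff)
  obtain U \<phi> where UP: "c = (U, \<phi>)" by (cases c)
  have "smooth_on (\<phi> ` U) (\<lambda>u. X (inv_into U \<phi> u) (U, \<phi>))"
    using X cM(1) unfolding vector_field_def UP by auto
  then have "smooth_on (snd c ` fst c) (\<lambda>u. X (chart_inv c u) c)" by (simp add: UP)
  then have C1: "Ck_on (Suc 0) (snd c ` fst c) (\<lambda>u. X (chart_inv c u) c)"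
    unfolding smooth_on_def by blast
  have o: "open (snd c ` fst c)" "snd c p \<in> snd c ` fst c" using M cM by (auto simp: smooth_atlas_def)
  obtain r L where "r > 0" "ball (snd c p) r \<subseteq> snd c ` fst c"
      "L-lipschitz_on (ball (snd c p) r) (\<lambda>u. X (chart_inv c u) c)"
    by (rule Ck_on_Suc_lipschitz[OF o C1]) (rule that)
  then show "\<exists>c\<in>charts_at M p. \<exists>r>0. \<exists>L. ball (snd c p) r \<subseteq> snd c ` fst c \<and>
     L-lipschitz_on (ball (snd c p) r) (\<lambda>u. X (chart_inv c u) c)"
    by (intro bexI[OF _ c] exI conjI)
qed

section \<open>Integral curves and flows on a manifold\<close>

lemma integral_curveD:
  assumes "integral_curve M X I \<gamma>"
  shows "open I" "is_interval I" "t \<in> I \<Longrightarrow> has_velocity M \<gamma> (X (\<gamma> t)) t"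
  using assms unfolding integral_curve_def by blast+

lemma integral_curveI:
  "open I \<Longrightarrow> is_interval I \<Longrightarrow> (\<And>t. t \<in> I \<Longrightarrow> has_velocity M \<gamma> (X (\<gamma> t)) t) \<Longrightarrow> integral_curve M X I \<gamma>"
  unfolding integral_curve_def by blast

lemma integral_curve_chart:
  assumes M: "smooth_atlas M" and \<gamma>: "integral_curve M X I \<gamma>" and t: "t \<in> I" and c: "c \<in> charts_at M (\<gamma> t)"
  shows "\<forall>\<^sub>F s in nhds t. ((\<lambda>s. snd c (\<gamma> s)) has_vector_derivative
    X (chart_inv c (snd c (\<gamma> s))) c) (at s)"
  using has_velocityD(3)[OF integral_curveD(3)[OF \<gamma> t] c] eventually_nhds_in_open[OF integral_curveD(1)[OF \<gamma>] t]
proof eventually_elim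
  case (elim s)
  have "c \<in> charts_at M (\<gamma> s)" using elim c by (simp add: charts_at_iff)
  from has_velocityD(4)[OF integral_curveD(3)[OF \<gamma> elim(2)] this] chart_inv_apply[OF M this]
  show ?case by simp
qed

lemma integral_curve_local_unique:
  assumes M: "smooth_atlas M" and X: "loc_lipschitz_field M X"
    and \<gamma>: "integral_curve M X I \<gamma>" "t \<in> I" and \<delta>: "integral_curve M X J \<delta>" "t \<in> J"
    and eq: "\<gamma> t = \<delta> t"
  shows "\<forall>\<^sub>F s in nhds t. \<gamma> s = \<delta> s"
proof -
  have v: "has_velocity M \<gamma> (X (\<gamma> t)) t" "has_velocity M \<delta> (X (\<delta> t)) t"
    using integral_curveD(3)[OF \<gamma>] integral_curveD(3)[OF \<delta>] .
  obtain c r L where c: "c \<in> charts_at M (\<gamma> t)" and r: "r > 0"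
    and "ball (snd c (\<gamma> t)) r \<subseteq> snd c ` fst c"
    and L: "L-lipschitz_on (ball (snd c (\<gamma> t)) r) (\<lambda>u. X (chart_inv c u) c)"
    by (rule loc_lipschitz_fieldE[OF X has_velocityD(1)[OF v(1)]]) (rule that)
  have c': "c \<in> charts_at M (\<delta> t)" using c eq by simp
  have inj: "inj_on (snd c) (fst c)" using M c by (simp add: charts_at_iff smooth_atlas_inj)
  have "\<forall>\<^sub>F s in nhds t. snd c (\<gamma> s) = snd c (\<delta> s)"
    by (rule ode_local_uniqueness[where x = "\<lambda>s. snd c (\<gamma> s)" and y = "\<lambda>s. snd c (\<delta> s)", OF r L])
      (use eq integral_curve_chart[OF M \<gamma> c] integral_curve_chart[OF M \<delta> c'] in simp_all)
  then show ?thesis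
    using has_velocityD(3)[OF v(1) c] has_velocityD(3)[OF v(2) c']
    by eventually_elim (simp add: inj_on_eq_iff[OF inj])
qed

text \<open>The truth value of \<gamma>(t) = \<delta>(t) is locally constant on the connected set I
  \<inter> J: near a time of agreement by local uniqueness, near a time of disagreement by the
  Hausdorff property.\<close>

lemma integral_curve_unique:
  assumes M: "is_manifold M" and X: "loc_lipschitz_field M X"
    and \<gamma>: "integral_curve M X I \<gamma>" and \<delta>: "integral_curve M X J \<delta>"
    and t0: "t0 \<in> I \<inter> J" "\<gamma> t0 = \<delta> t0" and t: "t \<in> I \<inter> J"
  shows "\<gamma> t = \<delta> t"
proof -
  have at: "smooth_atlas M" using M by (rule is_manifold_smooth_atlas)
  have "(\<gamma> t0 = \<delta> t0) = (\<gamma> t = \<delta> t)"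
  proof (rule connected_local_const[where f = "\<lambda>t. \<gamma> t = \<delta> t", OF _ t0(1) t])
    show "connected (I \<inter> J)"
      using integral_curveD(2)[OF \<gamma>] integral_curveD(2)[OF \<delta>]
      by (intro is_interval_connected is_interval_Int)
    show "\<forall>s\<in>I \<inter> J. \<forall>\<^sub>F u in at s within I \<inter> J. (\<gamma> s = \<delta> s) = (\<gamma> u = \<delta> u)"
    proof
      fix s assume s: "s \<in> I \<inter> J"
      have v: "has_velocity M \<gamma> (X (\<gamma> s)) s" "has_velocity M \<delta> (X (\<delta> s)) s"
        using integral_curveD(3)[OF \<gamma>] integral_curveD(3)[OF \<delta>] s by blast+
      have "\<forall>\<^sub>F u in nhds s. (\<gamma> s = \<delta> s) = (\<gamma> u = \<delta> u)"
      proof (cases "\<gamma> s = \<delta> s")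
        case True
        have "\<forall>\<^sub>F u in nhds s. \<gamma> u = \<delta> u"
          using s by (intro integral_curve_local_unique[OF at X \<gamma> _ \<delta> _ True]) auto
        then show ?thesis by eventually_elim (simp add: True)
      next
        case False
        have "Hausdorff_space (man_top M)" using M by (simp add: is_manifold_def)
        then obtain U V where UV: "openin (man_top M) U" "openin (man_top M) V" "\<gamma> s \<in> U" "\<delta> s \<in> V" "disjnt U V"
          using False has_velocityD(1)[OF v(1)] has_velocityD(1)[OF v(2)]
          unfolding Hausdorff_space_def topspace_man_top by blast
        have "\<forall>\<^sub>F u in nhds s. \<gamma> u \<in> U" "\<forall>\<^sub>F u in nhds s. \<delta> u \<in> V"
          using has_velocity_continuous[OF M v(1) UV(1,3)] has_velocity_continuous[OF M v(2) UV(2,4)] .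
        then show ?thesis by eventually_elim (use UV(5) False in \<open>auto simp: disjnt_iff\<close>)
      qed
      then show "\<forall>\<^sub>F u in at s within I \<inter> J. (\<gamma> s = \<delta> s) = (\<gamma> u = \<delta> u)"
        by (simp add: eventually_at_filter eventually_mono)
    qed
  qed
  then show ?thesis using t0(2) by simp
qed

text \<open>Evaluates the definite description in \<open>flow\<close>: uniqueness makes the endpoint
  independent of the interval and the curve.\<close>

lemma flow_eq:
  assumes M: "is_manifold M" and X: "loc_lipschitz_field M X"
    and \<gamma>: "integral_curve M X I \<gamma>" and t: "0 \<in> I" "t \<in> I"
  shows "flow M X t (\<gamma> 0) = \<gamma> t"
  unfolding flow_def
proof (rule the_equality)
  show "\<exists>J \<delta>. integral_curve M X J \<delta> \<and> 0 \<in> J \<and> t \<in> J \<and> \<delta> 0 = \<gamma> 0 \<and> \<delta> t = \<gamma> t"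
    using \<gamma> t by blast
  fix y assume "\<exists>J \<delta>. integral_curve M X J \<delta> \<and> 0 \<in> J \<and> t \<in> J \<and> \<delta> 0 = \<gamma> 0 \<and> \<delta> t = y"
  then obtain J \<delta> where \<delta>: "integral_curve M X J \<delta>" "0 \<in> J" "t \<in> J" "\<delta> 0 = \<gamma> 0" "\<delta> t = y" by blast
  show "y = \<gamma> t"
    using integral_curve_unique[OF M X \<delta>(1) \<gamma>, of 0 t] \<delta> t by simp
qed

text \<open>The Picard solution in a chart. Tangency of \<open>X\<close> is a separate hypothesis,
  since \<open>loc_lipschitz_field\<close> controls one coordinate of the field only.\<close>

lemma integral_curve_exists:
  assumes M: "smooth_atlas M" and X: "loc_lipschitz_field M X"
    and T: "\<And>p. p \<in> pts M \<Longrightarrow> X p \<in> tangent_space M p" and p: "p \<in> pts M"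
  obtains e \<gamma> where "e > 0" "integral_curve M X (ball 0 e) \<gamma>" "\<gamma> 0 = p"
proof -
  obtain c r L where c: "c \<in> charts_at M p" and r: "r > 0" "ball (snd c p) r \<subseteq> snd c ` fst c"
    and L: "L-lipschitz_on (ball (snd c p) r) (\<lambda>u. X (chart_inv c u) c)"
    by (rule loc_lipschitz_fieldE[OF X p]) (rule that)
  let ?i = "chart_inv c"
  obtain e x where e: "e > 0" and x: "x 0 = snd c p" "\<And>t. \<bar>t\<bar> < e \<Longrightarrow> x t \<in> ball (snd c p) r"
    "\<And>t. \<bar>t\<bar> < e \<Longrightarrow> (x has_vector_derivative X (?i (x t)) c) (at t)"
    by (rule picard_existence[OF r(1) L]) (rule that)
  define \<gamma> where "\<gamma> t = ?i (x t)" for t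
  have \<gamma>: "\<gamma> t \<in> fst c" "snd c (\<gamma> t) = x t" if "\<bar>t\<bar> < e" for t
    using x(2)[OF that] r(2) by (auto simp: \<gamma>_def inv_into_into f_inv_into_f)
  have "integral_curve M X (ball 0 e) \<gamma>"
  proof (rule integral_curveI)
    fix t :: real assume "t \<in> ball 0 e"
    then have t: "\<bar>t\<bar> < e" by (simp add: dist_real_def)
    have ct: "c \<in> charts_at M (\<gamma> t)" using c \<gamma>(1)[OF t] by (simp add: charts_at_iff)
    have "\<forall>\<^sub>F s in nhds t. s \<in> ball 0 e"
      using t by (intro eventually_nhds_in_open) (auto simp: dist_real_def)
    then have ev: "\<forall>\<^sub>F s in nhds t. \<bar>s\<bar> < e" by eventually_elim (simp add: dist_real_def)
    show "has_velocity M \<gamma> (X (\<gamma> t)) t"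
    proof (rule has_velocityI[where \<gamma> = \<gamma> and t = t, OF M ct T[OF charts_at_pts[OF ct]]])
      show "\<forall>\<^sub>F s in nhds t. \<gamma> s \<in> fst c" using ev by eventually_elim (rule \<gamma>)
      have "\<forall>\<^sub>F s in nhds t. x s = snd c (\<gamma> s)" using ev by eventually_elim (simp add: \<gamma>)
      with x(3)[OF t] have "((\<lambda>s. snd c (\<gamma> s)) has_vector_derivative X (?i (x t)) c) (at t)"
        by (rule has_vector_derivative_cong_nhds)
      then show "((\<lambda>s. snd c (\<gamma> s)) has_vector_derivative X (\<gamma> t) c) (at t)" by (simp add: \<gamma>_def)
    qed
  qed (auto simp: is_interval_ball_real)
  moreover have "\<gamma> 0 = p" using chart_inv_apply[OF M c] by (simp add: \<gamma>_def x(1))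
  ultimately show thesis using that e by blast
qed

section \<open>The zero field and its canonical lift\<close>

lemma vector_field_tzero: "smooth_atlas M \<Longrightarrow> vector_field M (\<lambda>_. tzero)"
  unfolding vector_field_def by (auto simp: tzero_in_tangent_space) (simp add: tzero_def smooth_on_const)

lemma flow_tzero:
  assumes M: "is_manifold M"
  shows "flow_dom M (\<lambda>_. tzero) t = pts M" and "x \<in> pts M \<Longrightarrow> flow M (\<lambda>_. tzero) t x = x"
proof -
  have at: "smooth_atlas M" using M by (rule is_manifold_smooth_atlas)
  have c: "integral_curve M (\<lambda>_. tzero) UNIV (\<lambda>_. x)" if "x \<in> pts M" for x
    by (rule integral_curveI) (use has_velocity_const[OF at that] in auto)
  show "flow_dom M (\<lambda>_. tzero) t = pts M"
    unfolding flow_dom_def using c by blast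
  show "flow M (\<lambda>_. tzero) t x = x" if "x \<in> pts M"
    using flow_eq[OF M vector_field_loc_lipschitz[OF at vector_field_tzero[OF at]] c[OF that], of t] by simp
qed

text \<open>The condition on the domains provides an integral curve through each point. The identity
  flow makes this curve constant, so its velocity, the value of the field, is zero.\<close>

lemma vector_field_zero_if_flow_id:
  assumes M: "is_manifold M" and Y: "vector_field M Y"
    and dom: "\<And>t. flow_dom M Y t = pts M" and id: "\<And>t x. x \<in> pts M \<Longrightarrow> flow M Y t x = x"
  shows "Y = (\<lambda>_. tzero)"
proof
  fix x
  have at: "smooth_atlas M" using M by (rule is_manifold_smooth_atlas)
  note lip = vector_field_loc_lipschitz[OF at Y]
  show "Y x = tzero"
  proof (cases "x \<in> pts M")
    case True
    then have "x \<in> flow_dom M Y 0" using dom by simp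
    then obtain I \<gamma> where \<gamma>: "integral_curve M Y I \<gamma>" "0 \<in> I" "\<gamma> 0 = x" unfolding flow_dom_def by blast
    have const: "\<gamma> s = x" if "s \<in> I" for s
      using flow_eq[OF M lip \<gamma>(1,2) that] id[OF True] \<gamma>(3) by simp
    have "\<forall>\<^sub>F s in nhds 0. \<gamma> s = x"
      using eventually_nhds_in_open[OF integral_curveD(1)[OF \<gamma>(1)] \<gamma>(2)] by eventually_elim (rule const)
    with integral_curveD(3)[OF \<gamma>(1,2)] have "has_velocity M (\<lambda>_. x) (Y (\<gamma> 0)) 0"
      by (rule has_velocity_cong)
    from has_velocity_unique[OF this has_velocity_const[OF at True]] show ?thesis by (simp add: \<gamma>(3))
  next
    \<comment> \<open>Off the manifold a vector field is \<open>tzero\<close> by convention. This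
      settles \<open>Y\<close> as a function, which the description in \<open>canonical_lift\<close>
      demands.\<close>
    case False
    then show ?thesis using Y unfolding vector_field_def by blast
  qed
qed

lemma open_sub_pts: "open_sub M (pts M) = M"
  by (auto simp: open_sub_def pts_def)

lemma smooth_map_ident:
  assumes M: "smooth_atlas M" and f: "\<And>x. x \<in> pts M \<Longrightarrow> f x = x"
  shows "smooth_map M M f"
  unfolding smooth_map_def
proof (intro conjI)
  show "continuous_map (man_top M) (man_top M) f"
    by (rule continuous_map_eq[OF continuous_map_id]) (simp add: topspace_man_top f)
  have "smooth_on (snd c ` {x \<in> fst c. f x \<in> fst d}) (snd d \<circ> f \<circ> chart_inv c)"
    if "c \<in> M" "d \<in> M" for c d
  proof -
    have fc: "f x = x" if "x \<in> fst c" for x using f \<open>c \<in> M\<close> that by (auto simp: pts_def)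
    have "{x \<in> fst c. f x \<in> fst d} = fst c \<inter> fst d" using fc by auto
    moreover have "smooth_on (snd c ` (fst c \<inter> fst d)) (snd d \<circ> f \<circ> chart_inv c)"
    proof (rule smooth_on_cong[OF open_chart_overlap[OF M that] _ compatible_smooth[OF smooth_atlas_compatible[OF M that]]])
      fix u assume "u \<in> snd c ` (fst c \<inter> fst d)"
      then have "chart_inv c u \<in> fst c" by (auto intro: inv_into_into)
      then show "transition c d u = (snd d \<circ> f \<circ> chart_inv c) u"
        by (simp add: transition_def fc)
    qed
    ultimately show ?thesis by simp
  qed
  then show "\<forall>(U, \<phi>)\<in>M. \<forall>(V, \<psi>)\<in>M. smooth_on (\<phi> ` {x \<in> U. f x \<in> V}) (\<psi> \<circ> f \<circ> inv_into U \<phi>)"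
    by fastforce
qed

lemma local_diffeo_id:
  assumes M: "smooth_atlas M" shows "local_diffeo M M id"
proof -
  have "diffeo M M id"
    unfolding diffeo_def
    using smooth_map_ident[OF M, of id] smooth_map_ident[OF M, of "inv_into (pts M) id"] by simp
  moreover have "openin (man_top M) (pts M)" using openin_topspace[of "man_top M"] by (simp add: topspace_man_top)
  ultimately show ?thesis
    unfolding local_diffeo_def by (intro conjI ballI exI[of _ "pts M"]) (simp_all add: open_sub_pts)
qed

lemma natural_bundleD:
  assumes "natural_bundle S F" "is_manifold M"
  shows "is_manifold (nb_obj F M)" "smooth_map (nb_obj F M) M (nb_proj F M)"
    and "z \<in> pts (nb_obj F M) \<Longrightarrow> nb_mor F M M id z = z"
    and "local_diffeo M M f \<Longrightarrow> (\<And>x. x \<in> pts M \<Longrightarrow> f x = g x) \<Longrightarrow> z \<in> pts (nb_obj F M) \<Longrightarrow>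
      nb_mor F M M f z = nb_mor F M M g z"
proof -
  note d = assms(1)[unfolded natural_bundle_def]
  have "fiber_bundle S (nb_obj F M) M (nb_proj F M)"
    using d[THEN conjunct1] assms(2) by simp
  then show "is_manifold (nb_obj F M)" "smooth_map (nb_obj F M) M (nb_proj F M)"
    unfolding fiber_bundle_def by simp_all
  show "nb_mor F M M id z = z" if "z \<in> pts (nb_obj F M)"
    using d[THEN conjunct2, THEN conjunct2, THEN conjunct2, THEN conjunct1] assms(2) that by simp
  show "nb_mor F M M f z = nb_mor F M M g z"
    if "local_diffeo M M f" "\<And>x. x \<in> pts M \<Longrightarrow> f x = g x" "z \<in> pts (nb_obj F M)"
    by (rule d[THEN conjunct2, THEN conjunct2, THEN conjunct1, rule_format])
      (use assms(2) that in auto)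
qed

text \<open>All open submanifolds in the definition are \<open>M\<close> itself, so the inclusions
  act trivially. The flow map is known to be the identity only on the points of \<open>M\<close>;
  that \<open>F\<close> ignores its values elsewhere is the congruence clause of
  \<open>natural_bundle\<close>.\<close>

lemma canonical_lift_tzero:
  assumes F: "natural_bundle S F" and M: "is_manifold M"
  shows "canonical_lift F M (\<lambda>_. tzero) = (\<lambda>_. tzero)"
proof -
  let ?E = "nb_obj F M"
  note nb = natural_bundleD[OF F M]
  have id: "nb_mor F M M id z = z" if "z \<in> pts ?E" for z by (rule nb(3)[OF that])
  have mor: "nb_mor F M M (flow M (\<lambda>_. tzero) t) z = z" if "z \<in> pts ?E" for t z
    using nb(4)[OF local_diffeo_id[OF is_manifold_smooth_atlas[OF M]] _ that, of "flow M (\<lambda>_. tzero) t"]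
      flow_tzero(2)[OF M] id[OF that] by simp
  have img: "nb_mor F M M id ` pts ?E = pts ?E" using id by auto
  note E = nb(1)
  show ?thesis
    unfolding canonical_lift_def Let_def flow_tzero(1)[OF M] open_sub_pts img
  proof (rule the_equality)
    show "vector_field ?E (\<lambda>_. tzero) \<and> (\<forall>t. flow_dom ?E (\<lambda>_. tzero) t = pts ?E) \<and>
      (\<forall>t. \<forall>z\<in>pts ?E. flow ?E (\<lambda>_. tzero) t (nb_mor F M M id z) =
         nb_mor F M M id (nb_mor F M M (flow M (\<lambda>_. tzero) t) z))"
      using vector_field_tzero[OF is_manifold_smooth_atlas[OF E]] flow_tzero[OF E] by (simp add: id mor)
    fix Y assume "vector_field ?E Y \<and> (\<forall>t. flow_dom ?E Y t = pts ?E) \<and>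
      (\<forall>t. \<forall>z\<in>pts ?E. flow ?E Y t (nb_mor F M M id z) =
         nb_mor F M M id (nb_mor F M M (flow M (\<lambda>_. tzero) t) z))"
    then show "Y = (\<lambda>_. tzero)"
      by (intro vector_field_zero_if_flow_id[OF E]) (auto simp: id mor)
  qed
qed

section \<open>Lie groups\<close>

lemma has_velocity_pts:
  assumes "has_velocity M \<gamma> v t" shows "\<forall>\<^sub>F s in nhds t. \<gamma> s \<in> pts M"
proof -
  obtain c where c: "c \<in> charts_at M (\<gamma> t)" using pts_chart[OF has_velocityD(1)[OF assms]] by blast
  show ?thesis
    using has_velocityD(3)[OF assms c]
    by eventually_elim (rule charts_at_pts[of c], use c in \<open>simp add: charts_at_iff\<close>)
qed

lemma tangent_curve:
  assumes "smooth_atlas M" "p \<in> pts M" "v \<in> tangent_space M p"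
  obtains \<gamma> where "\<gamma> 0 = p" "has_velocity M \<gamma> v 0"
  by (rule tangent_smooth_curve[OF assms]) (rule that)

lemma tangent_map_in_tangent_space:
  assumes M: "smooth_atlas M" and N: "smooth_atlas N" and f: "mdiff M N f p" and v: "v \<in> tangent_space M p"
  shows "tangent_map M N f p v \<in> tangent_space N (f p)"
proof -
  obtain \<gamma> where \<gamma>: "\<gamma> 0 = p" "has_velocity M \<gamma> v 0"
    by (rule tangent_curve[OF M mdiffD(1)[OF f] v]) (rule that)
  have "has_velocity N (\<lambda>s. f (\<gamma> s)) (tangent_map M N f (\<gamma> 0) v) 0"
    by (rule mdiff_velocity[OF M N _ \<gamma>(2)]) (simp add: \<gamma>(1) f)
  from has_velocityD(2)[OF this] show ?thesis by (simp add: \<gamma>(1))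
qed

text \<open>Both sides are velocities of the same curve. The map \<open>h\<close> has to agree with
  the composite on the points of \<open>M\<close> only, because group identities hold only on the
  carrier.\<close>

lemma tangent_map_comp:
  assumes M: "smooth_atlas M" and N: "smooth_atlas N" and K: "smooth_atlas K"
    and f: "mdiff M N f p" and g: "mdiff N K g (f p)" and h: "mdiff M K h p"
    and eq: "\<And>x. x \<in> pts M \<Longrightarrow> h x = g (f x)"
    and v: "v \<in> tangent_space M p"
  shows "tangent_map N K g (f p) (tangent_map M N f p v) = tangent_map M K h p v"
proof -
  obtain \<gamma> where \<gamma>: "\<gamma> 0 = p" "has_velocity M \<gamma> v 0"
    by (rule tangent_curve[OF M mdiffD(1)[OF f] v]) (rule that)
  have fv: "has_velocity N (\<lambda>s. f (\<gamma> s)) (tangent_map M N f (\<gamma> 0) v) 0"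
    by (rule mdiff_velocity[OF M N _ \<gamma>(2)]) (simp add: \<gamma>(1) f)
  have gv: "has_velocity K (\<lambda>s. g (f (\<gamma> s))) (tangent_map N K g (f (\<gamma> 0)) (tangent_map M N f (\<gamma> 0) v)) 0"
    by (rule mdiff_velocity[OF N K _ fv]) (simp add: \<gamma>(1) g)
  have hv: "has_velocity K (\<lambda>s. h (\<gamma> s)) (tangent_map M K h (\<gamma> 0) v) 0"
    by (rule mdiff_velocity[OF M K _ \<gamma>(2)]) (simp add: \<gamma>(1) h)
  have "\<forall>\<^sub>F s in nhds 0. h (\<gamma> s) = g (f (\<gamma> s))"
    using has_velocity_pts[OF \<gamma>(2)] by eventually_elim (rule eq)
  from has_velocity_unique[OF gv has_velocity_cong[OF hv this]] show ?thesis by (simp add: \<gamma>(1))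
qed

lemma tangent_map_ident:
  assumes M: "smooth_atlas M" and f: "mdiff M M f p" and eq: "\<And>x. x \<in> pts M \<Longrightarrow> f x = x"
    and v: "v \<in> tangent_space M p"
  shows "tangent_map M M f p v = v"
proof -
  obtain \<gamma> where \<gamma>: "\<gamma> 0 = p" "has_velocity M \<gamma> v 0"
    by (rule tangent_curve[OF M mdiffD(1)[OF f] v]) (rule that)
  have fv: "has_velocity M (\<lambda>s. f (\<gamma> s)) (tangent_map M M f (\<gamma> 0) v) 0"
    by (rule mdiff_velocity[OF M M _ \<gamma>(2)]) (simp add: \<gamma>(1) f)
  have "\<forall>\<^sub>F s in nhds 0. f (\<gamma> s) = \<gamma> s"
    using has_velocity_pts[OF \<gamma>(2)] by eventually_elim (rule eq)
  from has_velocity_unique[OF has_velocity_cong[OF fv this] \<gamma>(2)] show ?thesis by (simp add: \<gamma>(1))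
qed

locale lie_grp = group G for G :: "('g, 'l::model_space) lie_group" (structure) +
  assumes lie: "is_lie_group G"
begin

lemma group_man: "is_manifold (mfd G)" and pts_mfd: "pts (mfd G) = carrier G"
  using lie by (simp_all add: is_lie_group_def)

lemma group_atlas: "smooth_atlas (mfd G)"
  using group_man by (rule is_manifold_smooth_atlas)

lemma mult_smooth: "smooth_map (prod_man (mfd G) (mfd G)) (mfd G) (\<lambda>(g, k). g \<otimes> k)"
  using lie by (simp add: is_lie_group_def)

lemma mult_mdiff:
  assumes "g \<in> carrier G" "k \<in> carrier G"
  shows "mdiff (prod_man (mfd G) (mfd G)) (mfd G) (\<lambda>(g, k). g \<otimes> k) (g, k)"
  by (rule smooth_map_mdiff[OF mult_smooth smooth_atlas_prod[OF group_atlas group_atlas] subset_refl group_atlas subset_refl])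
    (use assms in \<open>simp add: pts_prod_man[OF group_atlas group_atlas] pts_mfd\<close>)

lemma lmult_mdiff: "g \<in> carrier G \<Longrightarrow> k \<in> carrier G \<Longrightarrow> mdiff (mfd G) (mfd G) (\<lambda>k. g \<otimes> k) k"
  using mdiff_slice(2)[OF group_atlas group_atlas group_atlas mult_mdiff] by simp

lemma rmult_mdiff: "g \<in> carrier G \<Longrightarrow> k \<in> carrier G \<Longrightarrow> mdiff (mfd G) (mfd G) (\<lambda>g. g \<otimes> k) g"
  using mdiff_slice(1)[OF group_atlas group_atlas group_atlas mult_mdiff] by simp

lemma conj_mdiff:
  assumes "g \<in> carrier G" "k \<in> carrier G"
  shows "mdiff (mfd G) (mfd G) (conj_act G g) k"
proof -
  have "mdiff (mfd G) (mfd G) (\<lambda>k. (g \<otimes> k) \<otimes> inv g) k"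
    by (rule mdiff_compose[where f = "\<lambda>k. g \<otimes> k" and g = "\<lambda>k. k \<otimes> inv g", OF group_atlas group_atlas group_atlas lmult_mdiff[OF assms] rmult_mdiff])
      (use assms in simp_all)
  then show ?thesis by (simp add: conj_act_def[abs_def])
qed

lemma lie_algebraD: "\<alpha> \<in> lie_algebra G \<Longrightarrow> \<alpha> \<in> tangent_space (mfd G) \<one>"
  by (simp add: lie_algebra_def)

lemma one_pts: "\<one> \<in> pts (mfd G)"
  by (simp add: pts_mfd)

lemma left_field_in:
  assumes "\<alpha> \<in> lie_algebra G" "g \<in> carrier G"
  shows "left_field G \<alpha> g \<in> tangent_space (mfd G) g"
  using tangent_map_in_tangent_space[OF group_atlas group_atlas lmult_mdiff[OF assms(2) one_closed] lie_algebraD[OF assms(1)]] assms(2)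
  by (simp add: left_field_def)

lemma left_field_one: "\<alpha> \<in> lie_algebra G \<Longrightarrow> left_field G \<alpha> \<one> = \<alpha>"
  unfolding left_field_def
  by (rule tangent_map_ident[OF group_atlas lmult_mdiff[OF one_closed one_closed]])
    (simp_all add: pts_mfd lie_algebraD)

lemma left_field_translate:
  assumes "\<alpha> \<in> lie_algebra G" "g \<in> carrier G" "h \<in> carrier G"
  shows "tangent_map (mfd G) (mfd G) (\<lambda>k. g \<otimes> k) h (left_field G \<alpha> h) = left_field G \<alpha> (g \<otimes> h)"
  unfolding left_field_def
  using tangent_map_comp[where f = "\<lambda>k. h \<otimes> k" and g = "\<lambda>k. g \<otimes> k" and h = "\<lambda>k. (g \<otimes> h) \<otimes> k",
      OF group_atlas group_atlas group_atlas lmult_mdiff[OF assms(3) one_closed] lmult_mdiff[OF assms(2) m_closed[OF assms(3) one_closed]]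
        lmult_mdiff[OF m_closed[OF assms(2,3)] one_closed] _ lie_algebraD[OF assms(1)]] assms
  by (simp add: pts_mfd m_assoc)

lemma left_field_scale:
  assumes "g \<in> carrier G" shows "left_field G (tscale r \<alpha>) g = tscale r (left_field G \<alpha> g)"
  unfolding left_field_def by (rule tangent_map_linear(2)[OF lmult_mdiff[OF assms one_closed]])

lemma left_field_minus:
  assumes "g \<in> carrier G"
  shows "left_field G (tminus \<alpha> \<beta>) g = tminus (left_field G \<alpha> g) (left_field G \<beta> g)"
  unfolding left_field_def by (rule tangent_map_linear(1)[OF lmult_mdiff[OF assms one_closed]])

lemma lie_algebra_scale: "\<alpha> \<in> lie_algebra G \<Longrightarrow> tscale r \<alpha> \<in> lie_algebra G"
  unfolding lie_algebra_def by (rule tscale_in_tangent_space[OF group_atlas])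

lemma lie_algebra_minus: "\<alpha> \<in> lie_algebra G \<Longrightarrow> \<beta> \<in> lie_algebra G \<Longrightarrow> tminus \<alpha> \<beta> \<in> lie_algebra G"
  unfolding lie_algebra_def by (rule tminus_in_tangent_space[OF group_atlas])

text \<open>In charts the left-invariant field is the partial derivative of the multiplication in
  its second argument, at the unit and in the direction \<alpha>. Smoothness of the multiplication
  makes this continuously differentiable in the first argument, hence locally Lipschitz.\<close>

lemma left_field_loc_lipschitz:
  assumes \<alpha>: "\<alpha> \<in> lie_algebra G" shows "loc_lipschitz_field (mfd G) (left_field G \<alpha>)"
  unfolding loc_lipschitz_field_def
proof
  fix p assume p: "p \<in> pts (mfd G)"
  \<comment> \<open>The chart that \<open>tangent_map\<close> selects at the unit, so that unfolding
    \<open>left_field\<close> gives a derivative in this chart.\<close>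
  define e where "e = (SOME c. c \<in> charts_at (mfd G) \<one>)"
  have e: "e \<in> charts_at (mfd G) \<one>"
    unfolding e_def using pts_chart[OF one_pts] by (rule someI_ex)
  obtain c where c: "c \<in> charts_at (mfd G) p" using pts_chart[OF p] by blast
  have cM: "c \<in> mfd G" "p \<in> fst c" "e \<in> mfd G" "\<one> \<in> fst e" using c e by (auto simp: charts_at_iff)
  let ?PG = "prod_man (mfd G) (mfd G)"
  let ?mul = "\<lambda>(g, k). g \<otimes> k"
  let ?P = "prod_chart c e"
  let ?\<Omega> = "snd ?P ` {x \<in> fst ?P. ?mul x \<in> fst c}"
  define H where "H u = snd c (?mul (inv_into (fst ?P) (snd ?P) u))" for u
  have P: "?P \<in> ?PG" by (rule prod_chart_in[OF group_atlas group_atlas cM(1,3)])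
  have smH: "smooth_on ?\<Omega> H"
    using smooth_map_smooth_on[OF mult_smooth P cM(1)] by (simp add: H_def[abs_def])
  have "openin (man_top ?PG) {x \<in> topspace (man_top ?PG). ?mul x \<in> fst c}"
    using mult_smooth openin_chart_domain[OF cM(1)] unfolding smooth_map_def
    by (intro openin_continuous_map_preimage) auto
  then have "open (snd ?P ` (fst ?P \<inter> {x \<in> pts ?PG. ?mul x \<in> fst c}))"
    unfolding topspace_man_top by (rule open_chart_image[OF smooth_atlas_prod[OF group_atlas group_atlas] P])
  moreover have "fst ?P \<inter> {x \<in> pts ?PG. ?mul x \<in> fst c} = {x \<in> fst ?P. ?mul x \<in> fst c}"
    using P unfolding pts_def by blast
  ultimately have o\<Omega>: "open ?\<Omega>" by simp
  have pc: "p \<in> carrier G" using p by (simp add: pts_mfd)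
  have "(p, \<one>) \<in> {x \<in> fst ?P. ?mul x \<in> fst c}" using cM pc by simp
  then have in\<Omega>: "(snd c p, snd e \<one>) \<in> ?\<Omega>" by (metis (no_types, lifting) imageI snd_prod_chart)
  \<comment> \<open>Two orders for the multiplication leave one for its partial derivative, as the
    Lipschitz estimate requires.\<close>
  have "Ck_on (Suc (Suc 0)) ?\<Omega> H" using smH unfolding smooth_on_def by blast
  then have C1: "Ck_on (Suc 0) ?\<Omega> (\<lambda>z. frechet_derivative H (at z) (0, \<alpha> e))"
    unfolding Ck_on.simps(2)[of "Suc 0"] by blast
  obtain r L where r: "r > 0" and sub: "ball (snd c p, snd e \<one>) r \<subseteq> ?\<Omega>"
    and L: "L-lipschitz_on (ball (snd c p, snd e \<one>) r) (\<lambda>z. frechet_derivative H (at z) (0, \<alpha> e))"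
    by (rule Ck_on_Suc_lipschitz[OF o\<Omega> in\<Omega> C1]) (rule that)
  have ball: "(u, snd e \<one>) \<in> ball (snd c p, snd e \<one>) r" if "u \<in> ball (snd c p) r" for u
    using that by (simp add: dist_Pair_Pair)
  have injc: "inj_on (snd c) (fst c)" and inje: "inj_on (snd e) (fst e)"
    using smooth_atlas_inj[OF group_atlas] cM by auto
  have u\<Omega>: "u \<in> snd c ` fst c" if "u \<in> ball (snd c p) r" for u
  proof -
    have "(u, snd e \<one>) \<in> ?\<Omega>" using ball[OF that] sub by blast
    then show ?thesis by (auto simp: prod_chart_def)
  qed
  have eq: "left_field G \<alpha> (chart_inv c u) c = frechet_derivative H (at (u, snd e \<one>)) (0, \<alpha> e)"
    if u: "u \<in> ball (snd c p) r" for u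
  proof -
    define k where "k = chart_inv c u"
    have k: "k \<in> fst c" using inv_into_into[OF u\<Omega>[OF u]] by (simp add: k_def)
    then have kc: "c \<in> charts_at (mfd G) k" using cM by (simp add: charts_at_iff)
    have kG: "k \<in> carrier G" using charts_at_pts[OF kc] by (simp add: pts_mfd)
    have "H differentiable at (u, snd e \<one>)"
      by (rule smooth_on_differentiable[OF smH]) (use ball[OF u] sub in blast)
    then have dH: "(H has_derivative frechet_derivative H (at (u, snd e \<one>))) (at (u, snd e \<one>))"
      by (simp add: frechet_derivative_works)
    have "((\<lambda>w. (u, w)) has_derivative (\<lambda>h. (0, h))) (at (snd e \<one>))"
      by (intro derivative_eq_intros) auto
    from has_derivative_compose[OF this dH]
    have "((\<lambda>w. H (u, w)) has_derivative (\<lambda>h. frechet_derivative H (at (u, snd e \<one>)) (0, h))) (at (snd e \<one>))" .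
    moreover have "\<forall>\<^sub>F w in nhds (snd e \<one>). H (u, w) = (snd c \<circ> (\<lambda>x. k \<otimes> x) \<circ> chart_inv e) w"
      using eventually_chart_image[OF group_atlas e]
    proof eventually_elim
      case (elim w)
      show ?case
        using inv_prod_chart[OF group_atlas group_atlas cM(1,3) u\<Omega>[OF u] elim] by (simp add: H_def k_def)
    qed
    ultimately have "((snd c \<circ> (\<lambda>x. k \<otimes> x) \<circ> chart_inv e) has_derivative
        (\<lambda>h. frechet_derivative H (at (u, snd e \<one>)) (0, h))) (at (snd e \<one>))"
      by (rule has_derivative_cong_nhds)
    from frechet_derivative_eqI[OF this]
    show ?thesis
      using kc kG unfolding k_def[symmetric] left_field_def tangent_map_def e_def[symmetric] Let_def by simp
  qed
  have "L-lipschitz_on (ball (snd c p) r) (\<lambda>u. left_field G \<alpha> (chart_inv c u) c)"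
  proof (rule lipschitz_onI)
    fix u w assume uw: "u \<in> ball (snd c p) r" "w \<in> ball (snd c p) r"
    show "dist (left_field G \<alpha> (chart_inv c u) c) (left_field G \<alpha> (chart_inv c w) c)
        \<le> L * dist u w"
      using lipschitz_onD[OF L ball[OF uw(1)] ball[OF uw(2)]]
      by (simp add: eq[OF uw(1)] eq[OF uw(2)] dist_Pair_Pair)
  qed (rule lipschitz_on_nonneg[OF L])
  moreover have "ball (snd c p) r \<subseteq> snd c ` fst c" using u\<Omega> by blast
  ultimately show "\<exists>c\<in>charts_at (mfd G) p. \<exists>r>0. \<exists>L. ball (snd c p) r \<subseteq> snd c ` fst c \<and>
     L-lipschitz_on (ball (snd c p) r) (\<lambda>u. left_field G \<alpha> (chart_inv c u) c)"
    using r by (intro bexI[OF _ c] exI conjI)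
qed

section \<open>One-parameter subgroups and the exponential map\<close>

lemma integral_curve_in: "integral_curve (mfd G) X I \<gamma> \<Longrightarrow> t \<in> I \<Longrightarrow> \<gamma> t \<in> carrier G"
  using has_velocityD(1)[OF integral_curveD(3)] pts_mfd by blast

lemma integral_curve_translate:
  assumes \<alpha>: "\<alpha> \<in> lie_algebra G" and \<gamma>: "integral_curve (mfd G) (left_field G \<alpha>) I \<gamma>" and g: "g \<in> carrier G"
  shows "integral_curve (mfd G) (left_field G \<alpha>) I (\<lambda>t. g \<otimes> \<gamma> t)"
proof (rule integral_curveI)
  fix t assume t: "t \<in> I"
  have \<gamma>t: "\<gamma> t \<in> carrier G" by (rule integral_curve_in[OF \<gamma> t])
  show "has_velocity (mfd G) (\<lambda>t. g \<otimes> \<gamma> t) (left_field G \<alpha> (g \<otimes> \<gamma> t)) t"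
    using mdiff_velocity[where f = "\<lambda>k. g \<otimes> k", OF group_atlas group_atlas lmult_mdiff[OF g \<gamma>t] integral_curveD(3)[OF \<gamma> t]]
    by (simp add: left_field_translate[OF \<alpha> g \<gamma>t])
qed (use integral_curveD[OF \<gamma>] in auto)

lemma integral_curve_shift:
  assumes \<gamma>: "integral_curve (mfd G) X (ball 0 T) \<gamma>"
  shows "integral_curve (mfd G) X (ball (-s) T) (\<lambda>t. \<gamma> (t + s))"
proof (rule integral_curveI)
  fix t assume "t \<in> ball (-s) T"
  then have t: "t + s \<in> ball 0 T" by (simp add: dist_real_def)
  have "((\<lambda>t. t + s) has_real_derivative 1) (at t)" by (auto intro!: derivative_eq_intros)
  from has_velocity_reparam[where f = "\<lambda>t. t + s", OF integral_curveD(3)[OF \<gamma> t] this group_atlas]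
  show "has_velocity (mfd G) (\<lambda>t. \<gamma> (t + s)) (X (\<gamma> (t + s))) t" by (simp add: tscale_def)
qed (auto simp: is_interval_ball_real)

text \<open>As functions of t, \<gamma>(t + s) and the left translate of \<gamma>(t) by \<gamma>(s)
  are integral curves of the left-invariant field that agree at t = 0. The time bounds keep all
  values in the domain of \<gamma>.\<close>

lemma one_parameter_local_hom:
  assumes \<alpha>: "\<alpha> \<in> lie_algebra G" and \<gamma>: "integral_curve (mfd G) (left_field G \<alpha>) (ball 0 T) \<gamma>" "\<gamma> 0 = \<one>"
    and st: "\<bar>s\<bar> < T" "\<bar>t\<bar> < T" "\<bar>s + t\<bar> < T"
  shows "\<gamma> (s + t) = \<gamma> s \<otimes> \<gamma> t"
proof -
  have s: "\<gamma> s \<in> carrier G" by (rule integral_curve_in[OF \<gamma>(1)]) (use st in \<open>simp add: dist_real_def\<close>)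
  have 0: "0 \<in> ball (- s) T \<inter> ball 0 T" and t: "t \<in> ball (- s) T \<inter> ball 0 T"
    using st by (auto simp: dist_real_def)
  have eq: "\<gamma> (0 + s) = \<gamma> s \<otimes> \<gamma> 0" using s \<gamma>(2) by simp
  have "\<gamma> (t + s) = \<gamma> s \<otimes> \<gamma> t"
    using integral_curve_unique[OF group_man left_field_loc_lipschitz[OF \<alpha>]
      integral_curve_shift[OF \<gamma>(1), of s] integral_curve_translate[OF \<alpha> \<gamma>(1) s] 0 eq t] .
  then show ?thesis by (simp add: add.commute)
qed

text \<open>Values of \<open>\<gamma>\<close> commute, so near \<open>t\<close> the half-speed square is the left translate by
  \<open>\<gamma> (t / 2)\<^sup>2\<close> of \<open>s \<mapsto> \<gamma> (s - t)\<close>.\<close>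

lemma one_parameter_double:
  assumes \<alpha>: "\<alpha> \<in> lie_algebra G" and T: "T > 0"
    and \<gamma>: "integral_curve (mfd G) (left_field G \<alpha>) (ball 0 T) \<gamma>" "\<gamma> 0 = \<one>"
  shows "integral_curve (mfd G) (left_field G \<alpha>) (ball 0 (2 * T)) (\<lambda>t. \<gamma> (t / 2) \<otimes> \<gamma> (t / 2))"
proof (rule integral_curveI)
  fix t :: real assume "t \<in> ball 0 (2 * T)"
  then have t: "\<bar>t\<bar> < 2 * T" by (simp add: dist_real_def)
  have in_G: "\<gamma> s \<in> carrier G" if "\<bar>s\<bar> < T" for s
    by (rule integral_curve_in[OF \<gamma>(1)]) (use that in \<open>simp add: dist_real_def\<close>)
  define a where "a = \<gamma> (t / 2)"
  have a: "a \<in> carrier G" unfolding a_def by (rule in_G) (use t in simp)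
  have ev: "\<forall>\<^sub>F s in nhds t. (a \<otimes> a) \<otimes> \<gamma> (s - t) = \<gamma> (s / 2) \<otimes> \<gamma> (s / 2)"
  proof -
    have "\<forall>\<^sub>F s in nhds t. s \<in> ball t T" using T by (intro eventually_nhds_in_open) auto
    moreover have "\<forall>\<^sub>F s in nhds t. s \<in> ball 0 (2 * T)"
      using t by (intro eventually_nhds_in_open) (auto simp: dist_real_def)
    ultimately show ?thesis
    proof eventually_elim
      case (elim s)
      then have s: "\<bar>s - t\<bar> < T" "\<bar>s\<bar> < 2 * T" by (auto simp: dist_real_def)
      define b where "b = \<gamma> ((s - t) / 2)"
      have b: "b \<in> carrier G" unfolding b_def by (rule in_G) (use s in simp)
      have hom: "\<gamma> (u + v) = \<gamma> u \<otimes> \<gamma> v" if "\<bar>u\<bar> < T" "\<bar>v\<bar> < T" "\<bar>u + v\<bar> < T" for u v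
        by (rule one_parameter_local_hom[OF \<alpha> \<gamma> that])
      have h: "t / 2 + (s - t) / 2 = s / 2" "(s - t) / 2 + t / 2 = s / 2" "(s - t) / 2 + (s - t) / 2 = s - t"
        by (simp_all add: field_simps)
      have 1: "\<gamma> (s / 2) = a \<otimes> b"
        using hom[of "t / 2" "(s - t) / 2"] t s unfolding h a_def b_def by simp
      have 2: "\<gamma> (s / 2) = b \<otimes> a"
        using hom[of "(s - t) / 2" "t / 2"] t s unfolding h a_def b_def by simp
      have 3: "\<gamma> (s - t) = b \<otimes> b"
        using hom[of "(s - t) / 2" "(s - t) / 2"] s unfolding h b_def by simp
      have "\<gamma> (s / 2) \<otimes> \<gamma> (s / 2) = (a \<otimes> b) \<otimes> (b \<otimes> a)" using 1 2 by simp
      also have "\<dots> = a \<otimes> (b \<otimes> (b \<otimes> a))" using a b by (simp add: m_assoc)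
      also have "b \<otimes> (b \<otimes> a) = b \<otimes> (a \<otimes> b)" using 1 2 by simp
      also have "\<dots> = (b \<otimes> a) \<otimes> b" using a b by (simp add: m_assoc)
      also have "\<dots> = (a \<otimes> b) \<otimes> b" using 1 2 by simp
      finally show ?case using a b 3 by (simp add: m_assoc)
    qed
  qed
  have aa: "a \<otimes> a \<in> carrier G" using a by simp
  have "integral_curve (mfd G) (left_field G \<alpha>) (ball t T) (\<lambda>s. \<gamma> (s - t))"
    using integral_curve_shift[OF \<gamma>(1), of "-t"] by simp
  from integral_curveD(3)[OF integral_curve_translate[OF \<alpha> this aa], of t]
  have "has_velocity (mfd G) (\<lambda>s. (a \<otimes> a) \<otimes> \<gamma> (s - t)) (left_field G \<alpha> (a \<otimes> a)) t"
    using T aa by (simp add: \<gamma>(2))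
  from has_velocity_cong[OF this ev]
  show "has_velocity (mfd G) (\<lambda>t. \<gamma> (t / 2) \<otimes> \<gamma> (t / 2)) (left_field G \<alpha> (\<gamma> (t / 2) \<otimes> \<gamma> (t / 2))) t"
    by (simp add: a_def)
qed (auto simp: is_interval_ball_real)

text \<open>Doubling extends a local solution to the radius \<open>2 ^ n * e\<close> for every
  \<open>n\<close>. By uniqueness \<open>flow\<close> evaluates all these solutions, which glues
  them.\<close>

lemma one_parameter_exists:
  assumes \<alpha>: "\<alpha> \<in> lie_algebra G"
  obtains \<gamma> where "integral_curve (mfd G) (left_field G \<alpha>) UNIV \<gamma>" "\<gamma> 0 = \<one>"
proof -
  let ?X = "left_field G \<alpha>"
  note lip = left_field_loc_lipschitz[OF \<alpha>]
  obtain e \<gamma>0 where e: "e > 0" "integral_curve (mfd G) ?X (ball 0 e) \<gamma>0" "\<gamma>0 0 = \<one>"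
    by (rule integral_curve_exists[OF group_atlas lip _ one_pts]) (use left_field_in[OF \<alpha>] pts_mfd that in auto)
  have ex: "\<exists>\<gamma>. integral_curve (mfd G) ?X (ball 0 (2 ^ n * e)) \<gamma> \<and> \<gamma> 0 = \<one>" for n :: nat
  proof (induction n)
    case 0
    then show ?case using e by auto
  next
    case (Suc n)
    then obtain \<gamma> where \<gamma>: "integral_curve (mfd G) ?X (ball 0 (2 ^ n * e)) \<gamma>" "\<gamma> 0 = \<one>" by blast
    have "integral_curve (mfd G) ?X (ball 0 (2 * (2 ^ n * e))) (\<lambda>t. \<gamma> (t / 2) \<otimes> \<gamma> (t / 2))"
      by (rule one_parameter_double[OF \<alpha> _ \<gamma>]) (use e in simp)
    then show ?case using \<gamma>(2) by (intro exI[of _ "\<lambda>t. \<gamma> (t / 2) \<otimes> \<gamma> (t / 2)"]) (simp add: mult.assoc)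
  qed
  have loc: "\<exists>T \<gamma>. \<bar>t\<bar> < T \<and> integral_curve (mfd G) ?X (ball 0 T) \<gamma> \<and> \<gamma> 0 = \<one>" for t
  proof -
    obtain n where "\<bar>t\<bar> / e < 2 ^ n" using real_arch_pow[of 2 "\<bar>t\<bar> / e"] by auto
    then have "\<bar>t\<bar> < 2 ^ n * e" using e(1) by (simp add: field_simps)
    then show ?thesis using ex[of n] by blast
  qed
  define E where "E t = flow (mfd G) ?X t \<one>" for t
  have E: "E t = \<gamma> t" if "integral_curve (mfd G) ?X (ball 0 T) \<gamma>" "\<gamma> 0 = \<one>" "\<bar>t\<bar> < T" for T \<gamma> t
    using flow_eq[OF group_man lip that(1), of t] that(2,3) unfolding E_def by (simp add: dist_real_def)
  have "integral_curve (mfd G) ?X UNIV E"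
  proof (rule integral_curveI)
    fix t
    obtain T \<gamma> where T: "\<bar>t\<bar> < T" "integral_curve (mfd G) ?X (ball 0 T) \<gamma>" "\<gamma> 0 = \<one>" using loc[of t] by blast
    have tT: "t \<in> ball 0 T" using T(1) by (simp add: dist_real_def)
    have "\<forall>\<^sub>F s in nhds t. s \<in> ball 0 T" by (rule eventually_nhds_in_open[OF open_ball tT])
    then have "\<forall>\<^sub>F s in nhds t. \<gamma> s = E s"
      by eventually_elim (use E[OF T(2,3)] in \<open>simp add: dist_real_def\<close>)
    from has_velocity_cong[OF integral_curveD(3)[OF T(2) tT] this]
    show "has_velocity (mfd G) E (?X (E t)) t" using E[OF T(2,3,1)] by simp
  qed auto
  moreover have "E 0 = \<one>" using loc[of 0] E[of _ _ 0] by force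
  ultimately show thesis by (rule that)
qed

text \<open>\<open>lie_exp\<close> takes the flow at time 1 of a field that depends on
  \<open>t\<close>. Rescaling time turns this into the point at time \<open>t\<close> of the
  one-parameter subgroup of \<alpha>.\<close>

lemma lie_exp_curve:
  assumes \<alpha>: "\<alpha> \<in> lie_algebra G"
  shows "integral_curve (mfd G) (left_field G \<alpha>) UNIV (\<lambda>t. lie_exp G (tscale t \<alpha>))"
    and "lie_exp G (tscale 0 \<alpha>) = \<one>"
proof -
  obtain \<gamma> where \<gamma>: "integral_curve (mfd G) (left_field G \<alpha>) UNIV \<gamma>" "\<gamma> 0 = \<one>"
    by (rule one_parameter_exists[OF \<alpha>]) (rule that)
  have "lie_exp G (tscale t \<alpha>) = \<gamma> t" for t
  proof -
    have "integral_curve (mfd G) (left_field G (tscale t \<alpha>)) UNIV (\<lambda>s. \<gamma> (t * s))"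
    proof (rule integral_curveI)
      fix s
      have "((\<lambda>s. t * s) has_real_derivative t) (at s)" by (auto intro!: derivative_eq_intros)
      from has_velocity_reparam[where f = "\<lambda>s. t * s", OF integral_curveD(3)[OF \<gamma>(1) UNIV_I] this group_atlas]
      show "has_velocity (mfd G) (\<lambda>s. \<gamma> (t * s)) (left_field G (tscale t \<alpha>) (\<gamma> (t * s))) s"
        by (simp add: left_field_scale integral_curve_in[OF \<gamma>(1)])
    qed auto
    from flow_eq[OF group_man left_field_loc_lipschitz[OF lie_algebra_scale[OF \<alpha>]] this, of 1]
    show ?thesis by (simp add: lie_exp_def \<gamma>(2))
  qed
  then show "integral_curve (mfd G) (left_field G \<alpha>) UNIV (\<lambda>t. lie_exp G (tscale t \<alpha>))"
    "lie_exp G (tscale 0 \<alpha>) = \<one>"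
    using \<gamma> by simp_all
qed

lemma lie_exp_in: "\<alpha> \<in> lie_algebra G \<Longrightarrow> lie_exp G (tscale t \<alpha>) \<in> carrier G"
  using integral_curve_in[OF lie_exp_curve(1)] by blast

lemma lie_exp_velocity_0:
  assumes "\<alpha> \<in> lie_algebra G" shows "has_velocity (mfd G) (\<lambda>t. lie_exp G (tscale t \<alpha>)) \<alpha> 0"
  using integral_curveD(3)[OF lie_exp_curve(1)[OF assms] UNIV_I, of 0]
  by (simp add: lie_exp_curve(2)[OF assms] left_field_one[OF assms])

lemma lie_exp_add:
  assumes \<alpha>: "\<alpha> \<in> lie_algebra G"
  shows "lie_exp G (tscale (s + t) \<alpha>) = lie_exp G (tscale s \<alpha>) \<otimes> lie_exp G (tscale t \<alpha>)"
proof -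
  \<comment> \<open>The local law needs an interval that contains \<open>s\<close>, \<open>t\<close>
    and \<open>s + t\<close>; this radius exceeds all three absolute values.\<close>
  have I: "integral_curve (mfd G) (left_field G \<alpha>) (ball 0 (1 + \<bar>s\<bar> + \<bar>t\<bar>)) (\<lambda>t. lie_exp G (tscale t \<alpha>))"
    using lie_exp_curve(1)[OF \<alpha>] by (auto simp: integral_curve_def is_interval_ball_real)
  show ?thesis
    by (rule one_parameter_local_hom[OF \<alpha> I lie_exp_curve(2)[OF \<alpha>]]) auto
qed

lemma lie_exp_minus:
  assumes \<alpha>: "\<alpha> \<in> lie_algebra G"
  shows "lie_exp G (tscale (- t) \<alpha>) = inv (lie_exp G (tscale t \<alpha>))"
proof -
  have "lie_exp G (tscale (- t) \<alpha>) \<otimes> lie_exp G (tscale t \<alpha>) = \<one>"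
    using lie_exp_add[OF \<alpha>, of "-t" t] lie_exp_curve(2)[OF \<alpha>] by simp
  then show ?thesis using lie_exp_in[OF \<alpha>] by (simp add: inv_equality)
qed

section \<open>The adjoint action and the Maurer-Cartan form\<close>

lemma Ad_velocity:
  assumes "has_velocity (mfd G) \<gamma> \<alpha> t" "\<gamma> t = \<one>" "g \<in> carrier G"
  shows "has_velocity (mfd G) (\<lambda>s. conj_act G g (\<gamma> s)) (Ad G g \<alpha>) t"
  using mdiff_velocity[OF group_atlas group_atlas _ assms(1), of "conj_act G g"] conj_mdiff[OF assms(3) one_closed] assms(2)
  by (simp add: Ad_def)

lemma conj_one: "g \<in> carrier G \<Longrightarrow> conj_act G g \<one> = \<one>"
  by (simp add: conj_act_def)

lemma conj_by_one: "g \<in> carrier G \<Longrightarrow> conj_act G \<one> g = g"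
  by (simp add: conj_act_def)

lemma conj_closed: "g \<in> carrier G \<Longrightarrow> k \<in> carrier G \<Longrightarrow> conj_act G g k \<in> carrier G"
  by (simp add: conj_act_def)

lemma conj_mult:
  "g \<in> carrier G \<Longrightarrow> h \<in> carrier G \<Longrightarrow> k \<in> carrier G \<Longrightarrow> conj_act G (g \<otimes> h) k = conj_act G g (conj_act G h k)"
  by (simp add: conj_act_def m_assoc inv_mult_group)

lemma Ad_closed: "g \<in> carrier G \<Longrightarrow> \<alpha> \<in> lie_algebra G \<Longrightarrow> Ad G g \<alpha> \<in> lie_algebra G"
  unfolding lie_algebra_def Ad_def
  using tangent_map_in_tangent_space[OF group_atlas group_atlas conj_mdiff[OF _ one_closed], of g \<alpha>] by (simp add: conj_one)

lemma Ad_one: "\<alpha> \<in> lie_algebra G \<Longrightarrow> Ad G \<one> \<alpha> = \<alpha>"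
  unfolding lie_algebra_def Ad_def
  by (rule tangent_map_ident[OF group_atlas conj_mdiff[OF one_closed one_closed]]) (simp_all add: pts_mfd conj_by_one)

lemma Ad_mult:
  assumes "g \<in> carrier G" "h \<in> carrier G" "\<alpha> \<in> lie_algebra G"
  shows "Ad G (g \<otimes> h) \<alpha> = Ad G g (Ad G h \<alpha>)"
proof -
  have g: "mdiff (mfd G) (mfd G) (conj_act G g) (conj_act G h \<one>)"
    using conj_mdiff[OF assms(1) one_closed] assms(2) by (simp add: conj_one)
  from tangent_map_comp[OF group_atlas group_atlas group_atlas conj_mdiff[OF assms(2) one_closed] g
      conj_mdiff[OF m_closed[OF assms(1,2)] one_closed] _ lie_algebraD[OF assms(3)]]
  show ?thesis using assms by (simp add: Ad_def conj_one pts_mfd conj_mult)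
qed

text \<open>Elements of a one-parameter subgroup commute, so conjugation by exp(t\<alpha>) fixes the
  subgroup pointwise and hence its velocity at 0.\<close>

lemma Ad_lie_exp:
  assumes \<alpha>: "\<alpha> \<in> lie_algebra G" shows "Ad G (lie_exp G (tscale t \<alpha>)) \<alpha> = \<alpha>"
proof -
  let ?E = "\<lambda>t. lie_exp G (tscale t \<alpha>)"
  have "conj_act G (?E t) (?E s) = ?E s" for s
  proof -
    have "?E t \<otimes> ?E s = ?E s \<otimes> ?E t"
      using lie_exp_add[OF \<alpha>, of t s] lie_exp_add[OF \<alpha>, of s t] by (simp add: add.commute)
    then show ?thesis using lie_exp_in[OF \<alpha>] by (simp add: conj_act_def m_assoc)
  qed
  then have "has_velocity (mfd G) ?E (Ad G (?E t) \<alpha>) 0"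
    using Ad_velocity[OF lie_exp_velocity_0[OF \<alpha>] lie_exp_curve(2)[OF \<alpha>] lie_exp_in[OF \<alpha>, of t]] by simp
  from has_velocity_unique[OF this lie_exp_velocity_0[OF \<alpha>]] show ?thesis .
qed

text \<open>Translation by \<open>inv g\<close> recovers \<alpha> from its left translate, so the
  map inverted by \<open>inv_into\<close> is injective on the Lie algebra.\<close>

lemma maurer_cartan_left_field:
  assumes "\<alpha> \<in> lie_algebra G" "g \<in> carrier G"
  shows "maurer_cartan G g (left_field G \<alpha> g) = \<alpha>"
proof -
  have "tangent_map (mfd G) (mfd G) (\<lambda>k. inv g \<otimes> k) g (left_field G \<beta> g) = \<beta>" if "\<beta> \<in> lie_algebra G" for \<beta>
    using left_field_translate[OF that inv_closed[OF assms(2)] assms(2)] assms(2) left_field_one[OF that] by simp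
  then have "inj_on (\<lambda>\<beta>. left_field G \<beta> g) (lie_algebra G)"
    by (rule inj_on_inverseI[where g = "tangent_map (mfd G) (mfd G) (\<lambda>k. inv g \<otimes> k) g"])
  from inv_into_f_f[OF this assms(1)] show ?thesis
    by (simp add: maurer_cartan_def left_field_def[abs_def])
qed

text \<open>The derivative of the multiplication at the pair of units is addition, since both of its
  partial maps there are the identity.\<close>

lemma velocity_mult_at_one:
  assumes v: "has_velocity (mfd G) \<gamma> \<alpha> t" "\<gamma> t = \<one>" and w: "has_velocity (mfd G) \<delta> \<beta> t" "\<delta> t = \<one>"
  shows "has_velocity (mfd G) (\<lambda>s. \<gamma> s \<otimes> \<delta> s) (tplus \<alpha> \<beta>) t"
proof -
  have \<alpha>: "\<alpha> \<in> tangent_space (mfd G) \<one>" and \<beta>: "\<beta> \<in> tangent_space (mfd G) \<one>"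
    using has_velocityD(2)[OF v(1)] has_velocityD(2)[OF w(1)] v(2) w(2) by simp_all
  have "tangent_map (mfd G) (mfd G) (\<lambda>x. x \<otimes> \<one>) \<one> \<alpha> = \<alpha>"
    by (rule tangent_map_ident[OF group_atlas rmult_mdiff[OF one_closed one_closed] _ \<alpha>]) (simp add: pts_mfd)
  moreover have "tangent_map (mfd G) (mfd G) (\<lambda>x. \<one> \<otimes> x) \<one> \<beta> = \<beta>"
    by (rule tangent_map_ident[OF group_atlas lmult_mdiff[OF one_closed one_closed] _ \<beta>]) (simp add: pts_mfd)
  moreover have "mdiff (prod_man (mfd G) (mfd G)) (mfd G) (\<lambda>(g, k). g \<otimes> k) (\<gamma> t, \<delta> t)"
    unfolding v(2) w(2) by (rule mult_mdiff) auto
  from has_velocity_product[OF group_atlas group_atlas group_atlas this v(1) w(1)]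
  have "has_velocity (mfd G) (\<lambda>s. \<gamma> s \<otimes> \<delta> s)
    (tplus (tangent_map (mfd G) (mfd G) (\<lambda>x. x \<otimes> \<one>) \<one> \<alpha>) (tangent_map (mfd G) (mfd G) (\<lambda>x. \<one> \<otimes> x) \<one> \<beta>)) t"
    by (simp add: v(2) w(2))
  ultimately show ?thesis by simp
qed

text \<open>The curve is rewritten by \<open>k g k\<^sup>-\<^sup>1 = g (g\<^sup>-\<^sup>1 k g) k\<^sup>-\<^sup>1\<close>.\<close>

lemma conj_lie_exp_velocity:
  assumes \<alpha>: "\<alpha> \<in> lie_algebra G" and g: "g \<in> carrier G"
  shows "has_velocity (mfd G) (\<lambda>t. conj_act G (lie_exp G (tscale t \<alpha>)) g)
    (left_field G (tminus (Ad G (inv g) \<alpha>) \<alpha>) g) 0"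
proof -
  let ?E = "\<lambda>t. lie_exp G (tscale t \<alpha>)"
  have E: "?E t \<in> carrier G" for t by (rule lie_exp_in[OF \<alpha>])
  have v: "has_velocity (mfd G) (\<lambda>t. conj_act G (inv g) (?E t)) (Ad G (inv g) \<alpha>) 0"
    by (rule Ad_velocity[OF lie_exp_velocity_0[OF \<alpha>] lie_exp_curve(2)[OF \<alpha>]]) (use g in simp)
  have "((\<lambda>t. - t) has_real_derivative -1) (at (0::real))" by (auto intro!: derivative_eq_intros)
  from has_velocity_reparam[where f = "\<lambda>t. - t", OF _ this group_atlas, of ?E \<alpha>] lie_exp_velocity_0[OF \<alpha>]
  have w: "has_velocity (mfd G) (\<lambda>t. ?E (- t)) (tscale (- 1) \<alpha>) 0" by simp
  have 1: "conj_act G (inv g) (?E 0) = \<one>" "?E (- 0) = \<one>"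
    using g by (simp_all add: lie_exp_curve(2)[OF \<alpha>] conj_one)
  have "tplus (Ad G (inv g) \<alpha>) (tscale (- 1) \<alpha>) = tminus (Ad G (inv g) \<alpha>) \<alpha>"
    by (simp add: tplus_def tminus_def tscale_def)
  with velocity_mult_at_one[OF v 1(1) w 1(2)]
  have m: "has_velocity (mfd G) (\<lambda>t. conj_act G (inv g) (?E t) \<otimes> ?E (- t)) (tminus (Ad G (inv g) \<alpha>) \<alpha>) 0" by simp
  have "has_velocity (mfd G) (\<lambda>t. g \<otimes> (conj_act G (inv g) (?E t) \<otimes> ?E (- t)))
    (left_field G (tminus (Ad G (inv g) \<alpha>) \<alpha>) g) 0"
    using mdiff_velocity[where f = "\<lambda>k. g \<otimes> k", OF group_atlas group_atlas _ m] lmult_mdiff[OF g one_closed] 1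
    by (simp add: left_field_def)
  moreover have "g \<otimes> (conj_act G (inv g) (?E t) \<otimes> ?E (- t)) = conj_act G (?E t) g" for t
  proof -
    let ?x = "?E t \<otimes> (g \<otimes> ?E (- t))"
    have "g \<otimes> (conj_act G (inv g) (?E t) \<otimes> ?E (- t)) = g \<otimes> (inv g \<otimes> ?x)"
      using g E by (simp add: conj_act_def m_assoc)
    also have "\<dots> = (g \<otimes> inv g) \<otimes> ?x" using g E by (intro m_assoc[symmetric]) simp_all
    also have "\<dots> = ?x" using g E by simp
    finally show ?thesis using g E lie_exp_minus[OF \<alpha>, of t] by (simp add: conj_act_def m_assoc)
  qed
  ultimately show ?thesis by simp
qed

text \<open>That every vector is a point requires a generating chart that is admissible in
  \<open>max_atlas\<close>. Evaluation in a chart at the unit is a bijection onto the model space,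
  and two such charts are related by the linear derivative of a transition.\<close>

lemma pts_lie_algebra_man: "pts (lie_algebra_man G) = lie_algebra G"
proof
  let ?A = "{(lie_algebra G, \<lambda>v. v c) | c. c \<in> charts_at (mfd G) \<one>} :: (('g, 'l) tangent, 'l) manifold"
  show "pts (lie_algebra_man G) \<subseteq> lie_algebra G"
  proof
    fix v assume "v \<in> pts (lie_algebra_man G)"
    then obtain d where "d \<in> max_atlas ?A" "v \<in> fst d"
      unfolding pts_def lie_algebra_man_def by blast
    then have "fst d \<subseteq> \<Union>(fst ` ?A)" unfolding max_atlas_iff by (elim conjE) assumption
    moreover have "\<Union>(fst ` ?A) \<subseteq> lie_algebra G" by fastforce
    ultimately show "v \<in> lie_algebra G" using \<open>v \<in> fst d\<close> by (meson subsetD)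
  qed
  obtain c where c: "c \<in> charts_at (mfd G) \<one>" using pts_chart[OF one_pts] by blast
  have im: "(\<lambda>v. v d) ` lie_algebra G = UNIV" if d: "d \<in> charts_at (mfd G) \<one>" for d
  proof -
    have "w \<in> (\<lambda>v. v d) ` lie_algebra G" for w
    proof -
      obtain v where "v \<in> tangent_space (mfd G) \<one>" "v d = w"
        by (rule tangent_with_coordinate[OF group_atlas d]) (rule that)
      then show ?thesis by (auto simp: lie_algebra_def)
    qed
    then show ?thesis by blast
  qed
  have inj: "inj_on (\<lambda>v. v d) (lie_algebra G)" if d: "d \<in> charts_at (mfd G) \<one>" for d
    by (rule inj_onI) (rule tangent_eqI[OF _ _ d], simp_all add: lie_algebra_def)
  have sm: "smooth_on UNIV (transition (lie_algebra G, \<lambda>v. v c) (lie_algebra G, \<lambda>v. v d))"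
    if c: "c \<in> charts_at (mfd G) \<one>" and d: "d \<in> charts_at (mfd G) \<one>" for c d
  proof -
    let ?D = "frechet_derivative (transition c d) (at (snd c \<one>))"
    have "transition (lie_algebra G, \<lambda>v. v c) (lie_algebra G, \<lambda>v. v d) w = ?D w" for w
    proof -
      have "w \<in> (\<lambda>v. v c) ` lie_algebra G" using im[OF c] by simp
      then obtain v where v: "v \<in> lie_algebra G" "w = v c" by blast
      have "inv_into (lie_algebra G) (\<lambda>v. v c) w = v"
        using inv_into_f_f[OF inj[OF c] v(1)] v(2) by simp
      then have "transition (lie_algebra G, \<lambda>v. v c) (lie_algebra G, \<lambda>v. v d) w = v d"
        by (simp add: transition_def)
      then show ?thesis
        unfolding v(2) tangent_space_transition[OF lie_algebraD[OF v(1)] c d] .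
    qed
    then have "transition (lie_algebra G, \<lambda>v. v c) (lie_algebra G, \<lambda>v. v d) = ?D" by (rule ext)
    moreover have "(transition c d has_derivative ?D) (at (snd c \<one>))"
      using transition_differentiable[OF group_atlas c d] by (simp add: frechet_derivative_works)
    ultimately show ?thesis by (simp add: smooth_on_bounded_linear has_derivative_bounded_linear)
  qed
  have cA: "(lie_algebra G, \<lambda>v. v c) \<in> ?A" using c by blast
  have "(lie_algebra G, \<lambda>v. v c) \<in> max_atlas ?A"
    unfolding max_atlas_iff
  proof (intro conjI ballI)
    show "fst (lie_algebra G, (\<lambda>v. v c) :: ('g, 'l) tangent \<Rightarrow> 'l) \<subseteq> \<Union>(fst ` ?A)" by (rule UN_upper[OF cA, of fst])
    fix d assume "d \<in> ?A"
    then obtain d' where "d = (lie_algebra G, \<lambda>v. v d')" "d' \<in> charts_at (mfd G) \<one>" by blast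
    then show "compatible (lie_algebra G, \<lambda>v. v c) d"
      using sm c im by (simp add: compatible_def)
  qed (use inj[OF c] im[OF c] in simp_all)
  from UN_upper[OF this, of fst] show "lie_algebra G \<subseteq> pts (lie_algebra_man G)"
    unfolding pts_def lie_algebra_man_def by simp
qed

end

section \<open>Principal and associated bundles\<close>

locale principal = lie_grp G for G :: "('g, 'l::model_space) lie_group" (structure) +
  fixes M :: "('m, 'e::model_space) manifold" and P :: "('p, 'q::model_space, 'm, 'g) principal_data"
  assumes pb: "principal_bundle G M P"
begin

lemma base_man: "is_manifold M" and tot_man: "is_manifold (tot P)"
  and prj_smooth: "smooth_map (tot P) M (prj P)"
  and ract_smooth: "smooth_map (prod_man (tot P) (mfd G)) (tot P) (\<lambda>(p, g). ract P p g)"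
  using pb by (simp_all add: principal_bundle_def)

lemma base_at: "smooth_atlas M" and tot_at: "smooth_atlas (tot P)"
  using base_man tot_man by (simp_all add: is_manifold_smooth_atlas)

lemma ract_one: "p \<in> pts (tot P) \<Longrightarrow> ract P p \<one> = p"
  using pb by (simp add: principal_bundle_def)

lemma ract_ract:
  "p \<in> pts (tot P) \<Longrightarrow> g \<in> carrier G \<Longrightarrow> k \<in> carrier G \<Longrightarrow> ract P (ract P p g) k = ract P p (g \<otimes> k)"
  using pb by (simp add: principal_bundle_def)

lemma prj_ract: "p \<in> pts (tot P) \<Longrightarrow> g \<in> carrier G \<Longrightarrow> prj P (ract P p g) = prj P p"
  using pb by (simp add: principal_bundle_def)

lemma ract_closed: "p \<in> pts (tot P) \<Longrightarrow> g \<in> carrier G \<Longrightarrow> ract P p g \<in> pts (tot P)"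
  using smooth_map_pts[OF ract_smooth, of "(p, g)"] by (simp add: pts_prod_man[OF tot_at group_atlas] pts_mfd)

lemma prj_pts: "p \<in> pts (tot P) \<Longrightarrow> prj P p \<in> pts M"
  by (rule smooth_map_pts[OF prj_smooth])

lemma prj_mdiff: "p \<in> pts (tot P) \<Longrightarrow> mdiff (tot P) M (prj P) p"
  by (rule smooth_map_mdiff[OF prj_smooth tot_at subset_refl base_at subset_refl])

lemma ract_mdiff:
  assumes "p \<in> pts (tot P)" "g \<in> carrier G" shows "mdiff (mfd G) (tot P) (\<lambda>g. ract P p g) g"
proof -
  have "mdiff (prod_man (tot P) (mfd G)) (tot P) (\<lambda>(p, g). ract P p g) (p, g)"
    by (rule smooth_map_mdiff[OF ract_smooth smooth_atlas_prod[OF tot_at group_atlas] subset_refl tot_at subset_refl])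
      (use assms in \<open>simp add: pts_prod_man[OF tot_at group_atlas] pts_mfd\<close>)
  from mdiff_slice(2)[OF tot_at group_atlas tot_at this] show ?thesis by simp
qed

text \<open>Distils from a local trivialization what the pointwise arguments use: a differentiable
  equivariant fibre coordinate that separates the points of a fibre, and a point over
  \<open>x\<close>.\<close>

lemma trivialization:
  assumes x: "x \<in> pts M"
  obtains U \<tau> where "x \<in> U"
    "\<And>q. q \<in> pts (tot P) \<Longrightarrow> prj P q \<in> U \<Longrightarrow> mdiff (tot P) (mfd G) \<tau> q"
    "\<And>q g. q \<in> pts (tot P) \<Longrightarrow> g \<in> carrier G \<Longrightarrow> prj P q \<in> U \<Longrightarrow> \<tau> (ract P q g) = \<tau> q \<otimes> g"
    "\<And>q q'. q \<in> pts (tot P) \<Longrightarrow> q' \<in> pts (tot P) \<Longrightarrow> prj P q \<in> U \<Longrightarrow> prj P q = prj P q' \<Longrightarrow>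
      \<tau> q = \<tau> q' \<Longrightarrow> q = q'"
    "\<exists>q\<in>pts (tot P). prj P q = x"
proof -
  obtain U \<tau> where U: "x \<in> U" and lt: "local_triv (mfd G) (tot P) M (prj P) U \<tau>"
    and eqv: "\<And>q g. q \<in> pts (tot P) \<Longrightarrow> g \<in> carrier G \<Longrightarrow> prj P q \<in> U \<Longrightarrow> \<tau> (ract P q g) = \<tau> q \<otimes> g"
    using pb x unfolding principal_bundle_def by meson
  let ?W = "{z \<in> pts (tot P). prj P z \<in> U}" and ?F = "\<lambda>z. (prj P z, \<tau> z)"
  have oU: "openin (man_top M) U"
    and df: "diffeo (open_sub (tot P) ?W) (prod_man (open_sub M U) (mfd G)) ?F"
    using lt unfolding local_triv_def by simp_all
  have "continuous_map (man_top (tot P)) (man_top M) (prj P)" using prj_smooth by (simp add: smooth_map_def)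
  from openin_continuous_map_preimage[OF this oU]
  have oW: "openin (man_top (tot P)) ?W" by (simp add: topspace_man_top)
  have MU: "smooth_atlas (open_sub M U)" by (rule smooth_atlas_open_sub[OF base_at])
  have ptsW: "pts (open_sub (tot P) ?W) = ?W" by (rule pts_open_sub[OF tot_man oW])
  have ptsU: "pts (prod_man (open_sub M U) (mfd G)) = U \<times> carrier G"
    by (simp add: pts_prod_man[OF MU group_atlas] pts_open_sub[OF base_man oU] pts_mfd)
  have bij: "bij_betw ?F ?W (U \<times> carrier G)"
    and sm: "smooth_map (open_sub (tot P) ?W) (prod_man (open_sub M U) (mfd G)) ?F"
    using df unfolding diffeo_def ptsW ptsU by simp_all
  have sub: "open_sub (tot P) ?W \<subseteq> tot P" by (auto simp: open_sub_iff)
  have Fin: "prj P q \<in> U" "\<tau> q \<in> carrier G" if "q \<in> ?W" for q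
    using bij_betwE[OF bij] that by auto
  have md: "mdiff (tot P) (mfd G) \<tau> q" if q: "q \<in> pts (tot P)" "prj P q \<in> U" for q
  proof -
    have qW: "q \<in> ?W" using q by simp
    have 1: "mdiff (tot P) (prod_man (open_sub M U) (mfd G)) ?F q"
      by (rule smooth_map_mdiff[OF sm tot_at sub smooth_atlas_prod[OF MU group_atlas] subset_refl]) (simp only: ptsW qW)
    have 2: "mdiff (prod_man (open_sub M U) (mfd G)) (mfd G) snd (prj P q, \<tau> q)"
      by (rule mdiff_snd[OF MU group_atlas]) (use Fin[OF qW] in \<open>simp_all add: pts_open_sub[OF base_man oU] pts_mfd\<close>)
    from mdiff_compose[where f = ?F and g = snd, OF tot_at smooth_atlas_prod[OF MU group_atlas] group_atlas 1 2]
    show ?thesis by simp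
  qed
  have inj: "q = q'" if "q \<in> pts (tot P)" "q' \<in> pts (tot P)" "prj P q \<in> U" "prj P q = prj P q'" "\<tau> q = \<tau> q'" for q q'
    using bij_betw_imp_inj_on[OF bij] that by (simp add: inj_on_def)
  have "(x, \<one>) \<in> ?F ` ?W" using bij_betw_imp_surj_on[OF bij] U by simp
  then have ex: "\<exists>q\<in>pts (tot P). prj P q = x" by auto
  show thesis by (rule that[OF U md eqv inj ex])
qed

lemma mdiff_in_carrier: "mdiff (tot P) (mfd G) \<tau> q \<Longrightarrow> \<tau> q \<in> carrier G"
  using mdiffD(2)[of "tot P" "mfd G" \<tau> q] by (simp add: pts_mfd)

lemma ract_transitive:
  assumes p: "p \<in> pts (tot P)" and q: "q \<in> pts (tot P)" and eq: "prj P p = prj P q"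
  obtains b where "b \<in> carrier G" "q = ract P p b"
proof -
  obtain U \<tau> where U: "prj P p \<in> U"
    and md: "\<And>q. q \<in> pts (tot P) \<Longrightarrow> prj P q \<in> U \<Longrightarrow> mdiff (tot P) (mfd G) \<tau> q"
    and eqv: "\<And>q g. q \<in> pts (tot P) \<Longrightarrow> g \<in> carrier G \<Longrightarrow> prj P q \<in> U \<Longrightarrow> \<tau> (ract P q g) = \<tau> q \<otimes> g"
    and inj: "\<And>q q'. q \<in> pts (tot P) \<Longrightarrow> q' \<in> pts (tot P) \<Longrightarrow> prj P q \<in> U \<Longrightarrow> prj P q = prj P q' \<Longrightarrow>
      \<tau> q = \<tau> q' \<Longrightarrow> q = q'"
    by (rule trivialization[OF prj_pts[OF p]]) (rule that)
  have \<tau>: "\<tau> p \<in> carrier G" "\<tau> q \<in> carrier G"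
    using md p q U eq by (auto intro: mdiff_in_carrier)
  \<comment> \<open>Read off in the trivialization: by equivariance the translate of
    \<open>p\<close> by \<open>?b\<close> has the fibre coordinate of \<open>q\<close>.\<close>
  let ?b = "inv (\<tau> p) \<otimes> \<tau> q"
  have b: "?b \<in> carrier G" using \<tau> by simp
  have 1: "\<tau> q = \<tau> (ract P p ?b)" using eqv[OF p b U] \<tau> by (simp add: m_assoc[symmetric])
  have 2: "prj P q \<in> U" "prj P q = prj P (ract P p ?b)" using U eq prj_ract[OF p b] by simp_all
  show thesis by (rule that[OF b inj[OF q ract_closed[OF p b] 2 1]])
qed

text \<open>The fibre coordinate carries the equation into the group, where \<open>\<tau> p\<close>
  cancels.\<close>

lemma ract_free:
  assumes p: "p \<in> pts (tot P)" and g: "g \<in> carrier G" and eq: "ract P p g = p"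
  shows "g = \<one>"
proof -
  obtain U \<tau> where U: "prj P p \<in> U"
    and md: "\<And>q. q \<in> pts (tot P) \<Longrightarrow> prj P q \<in> U \<Longrightarrow> mdiff (tot P) (mfd G) \<tau> q"
    and eqv: "\<And>q g. q \<in> pts (tot P) \<Longrightarrow> g \<in> carrier G \<Longrightarrow> prj P q \<in> U \<Longrightarrow> \<tau> (ract P q g) = \<tau> q \<otimes> g"
    by (rule trivialization[OF prj_pts[OF p]]) (rule that)
  have "\<tau> p \<in> carrier G" using md[OF p U] by (rule mdiff_in_carrier)
  then show ?thesis using eqv[OF p g U] eq g by simp
qed

lemma frame_in:
  assumes "x \<in> pts M" shows "frame P x \<in> pts (tot P)" "prj P (frame P x) = x"
proof -
  have "\<exists>q. q \<in> pts (tot P) \<and> prj P q = x"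
    by (rule trivialization[OF assms]) blast
  from someI_ex[OF this] show "frame P x \<in> pts (tot P)" "prj P (frame P x) = x"
    by (simp_all add: frame_def)
qed

text \<open>The algebraic laws of a left action. The conjugation and the adjoint space both satisfy
  them, so the calculus of classes is developed once for both.\<close>

definition gspace :: "('g, 'y, 'w::model_space) gspace \<Rightarrow> bool" where
  "gspace N \<longleftrightarrow> (\<forall>y\<in>pts (fst N). snd N \<one> y = y \<and> (\<forall>g\<in>carrier G. snd N g y \<in> pts (fst N)) \<and>
     (\<forall>g\<in>carrier G. \<forall>h\<in>carrier G. snd N (g \<otimes> h) y = snd N g (snd N h y)))"

lemma gspaceD:
  assumes "gspace N" "y \<in> pts (fst N)"
  shows "snd N \<one> y = y" "g \<in> carrier G \<Longrightarrow> snd N g y \<in> pts (fst N)"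
    "g \<in> carrier G \<Longrightarrow> h \<in> carrier G \<Longrightarrow> snd N (g \<otimes> h) y = snd N g (snd N h y)"
  using assms by (simp_all add: gspace_def)

lemma gspace_conj: "gspace (conj_space G)"
  by (simp add: gspace_def conj_space_def pts_mfd conj_by_one conj_closed conj_mult)

lemma gspace_adj: "gspace (adj_space G)"
  by (simp add: gspace_def adj_space_def pts_lie_algebra_man Ad_one Ad_closed Ad_mult)

text \<open>The substitution h \<mapsto> k h reindexes the orbit.\<close>

lemma cls_ract:
  assumes N: "gspace N" and p: "p \<in> pts (tot P)" and y: "y \<in> pts (fst N)" and k: "k \<in> carrier G"
  shows "cls G P N (ract P p k) y = cls G P N p (snd N k y)"
proof
  show "cls G P N (ract P p k) y \<subseteq> cls G P N p (snd N k y)"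
  proof
    fix w assume "w \<in> cls G P N (ract P p k) y"
    then obtain h where h: "h \<in> carrier G" "w = (ract P (ract P p k) h, snd N (inv h) y)"
      unfolding cls_def by blast
    have "snd N (inv (k \<otimes> h)) (snd N k y) = snd N (inv (k \<otimes> h) \<otimes> k) y"
      using gspaceD(3)[OF N y] k h by simp
    also have "inv (k \<otimes> h) \<otimes> k = inv h" using k h by (simp add: inv_mult_group m_assoc)
    finally have "w = (ract P p (k \<otimes> h), snd N (inv (k \<otimes> h)) (snd N k y))"
      using h ract_ract[OF p k h(1)] by simp
    then show "w \<in> cls G P N p (snd N k y)" unfolding cls_def using k h by blast
  qed
  show "cls G P N p (snd N k y) \<subseteq> cls G P N (ract P p k) y"
  proof
    fix w assume "w \<in> cls G P N p (snd N k y)"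
    then obtain g where g: "g \<in> carrier G" "w = (ract P p g, snd N (inv g) (snd N k y))"
      unfolding cls_def by blast
    let ?h = "inv k \<otimes> g"
    have h: "?h \<in> carrier G" using k g by simp
    have "ract P (ract P p k) ?h = ract P p g"
      using k g ract_ract[OF p k h] by (simp add: m_assoc[symmetric])
    moreover have "snd N (inv ?h) y = snd N (inv g) (snd N k y)"
      using gspaceD(3)[OF N y, of "inv g" k] k g by (simp add: inv_mult_group)
    ultimately have "w = (ract P (ract P p k) ?h, snd N (inv ?h) y)" using g by simp
    then show "w \<in> cls G P N (ract P p k) y" unfolding cls_def using h by blast
  qed
qed

text \<open>Two pairs in one orbit with the same first component are related by the unit, because
  the action on \<open>P\<close> is free.\<close>

lemma cls_inject:
  assumes N: "gspace N" and p: "p \<in> pts (tot P)" and y: "y \<in> pts (fst N)" "y' \<in> pts (fst N)"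
    and eq: "cls G P N p y = cls G P N p y'"
  shows "y = y'"
proof -
  have "(ract P p \<one>, snd N (inv \<one>) y) \<in> cls G P N p y" unfolding cls_def using one_closed by blast
  then have "(p, y) \<in> cls G P N p y'" using gspaceD(1)[OF N y(1)] ract_one[OF p] eq by simp
  then obtain g where g: "g \<in> carrier G" "p = ract P p g" "y = snd N (inv g) y'"
    unfolding cls_def by blast
  have "g = \<one>" by (rule ract_free[OF p g(1) g(2)[symmetric]])
  then show ?thesis using g(3) gspaceD(1)[OF N y(2)] by simp
qed

lemma bslash_cls:
  assumes "gspace N" "p \<in> pts (tot P)" "y \<in> pts (fst N)"
  shows "bslash G P N p (cls G P N p y) = y"
  unfolding bslash_def
  by (rule the_equality) (use assms cls_inject[OF assms(1,2)] in auto)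

lemma assoc_prj_cls:
  assumes p: "p \<in> pts (tot P)" shows "assoc_prj P (cls G P N p y) = prj P p"
  unfolding assoc_prj_def
proof (rule the_equality)
  have "(ract P p \<one>, snd N (inv \<one>) y) \<in> cls G P N p y" unfolding cls_def using one_closed by blast
  then show "\<exists>q y'. (q, y') \<in> cls G P N p y \<and> prj P p = prj P q" using ract_one[OF p] by auto
  fix x assume "\<exists>q y'. (q, y') \<in> cls G P N p y \<and> x = prj P q"
  then show "x = prj P p" unfolding cls_def using prj_ract[OF p] by auto
qed

section \<open>Charts and points of an associated bundle\<close>

definition assoc_chart ::
  "('g, 'y, 'w::model_space) gspace \<Rightarrow> ('m, 'e) chart \<Rightarrow> ('y, 'w) chart \<Rightarrow> ('m \<Rightarrow> 'p) \<Rightarrow> (('p \<times> 'y) set, 'e \<times> 'w) chart" where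
  "assoc_chart N c e s = ({cls G P N (s x) y | x y. x \<in> fst c \<and> y \<in> fst e},
     \<lambda>z. (snd c (assoc_prj P z), snd e (bslash G P N (s (assoc_prj P z)) z)))"

definition local_section :: "'m set \<Rightarrow> ('m \<Rightarrow> 'p) \<Rightarrow> bool" where
  "local_section U s \<longleftrightarrow> smooth_map (open_sub M U) (tot P) s \<and> (\<forall>x\<in>U. prj P (s x) = x)"

lemma assoc_man_eq:
  "assoc_man G M P N = max_atlas {assoc_chart N c e s | c e s. c \<in> M \<and> e \<in> fst N \<and> local_section (fst c) s}"
  unfolding assoc_man_def assoc_chart_def local_section_def
  by (rule arg_cong[of _ _ max_atlas]) (auto simp: split_paired_Ex)

lemma local_sectionD:
  assumes "local_section (fst c) s" "c \<in> M" "x \<in> fst c"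
  shows "s x \<in> pts (tot P)" "prj P (s x) = x"
proof -
  have "x \<in> pts (open_sub M (fst c))" using assms(2,3) unfolding pts_def by (auto simp: open_sub_iff intro!: bexI[of _ c])
  then show "s x \<in> pts (tot P)"
    using assms(1) unfolding local_section_def by (blast intro: smooth_map_pts)
  show "prj P (s x) = x" using assms unfolding local_section_def by blast
qed

context
  fixes N :: "('g, 'y, 'w::model_space) gspace"
  assumes N: "gspace N" and N_at: "smooth_atlas (fst N)"
begin

lemma assoc_chart_apply:
  assumes c: "c \<in> M" and e: "e \<in> fst N" and s: "local_section (fst c) s" and x: "x \<in> fst c" and y: "y \<in> fst e"
  shows "snd (assoc_chart N c e s) (cls G P N (s x) y) = (snd c x, snd e y)"
    "assoc_prj P (cls G P N (s x) y) = x" "bslash G P N (s x) (cls G P N (s x) y) = y"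
proof -
  note sx = local_sectionD[OF s c x]
  have y': "y \<in> pts (fst N)" using e y unfolding pts_def by blast
  show 1: "assoc_prj P (cls G P N (s x) y) = x" using assoc_prj_cls[OF sx(1)] sx(2) by simp
  show 2: "bslash G P N (s x) (cls G P N (s x) y) = y" by (rule bslash_cls[OF N sx(1) y'])
  show "snd (assoc_chart N c e s) (cls G P N (s x) y) = (snd c x, snd e y)"
    unfolding assoc_chart_def by (simp add: 1 2)
qed

lemma assoc_chart_inj:
  assumes c: "c \<in> M" and e: "e \<in> fst N" and s: "local_section (fst c) s"
  shows "inj_on (snd (assoc_chart N c e s)) (fst (assoc_chart N c e s))"
proof (rule inj_onI)
  fix z z' assume "z \<in> fst (assoc_chart N c e s)" "z' \<in> fst (assoc_chart N c e s)"
  then obtain x y x' y' where z: "x \<in> fst c" "y \<in> fst e" "z = cls G P N (s x) y"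
    "x' \<in> fst c" "y' \<in> fst e" "z' = cls G P N (s x') y'"
    unfolding assoc_chart_def by auto
  assume "snd (assoc_chart N c e s) z = snd (assoc_chart N c e s) z'"
  then have "snd c x = snd c x'" "snd e y = snd e y'"
    unfolding z(3,6) assoc_chart_apply(1)[OF c e s z(1,2)] assoc_chart_apply(1)[OF c e s z(4,5)] by simp_all
  then have "x = x'" "y = y'"
    using smooth_atlas_inj[OF base_at c] smooth_atlas_inj[OF N_at e] z by (simp_all add: inj_on_eq_iff)
  then show "z = z'" using z by simp
qed

lemma assoc_generators_inj:
  assumes "d \<in> {assoc_chart N c e s | c e s. c \<in> M \<and> e \<in> fst N \<and> local_section (fst c) s}"
  shows "inj_on (snd d) (fst d)"
  using assms assoc_chart_inj by blast

lemma assoc_at: "smooth_atlas (assoc_man G M P N)"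
  unfolding assoc_man_eq by (rule smooth_atlas_max_atlas) (rule assoc_generators_inj)

lemma assoc_point_chart:
  assumes "z \<in> pts (assoc_man G M P N)"
  obtains c e s x y where "c \<in> M" "e \<in> fst N" "local_section (fst c) s" "x \<in> fst c" "y \<in> fst e"
    "z = cls G P N (s x) y"
proof -
  let ?A = "{assoc_chart N c e s | c e s. c \<in> M \<and> e \<in> fst N \<and> local_section (fst c) s}"
  obtain k where k: "k \<in> max_atlas ?A" "z \<in> fst k"
    using assms unfolding pts_def assoc_man_eq by blast
  have "fst k \<subseteq> \<Union>(fst ` ?A)" using k(1) unfolding max_atlas_iff by (elim conjE) assumption
  then obtain d where d: "d \<in> ?A" "z \<in> fst d" using k(2) by blast
  then obtain c e s where "d = assoc_chart N c e s" "c \<in> M" "e \<in> fst N" "local_section (fst c) s" by blast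
  moreover obtain x y where "x \<in> fst c" "y \<in> fst e" "z = cls G P N (s x) y"
    using d(2) calculation(1) unfolding assoc_chart_def by auto
  ultimately show thesis using that by blast
qed

text \<open>A point is given through a local section \<open>s\<close>; transitivity on the fibre
  carries this representation from \<open>s x\<close> to the chosen \<open>p\<close>.\<close>

lemma assoc_point:
  assumes z: "z \<in> pts (assoc_man G M P N)" and p: "p \<in> pts (tot P)" "prj P p = assoc_prj P z"
  shows "bslash G P N p z \<in> pts (fst N)" "cls G P N p (bslash G P N p z) = z"
proof -
  obtain c e s x y where c: "c \<in> M" "e \<in> fst N" "local_section (fst c) s" "x \<in> fst c" "y \<in> fst e"
    "z = cls G P N (s x) y" by (rule assoc_point_chart[OF z]) (rule that)
  note sx = local_sectionD[OF c(3,1,4)]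
  have y: "y \<in> pts (fst N)" using c(2,5) unfolding pts_def by blast
  have "prj P p = prj P (s x)" using p(2) assoc_prj_cls[OF sx(1)] c(6) by simp
  then obtain b where b: "b \<in> carrier G" "s x = ract P p b" by (rule ract_transitive[OF p(1) sx(1)]) (rule that)
  have zb: "z = cls G P N p (snd N b y)" using cls_ract[OF N p(1) y b(1)] c(6) b(2) by simp
  have yb: "snd N b y \<in> pts (fst N)" by (rule gspaceD(2)[OF N y b(1)])
  have "bslash G P N p z = snd N b y" unfolding zb by (rule bslash_cls[OF N p(1) yb])
  then show "bslash G P N p z \<in> pts (fst N)" "cls G P N p (bslash G P N p z) = z"
    using zb by (simp_all add: yb)
qed

text \<open>Equivariance of the fibre coordinate in \<open>p\<close>. For the adjoint space it
  becomes the transformation law of \<open>coord\<close>.\<close>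

lemma bslash_ract:
  assumes z: "z \<in> pts (assoc_man G M P N)" and p: "p \<in> pts (tot P)" "prj P p = assoc_prj P z"
    and k: "k \<in> carrier G"
  shows "bslash G P N (ract P p k) z = snd N (inv k) (bslash G P N p z)"
proof -
  note b = assoc_point[OF z p]
  let ?y = "snd N (inv k) (bslash G P N p z)"
  have y: "?y \<in> pts (fst N)" by (rule gspaceD(2)[OF N b(1)]) (use k in simp)
  have "snd N k ?y = bslash G P N p z"
    using gspaceD(3)[OF N b(1) k, of "inv k"] gspaceD(1)[OF N b(1)] k by simp
  then have "cls G P N (ract P p k) ?y = z" using cls_ract[OF N p(1) y k] b(2) by simp
  then show ?thesis using bslash_cls[OF N ract_closed[OF p(1) k] y] by simp
qed

text \<open>Charts are obtained by cutting a generating chart down to the domain of an admissible chart at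
  the point, which avoids proving that the generating charts are mutually compatible.\<close>

lemma fibre_inclusion:
  assumes p: "p \<in> pts (tot P)" and g: "g \<in> pts (fst N)" and z: "cls G P N p g \<in> pts (assoc_man G M P N)"
    and act: "\<And>b k. b \<in> carrier G \<Longrightarrow> k \<in> pts (fst N) \<Longrightarrow> mdiff (fst N) (fst N) (snd N b) k"
  obtains \<rho> where "mdiff (fst N) (assoc_man G M P N) (cls G P N p) g"
    "mdiff (assoc_man G M P N) (fst N) \<rho> (cls G P N p g)"
    "\<And>k. k \<in> pts (fst N) \<Longrightarrow> \<rho> (cls G P N p k) = k"
proof -
  let ?z = "cls G P N p g" and ?Q = "assoc_man G M P N"
  let ?A = "{assoc_chart N c e s | c e s. c \<in> M \<and> e \<in> fst N \<and> local_section (fst c) s}"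
  obtain c e s x y0 where c: "c \<in> M" and e: "e \<in> fst N" and s: "local_section (fst c) s"
    and x: "x \<in> fst c" and y0: "y0 \<in> fst e" and zeq: "?z = cls G P N (s x) y0"
    by (rule assoc_point_chart[OF z]) (rule that)
  note sx = local_sectionD[OF s c x]
  have "prj P p = x" using assoc_prj_cls[OF p, of N g] assoc_prj_cls[OF sx(1), of N y0] sx(2) zeq by simp
  then have xeq: "prj P p = prj P (s x)" using sx(2) by simp
  obtain b where b: "b \<in> carrier G" "s x = ract P p b" by (rule ract_transitive[OF p sx(1) xeq]) (rule that)
  \<comment> \<open>Fibre coordinates relative to \<open>p\<close> and to \<open>s x\<close> differ
    by the action of \<open>b\<close>; \<theta> converts the former into the latter.\<close>
  define \<theta> where "\<theta> k = snd N (inv b) k" for k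
  have \<theta>: "\<theta> k \<in> pts (fst N)" "cls G P N p k = cls G P N (s x) (\<theta> k)" "snd N b (\<theta> k) = k"
    if k: "k \<in> pts (fst N)" for k
  proof -
    show k': "\<theta> k \<in> pts (fst N)" unfolding \<theta>_def by (rule gspaceD(2)[OF N k]) (use b in simp)
    show kk: "snd N b (\<theta> k) = k"
      unfolding \<theta>_def using gspaceD(3)[OF N k b(1), of "inv b"] gspaceD(1)[OF N k] b(1) by simp
    show "cls G P N p k = cls G P N (s x) (\<theta> k)"
      using cls_ract[OF N p k' b(1)] kk b(2) by simp
  qed
  have y0N: "y0 \<in> pts (fst N)" using e y0 unfolding pts_def by blast
  have \<theta>g: "\<theta> g = y0"
    by (rule cls_inject[OF N sx(1) \<theta>(1)[OF g] y0N]) (use \<theta>(2)[OF g] zeq in simp)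
  let ?d = "assoc_chart N c e s"
  have dA: "?d \<in> ?A" using c e s by blast
  obtain c1 where c1: "c1 \<in> charts_at ?Q ?z" using pts_chart[OF z] by blast
  then have c1Q: "c1 \<in> max_atlas ?A" "?z \<in> fst c1" by (simp_all add: charts_at_iff assoc_man_eq)
  define d' where "d' = (fst ?d \<inter> fst c1, snd ?d)"
  have d'Q: "d' \<in> ?Q"
    unfolding d'_def assoc_man_eq by (rule max_atlas_restrict_generator[OF assoc_generators_inj c1Q(1) dA])
  have dom: "cls G P N (s x') y' \<in> fst ?d" if "x' \<in> fst c" "y' \<in> fst e" for x' y'
    using that unfolding assoc_chart_def by auto
  have zd': "?z \<in> fst d'" using dom[OF x y0] zeq c1Q(2) by (simp add: d'_def)
  have d': "d' \<in> charts_at ?Q ?z" using d'Q zd' by (simp add: charts_at_iff)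
  have sd'z: "snd d' ?z = (snd c x, snd e y0)"
    unfolding d'_def snd_conv zeq by (rule assoc_chart_apply(1)[OF c e s x y0])
  have "open (snd d' ` fst d')" using assoc_at d'Q by (simp add: smooth_atlas_def)
  moreover have "snd d' ?z \<in> snd d' ` fst d'" using zd' by blast
  ultimately have evd': "\<forall>\<^sub>F u in nhds (snd c x, snd e y0). u \<in> snd d' ` fst d'"
    unfolding sd'z by (rule eventually_nhds_in_open)
  have eC: "e \<in> charts_at (fst N) (\<theta> g)" using e y0 by (simp add: charts_at_iff \<theta>g)
  obtain c0 where c0: "c0 \<in> charts_at (fst N) g" using pts_chart[OF g] by blast
  have \<theta>md: "mdiff (fst N) (fst N) \<theta> g"
    unfolding \<theta>_def[abs_def] by (rule act[OF _ g]) (use b in simp)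
  let ?i = "chart_inv c0"
  have ev1: "\<forall>\<^sub>F u in nhds (snd c0 g). \<theta> (?i u) \<in> fst e" by (rule mdiffD(3)[OF \<theta>md c0 eC])
  have ev2: "\<forall>\<^sub>F u in nhds (snd c0 g). ?i u \<in> pts (fst N)"
    using eventually_chart_inv[OF N_at c0 c0]
    by eventually_elim (use c0 in \<open>auto simp: charts_at_iff pts_def\<close>)
  have der: "(\<lambda>u. snd e (\<theta> (?i u))) differentiable at (snd c0 g)" by (rule mdiffD(4)[OF \<theta>md c0 eC])
  then obtain D where D: "((\<lambda>u. snd e (\<theta> (?i u))) has_derivative D) (at (snd c0 g))"
    unfolding differentiable_def by blast
  have pair: "((\<lambda>u. (snd c x, snd e (\<theta> (?i u)))) has_derivative (\<lambda>h. (0, D h))) (at (snd c0 g))"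
    by (rule has_derivative_Pair[OF has_derivative_const D])
  have coord: "snd ?d (cls G P N p k) = (snd c x, snd e (\<theta> k))" if "k \<in> pts (fst N)" "\<theta> k \<in> fst e" for k
    using assoc_chart_apply(1)[OF c e s x that(2)] \<theta>(2)[OF that(1)] by simp
  have ig: "?i (snd c0 g) = g" by (rule chart_inv_apply[OF N_at c0])
  \<comment> \<open>The image of \<open>d'\<close> is open, so nearby coordinates are attained at
    points of its domain. Injectivity of the uncut generating chart then identifies these points
    with the classes [p, k].\<close>
  have ev3: "\<forall>\<^sub>F u in nhds (snd c0 g). (snd c x, snd e (\<theta> (?i u))) \<in> snd d' ` fst d'"
    by (rule eventually_nhds_continuous[OF has_derivative_continuous[OF pair]]) (simp only: ig \<theta>g evd')
  have incl: "mdiff (fst N) ?Q (cls G P N p) g"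
  proof (rule mdiffI[where f = "cls G P N p", OF N_at assoc_at c0 d'])
    show "\<forall>\<^sub>F u in nhds (snd c0 g). cls G P N p (?i u) \<in> fst d'"
      using ev1 ev2 ev3
    proof eventually_elim
      case (elim u)
      then obtain z' where z': "z' \<in> fst d'" "snd ?d z' = (snd c x, snd e (\<theta> (?i u)))"
        unfolding d'_def by auto
      have "cls G P N p (?i u) \<in> fst ?d" using dom[OF x elim(1)] \<theta>(2)[OF elim(2)] by simp
      moreover have "z' \<in> fst ?d" using z'(1) by (simp add: d'_def)
      moreover have "snd ?d (cls G P N p (?i u)) = snd ?d z'" using coord[OF elim(2,1)] z'(2) by simp
      ultimately have "cls G P N p (?i u) = z'"
        using assoc_chart_inj[OF c e s] by (simp add: inj_on_eq_iff)
      then show ?case using z'(1) by simp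
    qed
    have "\<forall>\<^sub>F u in nhds (snd c0 g). (snd c x, snd e (\<theta> (?i u))) = snd d' (cls G P N p (?i u))"
      using ev1 ev2 by eventually_elim (simp add: d'_def coord)
    with differentiableI[OF pair] show "(\<lambda>u. snd d' (cls G P N p (?i u))) differentiable at (snd c0 g)"
      by (rule differentiable_cong_nhds)
  qed
  \<comment> \<open>The fibre coordinate along the section \<open>s\<close>. It is defined over
    neighbouring base points as well, so it can be differentiable on the bundle and not just along
    the fibre; acting by \<open>b\<close> returns to the frame \<open>p\<close>.\<close>
  define \<rho>0 where "\<rho>0 z = bslash G P N (s (assoc_prj P z)) z" for z
  have \<rho>0: "\<rho>0 (cls G P N (s x') y') = y'" if "x' \<in> fst c" "y' \<in> fst e" for x' y'
    unfolding \<rho>0_def using assoc_chart_apply(2,3)[OF c e s that] by simp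
  have \<rho>0z: "\<rho>0 ?z = y0" unfolding zeq by (rule \<rho>0[OF x y0])
  have e0: "e \<in> charts_at (fst N) (\<rho>0 ?z)" using e y0 by (simp add: charts_at_iff \<rho>0z)
  have inv_d': "\<rho>0 (chart_inv d' u) \<in> fst e \<and> snd u = snd e (\<rho>0 (chart_inv d' u))"
    if u: "u \<in> snd d' ` fst d'" for u
  proof -
    obtain z' where z': "z' \<in> fst d'" "u = snd d' z'" using u by blast
    have i: "chart_inv d' u = z'"
      using smooth_atlas_inj[OF assoc_at d'Q] z' by simp
    obtain x' y' where xy: "x' \<in> fst c" "y' \<in> fst e" "z' = cls G P N (s x') y'"
      using z'(1) unfolding d'_def assoc_chart_def by auto
    have "snd u = snd e y'"
      using assoc_chart_apply(1)[OF c e s xy(1,2)] z'(2) xy(3) by (simp add: d'_def)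
    then show ?thesis unfolding i xy(3) \<rho>0[OF xy(1,2)] using xy(2) by simp
  qed
  have \<rho>0md: "mdiff ?Q (fst N) \<rho>0 ?z"
  proof (rule mdiffI[where f = \<rho>0, OF assoc_at N_at d' e0])
    show "\<forall>\<^sub>F u in nhds (snd d' ?z). \<rho>0 (chart_inv d' u) \<in> fst e"
      unfolding sd'z using evd' by eventually_elim (use inv_d' in blast)
    have "\<forall>\<^sub>F u in nhds (snd d' ?z). snd u = snd e (\<rho>0 (chart_inv d' u))"
      unfolding sd'z using evd' by eventually_elim (use inv_d' in blast)
    then show "(\<lambda>u. snd e (\<rho>0 (chart_inv d' u))) differentiable at (snd d' ?z)"
      by (rule differentiable_cong_nhds[OF bounded_linear_imp_differentiable[OF bounded_linear_snd]])
  qed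
  have "mdiff (fst N) (fst N) (snd N b) (\<rho>0 ?z)"
    unfolding \<rho>0z by (rule act[OF b(1) y0N])
  from mdiff_compose[where f = \<rho>0 and g = "snd N b", OF assoc_at N_at N_at \<rho>0md this]
  have md: "mdiff ?Q (fst N) (\<lambda>z. snd N b (\<rho>0 z)) ?z" .
  have left_inv: "snd N b (\<rho>0 (cls G P N p k)) = k" if k: "k \<in> pts (fst N)" for k
  proof -
    have "\<rho>0 (cls G P N p k) = \<theta> k"
      unfolding \<rho>0_def \<theta>(2)[OF k] assoc_prj_cls[OF sx(1)] sx(2) by (rule bslash_cls[OF N sx(1) \<theta>(1)[OF k]])
    then show ?thesis using \<theta>(3)[OF k] by simp
  qed
  show thesis by (rule that[OF incl md left_inv])
qed

end

end

section \<open>The gauge field\<close>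

context principal
begin

lemma conj_space_simps: "fst (conj_space G) = mfd G" "snd (conj_space G) = conj_act G"
  by (simp_all add: conj_space_def)

lemma adj_space_simps: "fst (adj_space G) = lie_algebra_man G" "snd (adj_space G) = Ad G"
  by (simp_all add: adj_space_def)

lemma lie_algebra_man_at: "smooth_atlas (lie_algebra_man G)"
  unfolding lie_algebra_man_def
proof (rule smooth_atlas_max_atlas)
  fix d :: "(('g, 'l) tangent, 'l) chart"
  assume "d \<in> {(lie_algebra G, \<lambda>v. v c) |c. c \<in> charts_at (mfd G) \<one>}"
  then obtain c where c: "c \<in> charts_at (mfd G) \<one>" "d = (lie_algebra G, \<lambda>v. v c)" by blast
  have "inj_on (\<lambda>v. v c) (lie_algebra G)"
    by (rule inj_onI) (rule tangent_eqI[OF _ _ c(1)], simp_all add: lie_algebra_def)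
  then show "inj_on (snd d) (fst d)" by (simp add: c(2))
qed

end

locale gauge = principal G M P
  for G :: "('g, 'l::model_space) lie_group" (structure)
    and M :: "('m, 'e::model_space) manifold" and P :: "('p, 'q::model_space, 'm, 'g) principal_data" +
  fixes a :: "'m \<Rightarrow> ('p \<times> ('g, 'l) tangent) set"
  assumes section_a: "assoc_section G M P (adj_space G) a"
begin

text \<open>The equivariant function on \<open>P\<close> with values in the Lie algebra that
  corresponds to the section \<open>a\<close>.\<close>

definition coord :: "'p \<Rightarrow> ('g, 'l) tangent" where
  "coord p = bslash G P (adj_space G) p (a (prj P p))"

lemma section_point:
  assumes "x \<in> pts M"
  shows "a x \<in> pts (assoc_man G M P (adj_space G))" "assoc_prj P (a x) = x"
  using section_a assms smooth_map_pts[of M "assoc_man G M P (adj_space G)" a x]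
  by (simp_all add: assoc_section_def)

lemma adj_atlas: "smooth_atlas (fst (adj_space G))"
  by (simp add: adj_space_simps lie_algebra_man_at)

lemma coord_in: assumes p: "p \<in> pts (tot P)" shows "coord p \<in> lie_algebra G"
proof -
  note x = section_point[OF prj_pts[OF p]]
  have "coord p \<in> pts (fst (adj_space G))"
    unfolding coord_def by (rule assoc_point(1)[OF gspace_adj adj_atlas x(1) p x(2)[symmetric]])
  then show ?thesis by (simp add: adj_space_simps pts_lie_algebra_man)
qed

lemma coord_ract:
  assumes p: "p \<in> pts (tot P)" and k: "k \<in> carrier G"
  shows "coord (ract P p k) = Ad G (inv k) (coord p)"
proof -
  note x = section_point[OF prj_pts[OF p]]
  show ?thesis
    unfolding coord_def prj_ract[OF p k]
    using bslash_ract[OF gspace_adj adj_atlas x(1) p x(2)[symmetric] k] by (simp add: adj_space_simps)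
qed

abbreviation X :: "'p \<Rightarrow> ('p, 'q) tangent" where "X \<equiv> gauge_field G P a"
abbreviation expt :: "('g, 'l) tangent \<Rightarrow> real \<Rightarrow> 'g" where "expt \<alpha> t \<equiv> lie_exp G (tscale t \<alpha>)"

text \<open>\<open>gauge_field\<close> is a definite description; the chain rule for the orbit map
  through \<open>p\<close> shows that the velocity it describes exists.\<close>

lemma gauge_field_velocity:
  assumes p: "p \<in> pts (tot P)"
  shows "has_velocity (tot P) (\<lambda>t. ract P p (expt (coord p) t)) (X p) 0"
proof -
  have "mdiff (mfd G) (tot P) (ract P p) (expt (coord p) 0)"
    by (rule ract_mdiff[OF p lie_exp_in[OF coord_in[OF p]]])
  from mdiff_velocity[OF group_atlas tot_at this lie_exp_velocity_0[OF coord_in[OF p]]]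
  have v: "has_velocity (tot P) (\<lambda>t. ract P p (expt (coord p) t))
    (tangent_map (mfd G) (tot P) (ract P p) (expt (coord p) 0) (coord p)) 0" .
  from velocity_eq[OF this] v show ?thesis by (simp add: gauge_field_def coord_def)
qed

lemma gauge_field_vertical:
  assumes p: "p \<in> pts (tot P)" shows "tangent_map (tot P) M (prj P) p (X p) = tzero"
proof -
  let ?c = "\<lambda>t. ract P p (expt (coord p) t)"
  have c0: "?c 0 = p" by (simp add: lie_exp_curve(2)[OF coord_in[OF p]] ract_one[OF p])
  have c: "prj P (?c t) = prj P p" for t by (rule prj_ract[OF p lie_exp_in[OF coord_in[OF p]]])
  have "mdiff (tot P) M (prj P) (?c 0)" unfolding c0 by (rule prj_mdiff[OF p])
  from mdiff_velocity[OF tot_at base_at this gauge_field_velocity[OF p]]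
  have "has_velocity M (\<lambda>t. prj P p) (tangent_map (tot P) M (prj P) p (X p)) 0" by (simp only: c c0)
  from has_velocity_unique[OF this has_velocity_const[OF base_at prj_pts[OF p]]] show ?thesis .
qed

lemma base_gauge_field: "base_field M P X = (\<lambda>_. tzero)"
  unfolding base_field_def using gauge_field_vertical[OF frame_in(1)] by auto

text \<open>At q = p exp(t\<alpha>) the coordinate is Ad(exp(-t\<alpha>))\<alpha> = \<alpha>, so the
  curve that defines the field at q is the given curve shifted in time by t.\<close>

lemma gauge_integral_curve:
  assumes p: "p \<in> pts (tot P)"
  shows "integral_curve (tot P) X UNIV (\<lambda>t. ract P p (expt (coord p) t))"
proof (rule integral_curveI)
  fix t :: real
  let ?\<alpha> = "coord p"
  have \<alpha>: "?\<alpha> \<in> lie_algebra G" by (rule coord_in[OF p])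
  have E: "expt ?\<alpha> s \<in> carrier G" for s by (rule lie_exp_in[OF \<alpha>])
  define q where "q = ract P p (expt ?\<alpha> t)"
  have q: "q \<in> pts (tot P)" unfolding q_def by (rule ract_closed[OF p E])
  have "coord q = Ad G (expt ?\<alpha> (- t)) ?\<alpha>"
    unfolding q_def coord_ract[OF p E] lie_exp_minus[OF \<alpha>] ..
  then have cq: "coord q = ?\<alpha>" by (simp add: Ad_lie_exp[OF \<alpha>])
  have "((\<lambda>s. s - t) has_real_derivative 1) (at t)" by (auto intro!: derivative_eq_intros)
  from has_velocity_reparam[where f = "\<lambda>s. s - t", OF _ this tot_at, of "\<lambda>s. ract P q (expt (coord q) s)" "X q"]
  have "has_velocity (tot P) (\<lambda>s. ract P q (expt ?\<alpha> (s - t))) (X q) t"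
    using gauge_field_velocity[OF q] by (simp add: cq tscale_def)
  moreover have "ract P q (expt ?\<alpha> (s - t)) = ract P p (expt ?\<alpha> s)" for s
    unfolding q_def using ract_ract[OF p E E, of t "s - t"] lie_exp_add[OF \<alpha>, of t "s - t"] by simp
  ultimately show "has_velocity (tot P) (\<lambda>t. ract P p (expt ?\<alpha> t)) (X (ract P p (expt ?\<alpha> t))) t"
    by (simp add: q_def)
qed auto

text \<open>An integral curve of the vertical field stays in one fibre and so has the form \<open>p k(t)\<close>; the
  equivariance of the field makes \<open>k\<close> a solution of a right-invariant equation, whence
  \<open>exp (- t\<alpha>) k(t)\<close> has velocity zero. No regularity of the section is used.\<close>

lemma gauge_integral_curve_unique:
  assumes \<gamma>: "integral_curve (tot P) X I \<gamma>" and I: "0 \<in> I" "t \<in> I" and p: "\<gamma> 0 = p"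
  shows "\<gamma> t = ract P p (expt (coord p) t)"
proof -
  note o = integral_curveD(1,2)[OF \<gamma>]
  have in_P: "\<gamma> s \<in> pts (tot P)" if "s \<in> I" for s
    by (rule has_velocityD(1)[OF integral_curveD(3)[OF \<gamma> that]])
  have pP: "p \<in> pts (tot P)" using in_P[OF I(1)] p by simp
  let ?\<alpha> = "coord p"
  have \<alpha>: "?\<alpha> \<in> lie_algebra G" by (rule coord_in[OF pP])
  have E: "expt ?\<alpha> s \<in> carrier G" for s by (rule lie_exp_in[OF \<alpha>])
  \<comment> \<open>The projected curve has velocity zero and thus stays at one point, so a single
    trivialization covers all of \<gamma>.\<close>
  have prj0: "has_velocity M (\<lambda>s. prj P (\<gamma> s)) tzero s" if s: "s \<in> I" for s
    using mdiff_velocity[OF tot_at base_at prj_mdiff[OF in_P[OF s]] integral_curveD(3)[OF \<gamma> s]]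
    by (simp add: gauge_field_vertical[OF in_P[OF s]])
  have prj_const: "prj P (\<gamma> s) = prj P p" if s: "s \<in> I" for s
    using zero_velocity_constant[where \<gamma> = "\<lambda>s. prj P (\<gamma> s)", OF base_at o prj0 s I(1)] p by simp
  obtain U \<tau> where U: "prj P p \<in> U"
    and md: "\<And>q. q \<in> pts (tot P) \<Longrightarrow> prj P q \<in> U \<Longrightarrow> mdiff (tot P) (mfd G) \<tau> q"
    and eqv: "\<And>q g. q \<in> pts (tot P) \<Longrightarrow> g \<in> carrier G \<Longrightarrow> prj P q \<in> U \<Longrightarrow> \<tau> (ract P q g) = \<tau> q \<otimes> g"
    and inj: "\<And>q q'. q \<in> pts (tot P) \<Longrightarrow> q' \<in> pts (tot P) \<Longrightarrow> prj P q \<in> U \<Longrightarrow> prj P q = prj P q' \<Longrightarrow>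
      \<tau> q = \<tau> q' \<Longrightarrow> q = q'"
    by (rule trivialization[OF prj_pts[OF pP]]) (rule that)
  have in_U: "prj P (\<gamma> s) \<in> U" if "s \<in> I" for s using prj_const[OF that] U by simp
  have \<tau>p: "\<tau> p \<in> carrier G" by (rule mdiff_in_carrier[OF md[OF pP U]])
  \<comment> \<open>The group element that carries \<open>p\<close> to \<open>q\<close> within the
    fibre, expressed by the trivialization.\<close>
  define \<kappa> where "\<kappa> q = inv (\<tau> p) \<otimes> \<tau> q" for q
  have \<kappa>in: "\<kappa> (\<gamma> s) \<in> carrier G" if "s \<in> I" for s
    unfolding \<kappa>_def using \<tau>p mdiff_in_carrier[OF md[OF in_P[OF that] in_U[OF that]]] by simp
  have \<kappa>md: "mdiff (tot P) (mfd G) \<kappa> (\<gamma> s)" if s: "s \<in> I" for s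
    unfolding \<kappa>_def[abs_def]
    by (rule mdiff_compose[where f = \<tau> and g = "\<lambda>k. inv (\<tau> p) \<otimes> k", OF tot_at group_atlas group_atlas md[OF in_P[OF s] in_U[OF s]]])
      (rule lmult_mdiff, use \<tau>p mdiff_in_carrier[OF md[OF in_P[OF s] in_U[OF s]]] in simp_all)
  have \<gamma>k: "\<gamma> s = ract P p (\<kappa> (\<gamma> s))" if s: "s \<in> I" for s
  proof (rule inj[OF in_P[OF s] ract_closed[OF pP \<kappa>in[OF s]] in_U[OF s]])
    show "prj P (\<gamma> s) = prj P (ract P p (\<kappa> (\<gamma> s)))"
      using prj_const[OF s] prj_ract[OF pP \<kappa>in[OF s]] by simp
    have "\<tau> (ract P p (\<kappa> (\<gamma> s))) = \<tau> p \<otimes> (inv (\<tau> p) \<otimes> \<tau> (\<gamma> s))"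
      using eqv[OF pP \<kappa>in[OF s] U] by (simp add: \<kappa>_def)
    also have "\<dots> = (\<tau> p \<otimes> inv (\<tau> p)) \<otimes> \<tau> (\<gamma> s)"
      using \<tau>p mdiff_in_carrier[OF md[OF in_P[OF s] in_U[OF s]]] by (intro m_assoc[symmetric]) simp_all
    also have "\<dots> = \<tau> (\<gamma> s)" using \<tau>p mdiff_in_carrier[OF md[OF in_P[OF s] in_U[OF s]]] by simp
    finally show "\<tau> (\<gamma> s) = \<tau> (ract P p (\<kappa> (\<gamma> s)))" by simp
  qed
  \<comment> \<open>The tangent map of \<kappa> is evaluated on the curve that defines
    \<open>X\<close> at \<open>?q\<close>, along which \<kappa> is explicit; the result transfers to
    \<gamma>, which has the same velocity there.\<close>
  have kvel: "has_velocity (mfd G) (\<lambda>s. \<kappa> (\<gamma> s)) (left_field G (Ad G (inv (\<kappa> (\<gamma> s0))) ?\<alpha>) (\<kappa> (\<gamma> s0))) s0"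
    if s0: "s0 \<in> I" for s0
  proof -
    let ?q = "\<gamma> s0" and ?k = "\<kappa> (\<gamma> s0)"
    let ?\<beta> = "coord ?q"
    have q: "?q \<in> pts (tot P)" by (rule in_P[OF s0])
    have k: "?k \<in> carrier G" by (rule \<kappa>in[OF s0])
    have \<beta>: "?\<beta> \<in> lie_algebra G" by (rule coord_in[OF q])
    have \<beta>eq: "?\<beta> = Ad G (inv ?k) ?\<alpha>"
      using coord_ract[OF pP k] \<gamma>k[OF s0] by simp
    let ?c = "\<lambda>t. ract P ?q (expt ?\<beta> t)"
    have c0: "?c 0 = ?q" by (simp add: lie_exp_curve(2)[OF \<beta>] ract_one[OF q])
    have "mdiff (tot P) (mfd G) \<kappa> (?c 0)" unfolding c0 by (rule \<kappa>md[OF s0])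
    from mdiff_velocity[OF tot_at group_atlas this gauge_field_velocity[OF q]]
    have v1: "has_velocity (mfd G) (\<lambda>t. \<kappa> (?c t)) (tangent_map (tot P) (mfd G) \<kappa> ?q (X ?q)) 0"
      by (simp only: c0)
    have "\<kappa> (?c t) = ?k \<otimes> expt ?\<beta> t" for t
      unfolding \<kappa>_def eqv[OF q lie_exp_in[OF \<beta>] in_U[OF s0]]
      using \<tau>p lie_exp_in[OF \<beta>, of t] mdiff_in_carrier[OF md[OF q in_U[OF s0]]] by (simp add: m_assoc)
    then have v2: "has_velocity (mfd G) (\<lambda>t. ?k \<otimes> expt ?\<beta> t) (tangent_map (tot P) (mfd G) \<kappa> ?q (X ?q)) 0"
      using v1 by simp
    have "has_velocity (mfd G) (\<lambda>t. ?k \<otimes> expt ?\<beta> t) (left_field G ?\<beta> ?k) 0"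
      using integral_curveD(3)[OF integral_curve_translate[OF \<beta> lie_exp_curve(1)[OF \<beta>] k] UNIV_I, of 0] k
      by (simp add: lie_exp_curve(2)[OF \<beta>])
    from has_velocity_unique[OF v2 this]
    show ?thesis
      using mdiff_velocity[OF tot_at group_atlas \<kappa>md[OF s0] integral_curveD(3)[OF \<gamma> s0]] \<beta>eq by simp
  qed
  have zero: "has_velocity (mfd G) (\<lambda>s. expt ?\<alpha> (- s) \<otimes> \<kappa> (\<gamma> s)) tzero s0" if s0: "s0 \<in> I" for s0
  proof -
    let ?k = "\<kappa> (\<gamma> s0)" and ?e = "\<lambda>s. expt ?\<alpha> (- s)"
    have k: "?k \<in> carrier G" by (rule \<kappa>in[OF s0])
    have "((\<lambda>s. - s) has_real_derivative -1) (at s0)" by (auto intro!: derivative_eq_intros)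
    from has_velocity_reparam[where f = "\<lambda>s. - s", OF integral_curveD(3)[OF lie_exp_curve(1)[OF \<alpha>] UNIV_I] this group_atlas]
    obtain w where w: "has_velocity (mfd G) ?e w s0" by blast
    \<comment> \<open>A comparison curve with the value and velocity at \<open>s0\<close> of
      \<kappa> along \<gamma>. The product rule depends on these data only, and \<open>?e s\<close>
      times \<open>\<delta> s\<close> is constant in \<open>s\<close>; so \<open>?Z\<close>
      vanishes, and \<open>w\<close> never has to be computed.\<close>
    define \<delta> where "\<delta> s = expt ?\<alpha> (s - s0) \<otimes> ?k" for s
    have \<delta>0: "\<delta> s0 = ?k" by (simp add: \<delta>_def lie_exp_curve(2)[OF \<alpha>] k)
    have "((\<lambda>s. s - s0) has_real_derivative 1) (at s0)" by (auto intro!: derivative_eq_intros)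
    from has_velocity_reparam[where f = "\<lambda>s. s - s0", OF _ this group_atlas, of "expt ?\<alpha>" ?\<alpha>]
    have sh: "has_velocity (mfd G) (\<lambda>s. expt ?\<alpha> (s - s0)) ?\<alpha> s0"
      using lie_exp_velocity_0[OF \<alpha>] by (simp add: tscale_def)
    have cj: "has_velocity (mfd G) (\<lambda>s. conj_act G (inv ?k) (expt ?\<alpha> (s - s0))) (Ad G (inv ?k) ?\<alpha>) s0"
      by (rule Ad_velocity[OF sh]) (use k in \<open>simp_all add: lie_exp_curve(2)[OF \<alpha>]\<close>)
    have c1: "conj_act G (inv ?k) (expt ?\<alpha> (s0 - s0)) = \<one>"
      using k by (simp add: lie_exp_curve(2)[OF \<alpha>] conj_one)
    have "mdiff (mfd G) (mfd G) (\<lambda>g. ?k \<otimes> g) (conj_act G (inv ?k) (expt ?\<alpha> (s0 - s0)))"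
      unfolding c1 by (rule lmult_mdiff[OF k one_closed])
    from mdiff_velocity[OF group_atlas group_atlas this cj]
    have "has_velocity (mfd G) (\<lambda>s. ?k \<otimes> conj_act G (inv ?k) (expt ?\<alpha> (s - s0)))
        (left_field G (Ad G (inv ?k) ?\<alpha>) ?k) s0"
      unfolding c1 by (simp add: left_field_def)
    moreover have "?k \<otimes> conj_act G (inv ?k) (expt ?\<alpha> (s - s0)) = \<delta> s" for s
    proof -
      have "?k \<otimes> conj_act G (inv ?k) (expt ?\<alpha> (s - s0)) = ?k \<otimes> (inv ?k \<otimes> (expt ?\<alpha> (s - s0) \<otimes> ?k))"
        using k E[of "s - s0"] by (simp add: conj_act_def m_assoc)
      also have "\<dots> = (?k \<otimes> inv ?k) \<otimes> (expt ?\<alpha> (s - s0) \<otimes> ?k)"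
        using k E[of "s - s0"] by (intro m_assoc[symmetric]) simp_all
      finally show ?thesis using k E[of "s - s0"] by (simp add: \<delta>_def)
    qed
    ultimately have \<delta>v: "has_velocity (mfd G) \<delta> (left_field G (Ad G (inv ?k) ?\<alpha>) ?k) s0" by simp
    have mm: "mdiff (prod_man (mfd G) (mfd G)) (mfd G) (\<lambda>(g, k). g \<otimes> k) (?e s0, ?k)"
      by (rule mult_mdiff[OF E k])
    let ?Z = "tplus (tangent_map (mfd G) (mfd G) (\<lambda>x. x \<otimes> ?k) (?e s0) w)
      (tangent_map (mfd G) (mfd G) (\<lambda>y. ?e s0 \<otimes> y) ?k (left_field G (Ad G (inv ?k) ?\<alpha>) ?k))"
    have z1: "has_velocity (mfd G) (\<lambda>s. ?e s \<otimes> \<kappa> (\<gamma> s)) ?Z s0"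
      using has_velocity_product[where \<gamma> = ?e and \<delta> = "\<lambda>s. \<kappa> (\<gamma> s)", OF group_atlas group_atlas group_atlas mm w kvel[OF s0]] by simp
    have "mdiff (prod_man (mfd G) (mfd G)) (mfd G) (\<lambda>(g, k). g \<otimes> k) (?e s0, \<delta> s0)"
      using mm by (simp add: \<delta>0)
    from has_velocity_product[where \<gamma> = ?e and \<delta> = \<delta>, OF group_atlas group_atlas group_atlas this w \<delta>v]
    have z2: "has_velocity (mfd G) (\<lambda>s. ?e s \<otimes> \<delta> s) ?Z s0" by (simp add: \<delta>0)
    have "?e s \<otimes> \<delta> s = expt ?\<alpha> (- s0) \<otimes> ?k" for s
      unfolding \<delta>_def using m_assoc[OF E E k, of "- s" "s - s0"] lie_exp_add[OF \<alpha>, of "- s" "s - s0"] by simp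
    then have "has_velocity (mfd G) (\<lambda>s. expt ?\<alpha> (- s0) \<otimes> ?k) ?Z s0" using z2 by simp
    moreover have "has_velocity (mfd G) (\<lambda>s. expt ?\<alpha> (- s0) \<otimes> ?k) tzero s0"
      by (rule has_velocity_const[OF group_atlas]) (simp add: pts_mfd E k)
    ultimately have "?Z = tzero" by (rule has_velocity_unique)
    then show ?thesis using z1 by simp
  qed
  have k0: "\<kappa> (\<gamma> 0) = \<one>" unfolding p \<kappa>_def using \<tau>p by simp
  have "expt ?\<alpha> (- t) \<otimes> \<kappa> (\<gamma> t) = expt ?\<alpha> (- 0) \<otimes> \<kappa> (\<gamma> 0)"
    by (rule zero_velocity_constant[where \<gamma> = "\<lambda>s. expt ?\<alpha> (- s) \<otimes> \<kappa> (\<gamma> s)", OF group_atlas o zero I(2,1)])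
  then have "inv (expt ?\<alpha> t) \<otimes> \<kappa> (\<gamma> t) = \<one>"
    by (simp add: k0 lie_exp_minus[OF \<alpha>, of t] lie_exp_curve(2)[OF \<alpha>])
  then have "\<kappa> (\<gamma> t) = expt ?\<alpha> t"
    using E[of t] \<kappa>in[OF I(2)] by (metis inv_equality inv_inv inv_closed)
  then show ?thesis using \<gamma>k[OF I(2)] by simp
qed

lemma flow_gauge_field:
  assumes p: "p \<in> pts (tot P)"
  shows "flow (tot P) X t p = ract P p (expt (coord p) t)"
  unfolding flow_def
proof (rule the_equality)
  have "ract P p (expt (coord p) 0) = p" by (simp add: lie_exp_curve(2)[OF coord_in[OF p]] ract_one[OF p])
  then show "\<exists>I \<gamma>. integral_curve (tot P) X I \<gamma> \<and> 0 \<in> I \<and> t \<in> I \<and> \<gamma> 0 = p \<and> \<gamma> t = ract P p (expt (coord p) t)"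
    using gauge_integral_curve[OF p] by blast
  fix y assume "\<exists>I \<gamma>. integral_curve (tot P) X I \<gamma> \<and> 0 \<in> I \<and> t \<in> I \<and> \<gamma> 0 = p \<and> \<gamma> t = y"
  then obtain I \<gamma> where "integral_curve (tot P) X I \<gamma>" "0 \<in> I" "t \<in> I" "\<gamma> 0 = p" "\<gamma> t = y" by blast
  then show "y = ract P p (expt (coord p) t)" using gauge_integral_curve_unique[of I \<gamma> t p] by simp
qed

section \<open>The Darboux-Lie derivative along the gauge field\<close>

lemma conj_atlas: "smooth_atlas (fst (conj_space G))"
  by (simp add: conj_space_simps group_atlas)

lemma darboux_lie_gauge_field:
  assumes F: "natural_bundle S F" and h: "bundle_map G M P (conj_space G) (nb_obj F M) (nb_proj F M) h"
    and y: "y \<in> pts (nb_obj F M)"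
  shows "darboux_lie F G M P X h y = ad_minus G P (a (nb_proj F M y)) (Ad_map G P (fibre_inv G P h) a y)"
proof -
  let ?N = "conj_space G" and ?K = "adj_space G"
  let ?Q = "assoc_man G M P ?N"
  define x where "x = nb_proj F M y"
  define p where "p = frame P x"
  define g where "g = bslash G P ?N p (h y)"
  define \<alpha> where "\<alpha> = bslash G P ?K p (a x)"
  note nb = natural_bundleD[OF F base_man]
  have E_at: "smooth_atlas (nb_obj F M)" by (rule is_manifold_smooth_atlas[OF nb(1)])
  have Q_at: "smooth_atlas ?Q" by (rule assoc_at[OF gspace_conj conj_atlas])
  have hsm: "smooth_map (nb_obj F M) ?Q h" and hx: "assoc_prj P (h y) = x"
    using h y by (simp_all add: bundle_map_def x_def)
  have hQ: "h y \<in> pts ?Q" by (rule smooth_map_pts[OF hsm y])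
  have xM: "x \<in> pts M" unfolding x_def by (rule smooth_map_pts[OF nb(2) y])
  have p: "p \<in> pts (tot P)" "prj P p = x" unfolding p_def using frame_in[OF xM] by simp_all
  have "prj P p = assoc_prj P (h y)" using p(2) hx by simp
  note gz = assoc_point[OF gspace_conj conj_atlas hQ p(1) this]
  have g: "g \<in> carrier G" using gz(1) by (simp add: g_def conj_space_simps pts_mfd)
  have hyg: "cls G P ?N p g = h y" using gz(2) by (simp add: g_def)
  have \<alpha>c: "\<alpha> = coord p" by (simp add: \<alpha>_def coord_def p(2))
  have \<alpha>: "\<alpha> \<in> lie_algebra G" unfolding \<alpha>c by (rule coord_in[OF p(1)])
  let ?\<eta> = "tminus \<alpha> (Ad G (inv g) \<alpha>)"
  have Ad\<alpha>: "Ad G (inv g) \<alpha> \<in> lie_algebra G" using Ad_closed g \<alpha> by simp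
  have \<eta>: "?\<eta> \<in> lie_algebra G" by (rule lie_algebra_minus[OF \<alpha> Ad\<alpha>])
  have zQ: "cls G P ?N p g \<in> pts ?Q" using hyg hQ by simp
  have gN: "g \<in> pts (fst ?N)" using g by (simp add: conj_space_simps pts_mfd)
  have act: "mdiff (fst ?N) (fst ?N) (snd ?N b) k" if "b \<in> carrier G" "k \<in> pts (fst ?N)" for b k
    using that conj_mdiff by (simp add: conj_space_simps pts_mfd)
  \<comment> \<open>A left inverse of the fibre inclusion, differentiable at the point; it recovers
    \<open>Z\<close> from \<open>W\<close> below.\<close>
  obtain \<rho> where "mdiff (fst ?N) ?Q (cls G P ?N p) g" "mdiff ?Q (fst ?N) \<rho> (cls G P ?N p g)"
    "\<And>k. k \<in> pts (fst ?N) \<Longrightarrow> \<rho> (cls G P ?N p k) = k"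
    by (rule fibre_inclusion[OF gspace_conj conj_atlas p(1) gN zQ act], assumption, assumption) (rule that)
  then have incl: "mdiff (mfd G) ?Q (cls G P ?N p) g" and \<rho>: "mdiff ?Q (mfd G) \<rho> (cls G P ?N p g)"
    and left: "\<And>k. k \<in> carrier G \<Longrightarrow> \<rho> (cls G P ?N p k) = k"
    by (simp_all add: conj_space_simps pts_mfd)
  let ?j = "cls G P ?N p" and ?T = "tangent_map (mfd G) ?Q (cls G P ?N p) g"
  define W where "W = tminus (tangent_map (nb_obj F M) ?Q h y (canonical_lift F M (base_field M P X) y))
    (assoc_field G M P X (h y))"
  have lift0: "tangent_map (nb_obj F M) ?Q h y (canonical_lift F M (base_field M P X) y) = tzero"
    unfolding base_gauge_field canonical_lift_tzero[OF F base_man]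
    by (rule tangent_map_linear(3)[OF smooth_map_mdiff[OF hsm E_at subset_refl Q_at subset_refl y]])
  have cj0: "conj_act G (expt \<alpha> 0) g = g" by (simp add: lie_exp_curve(2)[OF \<alpha>] conj_by_one[OF g])
  have "mdiff (mfd G) ?Q ?j (conj_act G (expt \<alpha> 0) g)" unfolding cj0 by (rule incl)
  from mdiff_velocity[OF group_atlas Q_at this conj_lie_exp_velocity[OF \<alpha> g]]
  have "has_velocity ?Q (\<lambda>t. ?j (conj_act G (expt \<alpha> t) g)) (?T (left_field G (tminus (Ad G (inv g) \<alpha>) \<alpha>) g)) 0"
    unfolding cj0 .
  \<comment> \<open>A change of representative moves exp(t\<alpha>) from the frame to the second
    component, so the flow curve lies in the image of \<open>?j\<close> for the fixed frame
    \<open>p\<close>.\<close>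
  moreover have "?j (conj_act G (expt \<alpha> t) g) = cls G P ?N (flow (tot P) X t p) g" for t
    using cls_ract[OF gspace_conj p(1) _ lie_exp_in[OF \<alpha>], of g t] g flow_gauge_field[OF p(1), of t]
    by (simp add: \<alpha>c[symmetric] conj_space_simps pts_mfd)
  ultimately have "has_velocity ?Q (\<lambda>t. cls G P ?N (flow (tot P) X t p) g)
      (?T (left_field G (tminus (Ad G (inv g) \<alpha>) \<alpha>) g)) 0" by simp
  from velocity_eq[OF this]
  have af: "assoc_field G M P X (h y) = ?T (left_field G (tminus (Ad G (inv g) \<alpha>) \<alpha>) g)"
    by (simp add: assoc_field_def Let_def hx p_def[symmetric] g_def[symmetric])
  have neg: "left_field G ?\<eta> g = tscale (- 1) (left_field G (tminus (Ad G (inv g) \<alpha>) \<alpha>) g)"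
    unfolding left_field_minus[OF g] by (rule ext) (simp add: tminus_def tscale_def)
  have W: "W = ?T (left_field G ?\<eta> g)"
    unfolding W_def lift0 af neg tangent_map_linear(2)[OF incl]
    by (rule ext) (simp add: tminus_def tscale_def tzero_def)
  let ?C = "\<lambda>Z. \<exists>I \<gamma>. open I \<and> is_interval I \<and> 0 \<in> I \<and> smooth_map (open_sub line I) (mfd G) \<gamma> \<and> \<gamma> 0 = g \<and>
                 has_velocity (mfd G) \<gamma> Z 0 \<and> has_velocity ?Q (\<lambda>t. ?j (\<gamma> t)) W 0"
  \<comment> \<open>Existence is witnessed by a smooth curve through \<open>g\<close>. Uniqueness
    holds because every admissible \<open>Z\<close> is the image of \<open>W\<close> under the
    tangent map of \<rho>.\<close>
  have the_Z: "(THE Z. ?C Z) = left_field G ?\<eta> g"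
  proof (rule the_equality)
    have gp: "g \<in> pts (mfd G)" by (simp add: pts_mfd g)
    obtain I \<gamma> where \<gamma>: "open I" "is_interval I" "0 \<in> I" "smooth_map (open_sub line I) (mfd G) \<gamma>" "\<gamma> 0 = g"
      "has_velocity (mfd G) \<gamma> (left_field G ?\<eta> g) 0"
      by (rule tangent_smooth_curve[OF group_atlas gp left_field_in[OF \<eta> g]]) (rule that)
    have "mdiff (mfd G) ?Q ?j (\<gamma> 0)" unfolding \<gamma>(5) by (rule incl)
    from mdiff_velocity[OF group_atlas Q_at this \<gamma>(6)]
    have "has_velocity ?Q (\<lambda>t. ?j (\<gamma> t)) W 0" unfolding W \<gamma>(5) .
    then show C0: "?C (left_field G ?\<eta> g)" using \<gamma> by blast
    have recover: "Z = tangent_map ?Q (mfd G) \<rho> (?j g) W" if Z: "?C Z" for Z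
    proof -
      obtain I \<gamma> where \<gamma>: "\<gamma> 0 = g" "has_velocity (mfd G) \<gamma> Z 0" "has_velocity ?Q (\<lambda>t. ?j (\<gamma> t)) W 0"
        using Z by blast
      have "mdiff ?Q (mfd G) \<rho> (?j (\<gamma> 0))" unfolding \<gamma>(1) by (rule \<rho>)
      from mdiff_velocity[OF Q_at group_atlas this \<gamma>(3)]
      have "has_velocity (mfd G) (\<lambda>t. \<rho> (?j (\<gamma> t))) (tangent_map ?Q (mfd G) \<rho> (?j g) W) 0" unfolding \<gamma>(1) .
      moreover have "\<forall>\<^sub>F t in nhds 0. \<rho> (?j (\<gamma> t)) = \<gamma> t"
        using has_velocity_pts[OF \<gamma>(2)] by eventually_elim (simp add: pts_mfd left)
      ultimately have "has_velocity (mfd G) \<gamma> (tangent_map ?Q (mfd G) \<rho> (?j g) W) 0"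
        by (rule has_velocity_cong)
      from has_velocity_unique[OF \<gamma>(2) this] show ?thesis .
    qed
    show "Z = left_field G ?\<eta> g" if "?C Z" for Z
      using recover[OF that] recover[OF C0] by simp
  qed
  have "darboux_lie F G M P X h y = cls G P ?K p (maurer_cartan G g (THE Z. ?C Z))"
    unfolding darboux_lie_def Let_def x_def[symmetric] p_def[symmetric] g_def[symmetric] W_def[symmetric] ..
  also have "\<dots> = cls G P ?K p ?\<eta>" unfolding the_Z maurer_cartan_left_field[OF \<eta> g] ..
  finally have lhs: "darboux_lie F G M P X h y = cls G P ?K p ?\<eta>" .
  \<comment> \<open>All constructions on the right-hand side choose the frame over \<open>x\<close>,
    so their coordinates refer to the same \<open>p\<close> and reduce to \<alpha> and
    \<open>g\<close>.\<close>
  have fi: "fibre_inv G P h y = cls G P ?N p (inv g)"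
    by (simp add: fibre_inv_def Let_def hx p_def[symmetric] g_def[symmetric])
  have fip: "assoc_prj P (fibre_inv G P h y) = x" unfolding fi using assoc_prj_cls[OF p(1)] p(2) by simp
  have fib: "bslash G P ?N p (fibre_inv G P h y) = inv g"
    unfolding fi by (rule bslash_cls[OF gspace_conj p(1)]) (use g in \<open>simp add: conj_space_simps pts_mfd\<close>)
  have Am: "Ad_map G P (fibre_inv G P h) a y = cls G P ?K p (Ad G (inv g) \<alpha>)"
    by (simp add: Ad_map_def Let_def fip p_def[symmetric] fib \<alpha>_def[symmetric])
  have bA: "bslash G P ?K p (Ad_map G P (fibre_inv G P h) a y) = Ad G (inv g) \<alpha>"
    unfolding Am by (rule bslash_cls[OF gspace_adj p(1)]) (simp add: adj_space_simps pts_lie_algebra_man Ad\<alpha>)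
  have "ad_minus G P (a x) (Ad_map G P (fibre_inv G P h) a y) = cls G P ?K p ?\<eta>"
    by (simp add: ad_minus_def Let_def section_point(2)[OF xM] p_def[symmetric] bA \<alpha>_def[symmetric])
  then show ?thesis using lhs by (simp add: x_def)
qed

end

theorem proposition6p2:
  fixes F :: "('m, 'e::model_space, 'f, 'k::model_space) functor_data"
    and S :: "('s, 'd::model_space) manifold"
    and M :: "('m, 'e) manifold"
    and G :: "('g, 'l::model_space) lie_group"
    and P :: "('p, 'q::model_space, 'm, 'g) principal_data"
    and a :: "'m \<Rightarrow> ('p \<times> ('g, 'l) tangent) set"
    and h :: "'f \<Rightarrow> ('p \<times> 'g) set"
  assumes "natural_bundle S F"
    and "is_manifold M"
    and "is_lie_group G"
    and "principal_bundle G M P"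
    and "assoc_section G M P (adj_space G) a"
    and "bundle_map G M P (conj_space G) (nb_obj F M) (nb_proj F M) h"
  shows "\<forall>y\<in>pts (nb_obj F M).
    darboux_lie F G M P (gauge_field G P a) h y =
      ad_minus G P (a (nb_proj F M y)) (Ad_map G P (fibre_inv G P h) a y)"
proof -
  have "group G" using assms(3) by (simp add: is_lie_group_def)
  then interpret gauge G M P a
    using assms(3-5) by (simp add: gauge_def gauge_axioms_def principal_def principal_axioms_def lie_grp_def lie_grp_axioms_def)
  show ?thesis using darboux_lie_gauge_field[OF assms(1,6)] by blast
qed

end
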